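(* If $L^\star(\Lambda)$ is an inverse-closed, $*$-closed $\sigma$-algebra, then $T^\star(\Lambda)$ is an inverse-closed $\sigma$-algebra.
   Context: Setting. $\Lambda$ is $\mathbb{R}^\ell$ or a sectorial domain in the complex plane. With every "datum" $g$ there is associated a scale of Hilbert spaces $H^s(g)$, $s\in\mathbb{N}_0$, with continuous inclusions $H^{s+1}(g)\subset H^s(g)$. $\mathbf{G}$ is a set of admissible pairs $\mathbf{g}=(g_0,g_1)$ of data; write $\mathbf{g}^{(-1)}=(g_1,g_0)$, $\mathbf{g}_0=(g_0,g_0)$, $\mathbf{g}_1=(g_1,g_1)$ (also admissible); if $(g_0,g_1),(g_1,g_2)$ are admissible, so is $(g_0,g_2)$. For admissible $\mathbf{g}$ and integers $\mu\le0$, $L^\mu(\mathbf{g};\Lambda)$ is a vector space of families of operators $\lambda\mapsto A(\lambda)$, $\lambda\in\Lambda$, inducing continuous operators $A(\lambda):H^s(g_0)\to H^{s-\mu}(g_1)$ for all $\lambda$ and all $s$. Assume $L^\mu(\mathbf{g};\Lambda)\subset L^\nu(\mathbf{g};\Lambda)$ for $\mu\le\nu$, that pointwise composition maps $L^\mu((g_1,g_2);\Lambda)\times L^\nu((g_0,g_1);\Lambda)$ into $L^{\mu+\nu}((g_0,g_2);\Lambda)$, and that the identity belongs to $L^0((g,g);\Lambda)$. Let $L^{-\infty}(\mathbf{g};\Lambda)=\bigcap_{\mu\le0}L^\mu(\mathbf{g};\Lambda)$; its elements are required to satisfy $\|R(\lambda)\|_{H^s(g_0)\to H^t(g_1)}\to0$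 as $|\lambda|\to\infty$ for all $s,t$. $L^\star(\Lambda)$ is the union of all $L^\mu(\mathbf{g};\Lambda)$. $A(\lambda)\in L^0(\mathbf{g};\Lambda)$ is elliptic if there is $B(\lambda)\in L^0(\mathbf{g}^{(-1)};\Lambda)$ with $B(\lambda)A(\lambda)-1\in L^{-\infty}(\mathbf{g}_0;\Lambda)$ and $A(\lambda)B(\lambda)-1\in L^{-\infty}(\mathbf{g}_1;\Lambda)$. $L^\star(\Lambda)$ is inverse-closed if for any admissible $\mathbf{g}=(g,g)$ and $R(\lambda)\in L^{-\infty}(\mathbf{g};\Lambda)$ there is $S(\lambda)\in L^{-\infty}(\mathbf{g};\Lambda)$ with $(1+R(\lambda))(1+S(\lambda))=(1+S(\lambda))(1+R(\lambda))=1$ for sufficiently large $\lambda$. $L^\star(\Lambda)$ is $*$-closed if for every $A(\lambda)\in L^0(\mathbf{g};\Lambda)$ there is a family $A^*(\lambda)\in L^0(\mathbf{g}^{(-1)};\Lambda)$ such that $A^*(\lambda):H^0(g_1)\to H^0(g_0)$ is the adjoint of $A(\lambda):H^0(g_0)\to H^0(g_1)$ for every $\lambda$. $L^\star(\Lambda)$ is a $\sigma$-algebra if there is a (linear) map $A\mapsto\sigma(A)=(\sigma_1(A),\ldots,\sigma_n(A))$ assigning to each $A\in L^0(\mathbf{g};\Lambda)$ bundle morphisms $\sigma_\ell(A):E_\ell(g_0)\to E_\ell(g_1)$ between (finite or infinite dimensional) Hilbert space bundles such that: (1) $\sigma_\ell(BA)=\sigma_\ell(B)\sigma_\ell(A)$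 for composable $A,B$; (2) $\sigma(R)=0$ for smoothing $R$; (3) $A$ is elliptic iff all $\sigma_\ell(A)$ are bundle isomorphisms; and, in the $*$-closed case, (4) $\sigma_\ell(A^* )=\sigma_\ell(A)^*$ (fibrewise adjoint). Toeplitz subalgebras. For families of projections $P_j(\lambda)\in L^0(\mathbf{g}_j;\Lambda)$, $P_j(\lambda)^2=P_j(\lambda)$: $T^\mu(\mathbf{g},P_0,P_1;\Lambda)=P_1(\lambda)L^\mu(\mathbf{g};\Lambda)P_0(\lambda)$, $T^{-\infty}(\mathbf{g},P_0,P_1;\Lambda)=\bigcap_{\mu\le0}T^\mu(\mathbf{g},P_0,P_1;\Lambda)$, and $T^\star(\Lambda)$ is the union of all $T^\mu(\mathbf{g},P_0,P_1;\Lambda)$. $A(\lambda)\in T^0(\mathbf{g},P_0,P_1;\Lambda)$ is elliptic if there is $B(\lambda)\in T^0(\mathbf{g}^{(-1)},P_1,P_0;\Lambda)$ with $B(\lambda)A(\lambda)-P_0(\lambda)\in T^{-\infty}(\mathbf{g}_0,P_0,P_0;\Lambda)$ and $A(\lambda)B(\lambda)-P_1(\lambda)\in T^{-\infty}(\mathbf{g}_1,P_1,P_1;\Lambda)$. $T^\star(\Lambda)$ is inverse-closed if for every admissible $\mathbf{g}=(g,g)$, every projection $P(\lambda)\in L^0(\mathbf{g};\Lambda)$ and every $R(\lambda)\in T^{-\infty}(\mathbf{g},P,P;\Lambda)$ there is $S(\lambda)\in T^{-\infty}(\mathbf{g},P,P;\Lambda)$ with $(P(\lambda)+R(\lambda))(P(\lambda)+S(\lambda))=(P(\lambda)+S(\lambda))(P(\lambda)+R(\lambda))=P(\lambda)$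 for sufficiently large $\lambda$. $T^\star(\Lambda)$ is a $\sigma$-algebra means: (1)-(3) hold for ellipticity in $T^\star(\Lambda)$ and the symbol map $A\mapsto(\sigma_1(A,P_0,P_1),\ldots,\sigma_n(A,P_0,P_1))$ on $T^0(\mathbf{g},P_0,P_1;\Lambda)$, where $\sigma_\ell(A,P_0,P_1):\sigma_\ell(P_0)(E_\ell(g_0))\to\sigma_\ell(P_1)(E_\ell(g_1))$ is the restriction of $\sigma_\ell(A)$ to the subbundles given by the ranges of the projections $\sigma_\ell(P_j)$. In particular, $A$ is elliptic iff all $\sigma_\ell(A,P_0,P_1)$ are isomorphisms. *)

theory Defs
  imports "HOL-Analysis.Analysis" "HOL-Library.Function_Algebras"
begin

section \<open>Complex vector spaces and Hilbert spaces\<close>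

text \<open>The ambient types of the Hilbert spaces are mere complex vector spaces without topology. A
  Hilbert space is a linear subspace of such a type with an inner product of its own, so that a
  whole scale of spaces, or all fibres of a bundle, may live in one type (e.g. in the direct sum of
  the members of a family of unrelated spaces).\<close>

class complex_vector = ab_group_add +
  fixes scaleC :: "complex \<Rightarrow> 'a \<Rightarrow> 'a" (infixr "*\<^sub>C" 75)
  assumes scaleC_add_right: "a *\<^sub>C (x + y) = a *\<^sub>C x + a *\<^sub>C y"
    and scaleC_add_left: "(a + b) *\<^sub>C x = a *\<^sub>C x + b *\<^sub>C x"
    and scaleC_scaleC: "a *\<^sub>C (b *\<^sub>C x) = (a * b) *\<^sub>C x"
    and scaleC_one: "1 *\<^sub>C x = x"

global_interpretation complex_vector: vector_space "scaleC :: complex \<Rightarrow> 'a::complex_vector \<Rightarrow> 'a"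
  defines csubspace = complex_vector.subspace
  by unfold_locales (simp_all add: scaleC_add_right scaleC_add_left scaleC_scaleC scaleC_one)

instantiation "fun" :: (type, complex_vector) complex_vector
begin

definition scaleC_fun :: "complex \<Rightarrow> ('a \<Rightarrow> 'b) \<Rightarrow> 'a \<Rightarrow> 'b"
  where "scaleC_fun c f = (\<lambda>x. c *\<^sub>C f x)"

instance
  by standard
    (simp_all add: scaleC_fun_def fun_eq_iff scaleC_add_right scaleC_add_left scaleC_scaleC scaleC_one)

end

record 'a hilbert =
  hcar :: "'a set"
  hip :: "'a \<Rightarrow> 'a \<Rightarrow> complex"

definition hnorm :: "'a hilbert \<Rightarrow> 'a \<Rightarrow> real"
  where "hnorm H x = sqrt (Re (hip H x x))"

definition hilbert_space :: "'a::complex_vector hilbert \<Rightarrow> bool"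
  where "hilbert_space H \<longleftrightarrow>
    csubspace (hcar H) \<and>
    (\<forall>x\<in>hcar H. \<forall>y\<in>hcar H. \<forall>z\<in>hcar H. hip H (x + y) z = hip H x z + hip H y z) \<and>
    (\<forall>c. \<forall>x\<in>hcar H. \<forall>y\<in>hcar H. hip H (c *\<^sub>C x) y = c * hip H x y) \<and>
    (\<forall>x\<in>hcar H. \<forall>y\<in>hcar H. hip H y x = cnj (hip H x y)) \<and>
    (\<forall>x\<in>hcar H. 0 \<le> Re (hip H x x)) \<and>
    (\<forall>x\<in>hcar H. hip H x x = 0 \<longrightarrow> x = 0) \<and>
    (\<forall>X::nat \<Rightarrow> 'a.
       (\<forall>i. X i \<in> hcar H) \<and> (\<forall>e>0. \<exists>N. \<forall>i\<ge>N. \<forall>j\<ge>N. hnorm H (X i - X j) < e) \<longrightarrow>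
       (\<exists>x\<in>hcar H. (\<lambda>i. hnorm H (X i - x)) \<longlonglongrightarrow> 0))"

definition bounded_op :: "'a::complex_vector hilbert \<Rightarrow> 'b::complex_vector hilbert \<Rightarrow> ('a \<Rightarrow> 'b) \<Rightarrow> bool"
  where "bounded_op H K T \<longleftrightarrow>
    (\<forall>x\<in>hcar H. T x \<in> hcar K) \<and>
    (\<forall>x\<in>hcar H. \<forall>y\<in>hcar H. T (x + y) = T x + T y) \<and>
    (\<forall>c. \<forall>x\<in>hcar H. T (c *\<^sub>C x) = c *\<^sub>C T x) \<and>
    (\<exists>C. \<forall>x\<in>hcar H. hnorm K (T x) \<le> C * hnorm H x)"

definition opnorm :: "'a hilbert \<Rightarrow> 'b hilbert \<Rightarrow> ('a \<Rightarrow> 'b) \<Rightarrow> real"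
  where "opnorm H K T = (SUP x\<in>{x \<in> hcar H. hnorm H x \<le> 1}. hnorm K (T x))"

definition adjoint_op :: "'a hilbert \<Rightarrow> 'b hilbert \<Rightarrow> ('a \<Rightarrow> 'b) \<Rightarrow> ('b \<Rightarrow> 'a) \<Rightarrow> bool"
  where "adjoint_op H K T S \<longleftrightarrow>
    (\<forall>x\<in>hcar H. \<forall>y\<in>hcar K. hip K (T x) y = hip H x (S y))"

text \<open>Operators and bundle morphisms are extended by \<open>0\<close> outside their domains, so that equality of
  operators is equality of functions, and sums and compositions are the pointwise ones.\<close>

definition id_op :: "'a::complex_vector hilbert \<Rightarrow> 'a \<Rightarrow> 'a"
  where "id_op H x = (if x \<in> hcar H then x else 0)"

definition toplinear_iso :: "'a::complex_vector hilbert \<Rightarrow> 'b::complex_vector hilbert \<Rightarrow> ('a \<Rightarrow> 'b) \<Rightarrow> bool"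
  where "toplinear_iso H K T \<longleftrightarrow>
    bounded_op H K T \<and> bij_betw T (hcar H) (hcar K) \<and> bounded_op K H (inv_into (hcar H) T)"

definition pcomp :: "('i \<Rightarrow> 'b \<Rightarrow> 'c) \<Rightarrow> ('i \<Rightarrow> 'a \<Rightarrow> 'b) \<Rightarrow> 'i \<Rightarrow> 'a \<Rightarrow> 'c" (infixl "\<odot>" 70)
  where "B \<odot> A = (\<lambda>i. B i \<circ> A i)"

section \<open>Hilbert space bundles\<close>

text \<open>A trivialization \<open>(U, M, \<phi>)\<close> consists of an open set, a model Hilbert space, and the fibrewise
  maps \<open>\<phi> x : E\<^sub>x \<rightarrow> M\<close> for \<open>x \<in> U\<close>. As usual for vector bundles of possibly infinite rank, the
  transition maps and the local representatives of morphisms depend continuously on the base point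
  with respect to the operator norm; for finite rank this is the usual notion of continuity.\<close>

type_synonym ('x, 'f) chart = "'x set \<times> 'f hilbert \<times> ('x \<Rightarrow> 'f \<Rightarrow> 'f)"

record ('x, 'f) hbundle =
  base :: "'x topology"
  fibre :: "'x \<Rightarrow> 'f hilbert"
  charts :: "('x, 'f) chart set"

definition norm_continuous ::
    "'x topology \<Rightarrow> 'x set \<Rightarrow> 'a::complex_vector hilbert \<Rightarrow> 'b::complex_vector hilbert \<Rightarrow> ('x \<Rightarrow> 'a \<Rightarrow> 'b) \<Rightarrow> bool"
  where "norm_continuous X U M N T \<longleftrightarrow>
    (\<forall>x\<in>U. bounded_op M N (T x)) \<and>
    (\<forall>x\<^sub>0\<in>U. ((\<lambda>x. opnorm M N (T x - T x\<^sub>0)) \<longlongrightarrow> 0) (nhdsin (subtopology X U) x\<^sub>0))"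

definition trivialization ::
    "'x topology \<Rightarrow> ('x \<Rightarrow> 'f::complex_vector hilbert) \<Rightarrow> ('x, 'f) chart \<Rightarrow> bool"
  where "trivialization X F = (\<lambda>(U, M, \<phi>).
    openin X U \<and> hilbert_space M \<and> (\<forall>x\<in>U. toplinear_iso (F x) M (\<phi> x)))"

definition metric_continuous ::
    "'x topology \<Rightarrow> ('x \<Rightarrow> 'f::complex_vector hilbert) \<Rightarrow> ('x, 'f) chart \<Rightarrow> bool"
  where "metric_continuous X F = (\<lambda>(U, M, \<phi>).
    let G = (\<lambda>x u v. hip (F x) (inv_into (hcar (F x)) (\<phi> x) u) (inv_into (hcar (F x)) (\<phi> x) v)) in
    \<forall>x\<^sub>0\<in>U. \<forall>e>0. \<forall>\<^sub>F x in nhdsin (subtopology X U) x\<^sub>0. \<forall>u\<in>hcar M. \<forall>v\<in>hcar M.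
      cmod (G x u v - G x\<^sub>0 u v) \<le> e * hnorm M u * hnorm M v)"

definition continuous_rep ::
    "'x topology \<Rightarrow> ('x \<Rightarrow> 'f::complex_vector hilbert) \<Rightarrow> ('x, 'f) chart \<Rightarrow> ('x, 'f) chart \<Rightarrow>
      ('x \<Rightarrow> 'f \<Rightarrow> 'f) \<Rightarrow> bool"
  where "continuous_rep X F = (\<lambda>(U, M, \<phi>) (V, N, \<psi>) f.
    norm_continuous X (U \<inter> V) M N (\<lambda>x. \<psi> x \<circ> f x \<circ> inv_into (hcar (F x)) (\<phi> x)))"

definition hilbert_bundle :: "('x, 'f::complex_vector) hbundle \<Rightarrow> bool"
  where "hilbert_bundle E \<longleftrightarrow>
    (\<forall>x\<in>topspace (base E). hilbert_space (fibre E x)) \<and>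
    (\<forall>x\<in>topspace (base E). \<exists>(U, M, \<phi>)\<in>charts E. x \<in> U) \<and>
    (\<forall>c\<in>charts E. trivialization (base E) (fibre E) c \<and> metric_continuous (base E) (fibre E) c) \<and>
    (\<forall>c\<in>charts E. \<forall>d\<in>charts E. continuous_rep (base E) (fibre E) c d (\<lambda>x. id))"

definition bundle_morphism ::
    "('x, 'f::complex_vector) hbundle \<Rightarrow> ('x, 'f) hbundle \<Rightarrow> ('x \<Rightarrow> 'f \<Rightarrow> 'f) \<Rightarrow> bool"
  where "bundle_morphism E F f \<longleftrightarrow>
    base F = base E \<and>
    (\<forall>x\<in>topspace (base E). bounded_op (fibre E x) (fibre F x) (f x)) \<and>
    (\<forall>x v. x \<notin> topspace (base E) \<or> v \<notin> hcar (fibre E x) \<longrightarrow> f x v = 0) \<and>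
    (\<forall>c\<in>charts E. \<forall>d\<in>charts F. continuous_rep (base E) (fibre E) c d f)"

definition bundle_id :: "('x, 'f::complex_vector) hbundle \<Rightarrow> 'x \<Rightarrow> 'f \<Rightarrow> 'f"
  where "bundle_id E x = (if x \<in> topspace (base E) then id_op (fibre E x) else 0)"

definition bundle_iso ::
    "('x, 'f::complex_vector) hbundle \<Rightarrow> ('x, 'f) hbundle \<Rightarrow> ('x \<Rightarrow> 'f \<Rightarrow> 'f) \<Rightarrow> bool"
  where "bundle_iso E F f \<longleftrightarrow> bundle_morphism E F f \<and>
    (\<exists>h. bundle_morphism F E h \<and> h \<odot> f = bundle_id E \<and> f \<odot> h = bundle_id F)"

text \<open>The range of a projection \<open>p\<close>, with the metric and the bundle structure induced from \<open>E\<close>: its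
  charts are all trivializations in which the inclusion into \<open>E\<close> is continuous.\<close>

definition range_fibre :: "('x, 'f::complex_vector) hbundle \<Rightarrow> ('x \<Rightarrow> 'f \<Rightarrow> 'f) \<Rightarrow> 'x \<Rightarrow> 'f hilbert"
  where "range_fibre E p x = \<lparr>hcar = p x ` hcar (fibre E x), hip = hip (fibre E x)\<rparr>"

definition range_bundle :: "('x, 'f::complex_vector) hbundle \<Rightarrow> ('x \<Rightarrow> 'f \<Rightarrow> 'f) \<Rightarrow> ('x, 'f) hbundle"
  where "range_bundle E p =
    \<lparr>base = base E,
     fibre = range_fibre E p,
     charts = {c. trivialization (base E) (range_fibre E p) c \<and>
       (\<forall>d\<in>charts E. continuous_rep (base E) (range_fibre E p) c d (\<lambda>x. id))}\<rparr>"

definition restrict_morphism ::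
    "('x, 'f::complex_vector) hbundle \<Rightarrow> ('x \<Rightarrow> 'f \<Rightarrow> 'f) \<Rightarrow> 'x \<Rightarrow> 'f \<Rightarrow> 'f"
  where "restrict_morphism F f x v = (if x \<in> topspace (base F) \<and> v \<in> hcar (fibre F x) then f x v else 0)"

section \<open>Operator algebras with parameter\<close>

text \<open>A sectorial domain is a sector with vertex \<open>0\<close>; each bounding ray, and the vertex, may or may not
  belong to it. The isometry identifies the parameter type with the complex plane.\<close>

definition sectorial_domain :: "complex set \<Rightarrow> bool"
  where "sectorial_domain S \<longleftrightarrow>
    (\<exists>a b I. a < b \<and> b \<le> a + 2 * pi \<and> {a<..<b} \<subseteq> I \<and> I \<subseteq> {a..b} \<and>
       S - {0} = {complex_of_real r * cis t | r t. 0 < r \<and> t \<in> I})"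

definition parameter_domain :: "'l::euclidean_space set \<Rightarrow> bool"
  where "parameter_domain \<Lambda> \<longleftrightarrow>
    \<Lambda> = UNIV \<or>
    (\<exists>(\<iota>::complex \<Rightarrow> 'l) S. linear \<iota> \<and> surj \<iota> \<and> (\<forall>z. norm (\<iota> z) = norm z) \<and>
       sectorial_domain S \<and> \<Lambda> = \<iota> ` S)"

abbreviation (input) large :: "'l::real_normed_vector set \<Rightarrow> 'l filter"
  where "large \<Lambda> \<equiv> inf at_infinity (principal \<Lambda>)"

type_synonym ('l, 'h) family = "'l \<Rightarrow> 'h \<Rightarrow> 'h"

definition id_family :: "'l set \<Rightarrow> 'h::complex_vector hilbert \<Rightarrow> ('l, 'h) family"
  where "id_family \<Lambda> H l = (if l \<in> \<Lambda> then id_op H else 0)"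

definition smoothing :: "(int \<Rightarrow> 'p \<Rightarrow> ('l, 'h) family set) \<Rightarrow> 'p \<Rightarrow> ('l, 'h) family set"
  where "smoothing L p = (\<Inter>\<mu>\<in>{..0}. L \<mu> p)"

text \<open>Here \<open>H g s\<close> is the space \<open>H\<^sup>s(g)\<close>, \<open>adm\<close> is the set of admissible pairs, and \<open>L \<mu> (g\<^sub>0, g\<^sub>1)\<close> is
  only relevant for admissible pairs and \<open>\<mu> \<le> 0\<close>. Since \<open>H\<^sup>s(g) \<subseteq> H\<^sup>0(g)\<close>, an operator is determined
  by its action on \<open>H\<^sup>0(g\<^sub>0)\<close>.\<close>

locale operator_algebra =
  fixes \<Lambda> :: "'l::euclidean_space set"
    and H :: "'g \<Rightarrow> nat \<Rightarrow> 'h::complex_vector hilbert"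
    and adm :: "('g \<times> 'g) set"
    and L :: "int \<Rightarrow> 'g \<times> 'g \<Rightarrow> ('l, 'h) family set"
  assumes parameters: "parameter_domain \<Lambda>"
    and hilbert: "hilbert_space (H g s)"
    and inclusion: "hcar (H g (Suc s)) \<subseteq> hcar (H g s)" "bounded_op (H g (Suc s)) (H g s) id"
    and adm_swap: "(g\<^sub>0, g\<^sub>1) \<in> adm \<Longrightarrow> (g\<^sub>1, g\<^sub>0) \<in> adm"
    and adm_refl: "(g\<^sub>0, g\<^sub>1) \<in> adm \<Longrightarrow> (g\<^sub>0, g\<^sub>0) \<in> adm" "(g\<^sub>0, g\<^sub>1) \<in> adm \<Longrightarrow> (g\<^sub>1, g\<^sub>1) \<in> adm"
    and adm_trans: "(g\<^sub>0, g\<^sub>1) \<in> adm \<Longrightarrow> (g\<^sub>1, g\<^sub>2) \<in> adm \<Longrightarrow> (g\<^sub>0, g\<^sub>2) \<in> adm"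
    and continuous: "\<lbrakk>(g\<^sub>0, g\<^sub>1) \<in> adm; \<mu> \<le> 0; A \<in> L \<mu> (g\<^sub>0, g\<^sub>1); l \<in> \<Lambda>\<rbrakk>
      \<Longrightarrow> bounded_op (H g\<^sub>0 s) (H g\<^sub>1 (s + nat (- \<mu>))) (A l)"
    and extensional: "\<lbrakk>(g\<^sub>0, g\<^sub>1) \<in> adm; \<mu> \<le> 0; A \<in> L \<mu> (g\<^sub>0, g\<^sub>1); l \<notin> \<Lambda> \<or> x \<notin> hcar (H g\<^sub>0 0)\<rbrakk>
      \<Longrightarrow> A l x = 0"
    and vector_space: "\<lbrakk>(g\<^sub>0, g\<^sub>1) \<in> adm; \<mu> \<le> 0\<rbrakk> \<Longrightarrow> csubspace (L \<mu> (g\<^sub>0, g\<^sub>1))"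
    and mono: "\<lbrakk>(g\<^sub>0, g\<^sub>1) \<in> adm; \<mu> \<le> \<nu>; \<nu> \<le> 0\<rbrakk> \<Longrightarrow> L \<mu> (g\<^sub>0, g\<^sub>1) \<subseteq> L \<nu> (g\<^sub>0, g\<^sub>1)"
    and comp: "\<lbrakk>(g\<^sub>0, g\<^sub>1) \<in> adm; (g\<^sub>1, g\<^sub>2) \<in> adm; \<mu> \<le> 0; \<nu> \<le> 0; B \<in> L \<mu> (g\<^sub>1, g\<^sub>2); A \<in> L \<nu> (g\<^sub>0, g\<^sub>1)\<rbrakk>
      \<Longrightarrow> B \<odot> A \<in> L (\<mu> + \<nu>) (g\<^sub>0, g\<^sub>2)"
    and identity: "(g, g) \<in> adm \<Longrightarrow> id_family \<Lambda> (H g 0) \<in> L 0 (g, g)"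
    and smoothing_decay: "\<lbrakk>(g\<^sub>0, g\<^sub>1) \<in> adm; R \<in> smoothing L (g\<^sub>0, g\<^sub>1)\<rbrakk>
      \<Longrightarrow> ((\<lambda>l. opnorm (H g\<^sub>0 s) (H g\<^sub>1 t) (R l)) \<longlongrightarrow> 0) (large \<Lambda>)"

definition elliptic ::
    "'l set \<Rightarrow> ('g \<Rightarrow> nat \<Rightarrow> 'h::complex_vector hilbert) \<Rightarrow> (int \<Rightarrow> 'g \<times> 'g \<Rightarrow> ('l, 'h) family set) \<Rightarrow>
      'g \<times> 'g \<Rightarrow> ('l, 'h) family \<Rightarrow> bool"
  where "elliptic \<Lambda> H L = (\<lambda>(g\<^sub>0, g\<^sub>1) A.
    A \<in> L 0 (g\<^sub>0, g\<^sub>1) \<and>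
    (\<exists>B\<in>L 0 (g\<^sub>1, g\<^sub>0).
       B \<odot> A - id_family \<Lambda> (H g\<^sub>0 0) \<in> smoothing L (g\<^sub>0, g\<^sub>0) \<and>
       A \<odot> B - id_family \<Lambda> (H g\<^sub>1 0) \<in> smoothing L (g\<^sub>1, g\<^sub>1)))"

definition inverse_closed ::
    "'l::real_normed_vector set \<Rightarrow> ('g \<Rightarrow> nat \<Rightarrow> 'h::complex_vector hilbert) \<Rightarrow> ('g \<times> 'g) set \<Rightarrow>
      (int \<Rightarrow> 'g \<times> 'g \<Rightarrow> ('l, 'h) family set) \<Rightarrow> bool"
  where "inverse_closed \<Lambda> H adm L \<longleftrightarrow>
    (\<forall>g. (g, g) \<in> adm \<longrightarrow> (\<forall>R\<in>smoothing L (g, g). \<exists>S\<in>smoothing L (g, g).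
       \<forall>\<^sub>F l in large \<Lambda>.
         (id_op (H g 0) + R l) \<circ> (id_op (H g 0) + S l) = id_op (H g 0) \<and>
         (id_op (H g 0) + S l) \<circ> (id_op (H g 0) + R l) = id_op (H g 0)))"

definition adjoint_family ::
    "'l set \<Rightarrow> ('g \<Rightarrow> nat \<Rightarrow> 'h hilbert) \<Rightarrow> 'g \<times> 'g \<Rightarrow> ('l, 'h) family \<Rightarrow> ('l, 'h) family \<Rightarrow> bool"
  where "adjoint_family \<Lambda> H = (\<lambda>(g\<^sub>0, g\<^sub>1) A A'. \<forall>l\<in>\<Lambda>. adjoint_op (H g\<^sub>0 0) (H g\<^sub>1 0) (A l) (A' l))"

definition star_closed ::
    "'l set \<Rightarrow> ('g \<Rightarrow> nat \<Rightarrow> 'h hilbert) \<Rightarrow> ('g \<times> 'g) set \<Rightarrow>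
      (int \<Rightarrow> 'g \<times> 'g \<Rightarrow> ('l, 'h) family set) \<Rightarrow> bool"
  where "star_closed \<Lambda> H adm L \<longleftrightarrow>
    (\<forall>(g\<^sub>0, g\<^sub>1)\<in>adm. \<forall>A\<in>L 0 (g\<^sub>0, g\<^sub>1). \<exists>A'\<in>L 0 (g\<^sub>1, g\<^sub>0). adjoint_family \<Lambda> H (g\<^sub>0, g\<^sub>1) A A')"

text \<open>The part of the notion of a \<open>\<sigma>\<close>-algebra that is common to \<open>L\<^sup>\<star>(\<Lambda>)\<close> and \<open>T\<^sup>\<star>(\<Lambda>)\<close>. For the former
  the objects of type \<open>'o\<close> are data, for the latter they are data together with a projection; \<open>L0\<close> and
  \<open>Linf\<close> are the operators of order \<open>0\<close> and the smoothing operators, and \<open>\<sigma> k (a, b) A\<close> is the \<open>k\<close>-th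
  component of the symbol of \<open>A\<close>, considered as an operator from \<open>a\<close> to \<open>b\<close>.\<close>

locale symbol_map =
  fixes adm :: "('o \<times> 'o) set"
    and L0 Linf :: "'o \<times> 'o \<Rightarrow> ('l, 'h::complex_vector) family set"
    and ell :: "'o \<times> 'o \<Rightarrow> ('l, 'h) family \<Rightarrow> bool"
    and n :: nat
    and E :: "nat \<Rightarrow> 'o \<Rightarrow> ('x, 'f::complex_vector) hbundle"
    and \<sigma> :: "nat \<Rightarrow> 'o \<times> 'o \<Rightarrow> ('l, 'h) family \<Rightarrow> 'x \<Rightarrow> 'f \<Rightarrow> 'f"
  assumes bundles: "\<lbrakk>k \<in> {1..n}; (a, a) \<in> adm\<rbrakk> \<Longrightarrow> hilbert_bundle (E k a)"
    and morphism: "\<lbrakk>k \<in> {1..n}; (a, b) \<in> adm; A \<in> L0 (a, b)\<rbrakk>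
      \<Longrightarrow> bundle_morphism (E k a) (E k b) (\<sigma> k (a, b) A)"
    and add: "\<lbrakk>k \<in> {1..n}; (a, b) \<in> adm; A \<in> L0 (a, b); B \<in> L0 (a, b)\<rbrakk>
      \<Longrightarrow> \<sigma> k (a, b) (A + B) = \<sigma> k (a, b) A + \<sigma> k (a, b) B"
    and scale: "\<lbrakk>k \<in> {1..n}; (a, b) \<in> adm; A \<in> L0 (a, b)\<rbrakk>
      \<Longrightarrow> \<sigma> k (a, b) (z *\<^sub>C A) = z *\<^sub>C \<sigma> k (a, b) A"
    and multiplicative: "\<lbrakk>k \<in> {1..n}; (a, b) \<in> adm; (b, c) \<in> adm; A \<in> L0 (a, b); B \<in> L0 (b, c)\<rbrakk>
      \<Longrightarrow> \<sigma> k (a, c) (B \<odot> A) = \<sigma> k (b, c) B \<odot> \<sigma> k (a, b) A"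
    and vanishing: "\<lbrakk>k \<in> {1..n}; (a, b) \<in> adm; R \<in> Linf (a, b)\<rbrakk> \<Longrightarrow> \<sigma> k (a, b) R = 0"
    and elliptic_iff: "\<lbrakk>(a, b) \<in> adm; A \<in> L0 (a, b)\<rbrakk>
      \<Longrightarrow> ell (a, b) A \<longleftrightarrow> (\<forall>k\<in>{1..n}. bundle_iso (E k a) (E k b) (\<sigma> k (a, b) A))"

definition symbol_sigma_algebra ::
    "'l set \<Rightarrow> ('g \<Rightarrow> nat \<Rightarrow> 'h::complex_vector hilbert) \<Rightarrow> ('g \<times> 'g) set \<Rightarrow>
      (int \<Rightarrow> 'g \<times> 'g \<Rightarrow> ('l, 'h) family set) \<Rightarrow> nat \<Rightarrow> (nat \<Rightarrow> 'g \<Rightarrow> ('x, 'f::complex_vector) hbundle) \<Rightarrow>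
      (nat \<Rightarrow> 'g \<times> 'g \<Rightarrow> ('l, 'h) family \<Rightarrow> 'x \<Rightarrow> 'f \<Rightarrow> 'f) \<Rightarrow> bool"
  where "symbol_sigma_algebra \<Lambda> H adm L n E \<sigma> \<longleftrightarrow>
    symbol_map adm (L 0) (smoothing L) (elliptic \<Lambda> H L) n E \<sigma> \<and>
    (star_closed \<Lambda> H adm L \<longrightarrow>
      (\<forall>(g\<^sub>0, g\<^sub>1)\<in>adm. \<forall>A\<in>L 0 (g\<^sub>0, g\<^sub>1). \<forall>A'\<in>L 0 (g\<^sub>1, g\<^sub>0). adjoint_family \<Lambda> H (g\<^sub>0, g\<^sub>1) A A' \<longrightarrow>
        (\<forall>k\<in>{1..n}. \<forall>x\<in>topspace (base (E k g\<^sub>0)).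
          adjoint_op (fibre (E k g\<^sub>0) x) (fibre (E k g\<^sub>1) x) (\<sigma> k (g\<^sub>0, g\<^sub>1) A x) (\<sigma> k (g\<^sub>1, g\<^sub>0) A' x))))"

section \<open>Toeplitz subalgebras\<close>

definition projection :: "(int \<Rightarrow> 'g \<times> 'g \<Rightarrow> ('l, 'h) family set) \<Rightarrow> 'g \<Rightarrow> ('l, 'h) family \<Rightarrow> bool"
  where "projection L g P \<longleftrightarrow> P \<in> L 0 (g, g) \<and> P \<odot> P = P"

text \<open>The objects of the Toeplitz algebra are pairs \<open>(g, P)\<close>: the class \<open>T\<^sup>\<mu>((g\<^sub>0, g\<^sub>1), P\<^sub>0, P\<^sub>1; \<Lambda>)\<close> is
  \<open>toeplitz L \<mu> ((g\<^sub>0, P\<^sub>0), (g\<^sub>1, P\<^sub>1))\<close>.\<close>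

definition toeplitz ::
    "(int \<Rightarrow> 'g \<times> 'g \<Rightarrow> ('l, 'h) family set) \<Rightarrow>
      int \<Rightarrow> ('g \<times> ('l, 'h) family) \<times> ('g \<times> ('l, 'h) family) \<Rightarrow> ('l, 'h) family set"
  where "toeplitz L \<mu> = (\<lambda>((g\<^sub>0, P\<^sub>0), (g\<^sub>1, P\<^sub>1)). {P\<^sub>1 \<odot> A \<odot> P\<^sub>0 | A. A \<in> L \<mu> (g\<^sub>0, g\<^sub>1)})"

definition toeplitz_adm ::
    "('g \<times> 'g) set \<Rightarrow> (int \<Rightarrow> 'g \<times> 'g \<Rightarrow> ('l, 'h) family set) \<Rightarrow>
      (('g \<times> ('l, 'h) family) \<times> ('g \<times> ('l, 'h) family)) set"
  where "toeplitz_adm adm L =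
    {((g\<^sub>0, P\<^sub>0), (g\<^sub>1, P\<^sub>1)). (g\<^sub>0, g\<^sub>1) \<in> adm \<and> projection L g\<^sub>0 P\<^sub>0 \<and> projection L g\<^sub>1 P\<^sub>1}"

definition toeplitz_elliptic ::
    "(int \<Rightarrow> 'g \<times> 'g \<Rightarrow> ('l, 'h::complex_vector) family set) \<Rightarrow>
      ('g \<times> ('l, 'h) family) \<times> ('g \<times> ('l, 'h) family) \<Rightarrow> ('l, 'h) family \<Rightarrow> bool"
  where "toeplitz_elliptic L = (\<lambda>((g\<^sub>0, P\<^sub>0), (g\<^sub>1, P\<^sub>1)) A.
    A \<in> toeplitz L 0 ((g\<^sub>0, P\<^sub>0), (g\<^sub>1, P\<^sub>1)) \<and>
    (\<exists>B\<in>toeplitz L 0 ((g\<^sub>1, P\<^sub>1), (g\<^sub>0, P\<^sub>0)).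
       B \<odot> A - P\<^sub>0 \<in> smoothing (toeplitz L) ((g\<^sub>0, P\<^sub>0), (g\<^sub>0, P\<^sub>0)) \<and>
       A \<odot> B - P\<^sub>1 \<in> smoothing (toeplitz L) ((g\<^sub>1, P\<^sub>1), (g\<^sub>1, P\<^sub>1))))"

definition toeplitz_inverse_closed ::
    "'l::real_normed_vector set \<Rightarrow> ('g \<times> 'g) set \<Rightarrow>
      (int \<Rightarrow> 'g \<times> 'g \<Rightarrow> ('l, 'h::complex_vector) family set) \<Rightarrow> bool"
  where "toeplitz_inverse_closed \<Lambda> adm L \<longleftrightarrow>
    (\<forall>g P. (g, g) \<in> adm \<and> projection L g P \<longrightarrow>
      (\<forall>R\<in>smoothing (toeplitz L) ((g, P), (g, P)). \<exists>S\<in>smoothing (toeplitz L) ((g, P), (g, P)).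
         \<forall>\<^sub>F l in large \<Lambda>.
           (P l + R l) \<circ> (P l + S l) = P l \<and> (P l + S l) \<circ> (P l + R l) = P l))"

definition toeplitz_bundle ::
    "(nat \<Rightarrow> 'g \<Rightarrow> ('x, 'f::complex_vector) hbundle) \<Rightarrow>
      (nat \<Rightarrow> 'g \<times> 'g \<Rightarrow> ('l, 'h) family \<Rightarrow> 'x \<Rightarrow> 'f \<Rightarrow> 'f) \<Rightarrow>
      nat \<Rightarrow> 'g \<times> ('l, 'h) family \<Rightarrow> ('x, 'f) hbundle"
  where "toeplitz_bundle E \<sigma> k = (\<lambda>(g, P). range_bundle (E k g) (\<sigma> k (g, g) P))"

definition toeplitz_symbol ::
    "(nat \<Rightarrow> 'g \<Rightarrow> ('x, 'f::complex_vector) hbundle) \<Rightarrow>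
      (nat \<Rightarrow> 'g \<times> 'g \<Rightarrow> ('l, 'h) family \<Rightarrow> 'x \<Rightarrow> 'f \<Rightarrow> 'f) \<Rightarrow>
      nat \<Rightarrow> ('g \<times> ('l, 'h) family) \<times> ('g \<times> ('l, 'h) family) \<Rightarrow> ('l, 'h) family \<Rightarrow> 'x \<Rightarrow> 'f \<Rightarrow> 'f"
  where "toeplitz_symbol E \<sigma> k = (\<lambda>((g\<^sub>0, P\<^sub>0), (g\<^sub>1, P\<^sub>1)) A.
    restrict_morphism (toeplitz_bundle E \<sigma> k (g\<^sub>0, P\<^sub>0)) (\<sigma> k (g\<^sub>0, g\<^sub>1) A))"

definition toeplitz_sigma_algebra ::
    "('g \<times> 'g) set \<Rightarrow> (int \<Rightarrow> 'g \<times> 'g \<Rightarrow> ('l, 'h::complex_vector) family set) \<Rightarrow> nat \<Rightarrow>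
      (nat \<Rightarrow> 'g \<Rightarrow> ('x, 'f::complex_vector) hbundle) \<Rightarrow>
      (nat \<Rightarrow> 'g \<times> 'g \<Rightarrow> ('l, 'h) family \<Rightarrow> 'x \<Rightarrow> 'f \<Rightarrow> 'f) \<Rightarrow> bool"
  where "toeplitz_sigma_algebra adm L n E \<sigma> \<longleftrightarrow>
    symbol_map (toeplitz_adm adm L) (toeplitz L 0) (smoothing (toeplitz L)) (toeplitz_elliptic L)
      n (toeplitz_bundle E \<sigma>) (toeplitz_symbol E \<sigma>)"

end

theory Submission
  imports Defs
begin

text \<open>Inverse-closedness is inherited by compressing inverses with the projection. For the symbols,
  the range of a norm-continuous family of projections is locally trivial, since nearby projections
  are conjugate, so it is a Hilbert bundle. If the restricted symbol \<open>a : ran p\<^sub>0 \<rightarrow> ran p\<^sub>1\<close> of \<open>A\<close>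
  is invertible, then \<open>a\<^sup>* a + (1 - p\<^sub>0)\<^sup>* (1 - p\<^sub>0)\<close> and \<open>a a\<^sup>* + (1 - p\<^sub>1) (1 - p\<^sub>1)\<^sup>*\<close> are positive
  definite, so by Lax--Milgram the corresponding operators of the full algebra are elliptic; their
  parametrices yield a left and a right Toeplitz parametrix of \<open>A\<close>.\<close>

section \<open>Hilbert spaces and bounded operators\<close>

text \<open>The inverse of the restricted symbol \<open>a\<close> is a mere bundle morphism; nothing
  makes it the symbol of an operator, so a parametrix can only come from an isomorphism between full
  bundles. In general \<open>A\<close> cannot be completed to one from \<open>E k g\<^sub>0\<close>
  to \<open>E k g\<^sub>1\<close>, since the kernels of the two projections need not be isomorphic.
  Squaring \<open>a\<close> moves the problem to a single bundle on either side, where the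
  complementary projection fills the missing directions. The projections need not be self-adjoint,
  so the adjoints of the complements appear explicitly, and the lower bound for the adjoint pair is
  obtained by duality. The price is two separate parametrices, which are then shown to agree modulo
  smoothing operators. Charts of a range bundle are constrained only through the inclusion into the
  ambient bundle. Continuity of inverses, transition maps and restrictions is therefore recovered
  from one division principle: a bounded solution T of B T = A is norm continuous if A and B are and
  B is bounded below.\<close>

lemma minus_scaleC: "- x = (- 1) *\<^sub>C (x :: 'a::complex_vector)"
  using complex_vector.scale_minus_left[of 1 x] scaleC_one[of x] by simp

section \<open>Geometry of a single Hilbert space\<close>

context
  fixes H :: "'a::complex_vector hilbert"
  assumes H: "hilbert_space H"
begin

lemmas hilbert_space_conds = H[unfolded hilbert_space_def]

lemma hs_subspace: "csubspace (hcar H)"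
  by (rule hilbert_space_conds[THEN conjunct1])

lemma hs_zero [simp]: "0 \<in> hcar H"
  using hs_subspace by (rule complex_vector.subspace_0)

lemma hs_add [simp]: "x \<in> hcar H \<Longrightarrow> y \<in> hcar H \<Longrightarrow> x + y \<in> hcar H"
  using hs_subspace by (rule complex_vector.subspace_add)

lemma hs_diff [simp]: "x \<in> hcar H \<Longrightarrow> y \<in> hcar H \<Longrightarrow> x - y \<in> hcar H"
  using hs_subspace by (rule complex_vector.subspace_diff)

lemma hs_uminus [simp]: "x \<in> hcar H \<Longrightarrow> - x \<in> hcar H"
  using hs_subspace by (rule complex_vector.subspace_neg)

lemma hs_scale [simp]: "x \<in> hcar H \<Longrightarrow> c *\<^sub>C x \<in> hcar H"
  using hs_subspace by (rule complex_vector.subspace_scale)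

lemma hip_add_left:
  "x \<in> hcar H \<Longrightarrow> y \<in> hcar H \<Longrightarrow> z \<in> hcar H \<Longrightarrow> hip H (x + y) z = hip H x z + hip H y z"
  using hilbert_space_conds[THEN conjunct2, THEN conjunct1] by blast

lemma hip_scale_left: "x \<in> hcar H \<Longrightarrow> y \<in> hcar H \<Longrightarrow> hip H (c *\<^sub>C x) y = c * hip H x y"
  using hilbert_space_conds[THEN conjunct2, THEN conjunct2, THEN conjunct1] by blast

lemma hip_cnj: "x \<in> hcar H \<Longrightarrow> y \<in> hcar H \<Longrightarrow> hip H y x = cnj (hip H x y)"
  using hilbert_space_conds[THEN conjunct2, THEN conjunct2, THEN conjunct2, THEN conjunct1] by blast

lemma hip_ge_0: "x \<in> hcar H \<Longrightarrow> 0 \<le> Re (hip H x x)"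
  using hilbert_space_conds[THEN conjunct2, THEN conjunct2, THEN conjunct2, THEN conjunct2, THEN conjunct1] by blast

lemma hip_definite: "x \<in> hcar H \<Longrightarrow> hip H x x = 0 \<Longrightarrow> x = 0"
  using hilbert_space_conds[THEN conjunct2, THEN conjunct2, THEN conjunct2, THEN conjunct2, THEN conjunct2, THEN conjunct1] by blast

lemma hip_add_right:
  "x \<in> hcar H \<Longrightarrow> y \<in> hcar H \<Longrightarrow> z \<in> hcar H \<Longrightarrow> hip H z (x + y) = hip H z x + hip H z y"
  by (metis complex_cnj_add hip_add_left hip_cnj hs_add)

lemma hip_scale_right: "x \<in> hcar H \<Longrightarrow> y \<in> hcar H \<Longrightarrow> hip H y (c *\<^sub>C x) = cnj c * hip H y x"
  by (metis complex_cnj_mult hip_cnj hip_scale_left hs_scale)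

lemma hip_uminus_left: "x \<in> hcar H \<Longrightarrow> y \<in> hcar H \<Longrightarrow> hip H (- x) y = - hip H x y"
  using hip_scale_left[of x y "-1"] by (simp flip: minus_scaleC)

lemma hip_uminus_right: "x \<in> hcar H \<Longrightarrow> y \<in> hcar H \<Longrightarrow> hip H y (- x) = - hip H y x"
  using hip_scale_right[of x y "-1"] by (simp flip: minus_scaleC)

lemma hip_diff_left:
  "x \<in> hcar H \<Longrightarrow> y \<in> hcar H \<Longrightarrow> z \<in> hcar H \<Longrightarrow> hip H (x - y) z = hip H x z - hip H y z"
  using hip_add_left[of x "- y" z] by (simp add: hip_uminus_left)

lemma hip_diff_right:
  "x \<in> hcar H \<Longrightarrow> y \<in> hcar H \<Longrightarrow> z \<in> hcar H \<Longrightarrow> hip H z (x - y) = hip H z x - hip H z y"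
  using hip_add_right[of x "- y" z] by (simp add: hip_uminus_right)

lemma hip_zero: "x \<in> hcar H \<Longrightarrow> hip H 0 x = 0" "x \<in> hcar H \<Longrightarrow> hip H x 0 = 0"
  using hip_diff_left[of x x x] hip_diff_right[of x x x] by simp_all

lemma hip_self: "x \<in> hcar H \<Longrightarrow> hip H x x = complex_of_real ((hnorm H x)\<^sup>2)"
proof -
  assume x: "x \<in> hcar H"
  have "0 \<le> Re (hip H x x)"
    using x by (rule hip_ge_0)
  moreover have "Im (hip H x x) = 0"
    using hip_cnj[OF x x] by (simp add: complex_eq_iff)
  ultimately show ?thesis
    by (simp add: complex_eq_iff hnorm_def)
qed

lemma hnorm_ge_0 [simp]: "x \<in> hcar H \<Longrightarrow> 0 \<le> hnorm H x"
  by (simp add: hip_ge_0 hnorm_def)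

lemma hnorm_eq_0: "x \<in> hcar H \<Longrightarrow> hnorm H x = 0 \<longleftrightarrow> x = 0"
  using hip_self[of x] hip_zero(1)[of 0] hip_definite[of x] by (auto simp: hnorm_def)

lemma hnorm_le_0_iff: "x \<in> hcar H \<Longrightarrow> hnorm H x \<le> 0 \<longleftrightarrow> x = 0"
  using hnorm_ge_0[of x] hnorm_eq_0[of x] by linarith

lemma hnorm_zero [simp]: "hnorm H 0 = 0"
  by (simp add: hnorm_eq_0)

lemma hnorm_scale: "x \<in> hcar H \<Longrightarrow> hnorm H (c *\<^sub>C x) = cmod c * hnorm H x"
proof -
  assume x: "x \<in> hcar H"
  have "hip H (c *\<^sub>C x) (c *\<^sub>C x) = (c * cnj c) * hip H x x"
    using x by (simp add: hip_scale_left hip_scale_right)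
  also have "\<dots> = complex_of_real ((cmod c * hnorm H x)\<^sup>2)"
    using x by (simp add: hip_self power_mult_distrib flip: complex_norm_square)
  finally have "(hnorm H (c *\<^sub>C x))\<^sup>2 = (cmod c * hnorm H x)\<^sup>2"
    using x by (simp add: hip_self flip: of_real_power)
  then show ?thesis
    using x by (simp add: power2_eq_iff_nonneg)
qed

lemma hnorm_uminus [simp]: "x \<in> hcar H \<Longrightarrow> hnorm H (- x) = hnorm H x"
  using hnorm_scale[of x "-1"] by (simp flip: minus_scaleC)

lemma hnorm_minus_commute: "x \<in> hcar H \<Longrightarrow> y \<in> hcar H \<Longrightarrow> hnorm H (x - y) = hnorm H (y - x)"
  using hnorm_uminus[of "x - y"] by simp

lemma hnorm_diff_sq:
  "x \<in> hcar H \<Longrightarrow> y \<in> hcar H \<Longrightarrow>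
    (hnorm H (x - y))\<^sup>2 = (hnorm H x)\<^sup>2 - 2 * Re (hip H x y) + (hnorm H y)\<^sup>2"
proof -
  assume x: "x \<in> hcar H" and y: "y \<in> hcar H"
  have "(hnorm H (x - y))\<^sup>2 = Re (hip H (x - y) (x - y))"
    using x y by (simp add: hip_self)
  also have "\<dots> = Re (hip H x x) - Re (hip H x y) - Re (hip H y x) + Re (hip H y y)"
    using x y by (simp add: hip_diff_left hip_diff_right)
  also have "Re (hip H y x) = Re (hip H x y)"
    using hip_cnj[OF x y] by simp
  finally show ?thesis
    using x y by (simp add: hip_self)
qed

lemma hip_cauchy_schwarz:
  assumes x: "x \<in> hcar H" and y: "y \<in> hcar H"
  shows "cmod (hip H x y) \<le> hnorm H x * hnorm H y"
proof (cases "y = 0")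
  case True
  then show ?thesis
    using x by (simp add: hip_zero)
next
  case False
  let ?s = "hip H x y"
  let ?r = "(hnorm H y)\<^sup>2"
  have r: "?r > 0"
    using False y by (simp add: hnorm_eq_0)
  \<comment> \<open>The vector subtracted from \<open>x\<close> is its orthogonal projection onto
    the line spanned by \<open>y\<close>.\<close>
  have "0 \<le> (hnorm H (x - (?s / ?r) *\<^sub>C y))\<^sup>2"
    by simp
  also have "\<dots> = (hnorm H x)\<^sup>2 - 2 * Re (cnj (?s / ?r) * ?s) + (cmod (?s / ?r) * hnorm H y)\<^sup>2"
    using x y by (simp add: hnorm_diff_sq hip_scale_right hnorm_scale)
  also have "cnj (?s / ?r) * ?s = (cmod ?s)\<^sup>2 / ?r"
    by (simp add: mult.commute flip: complex_norm_square)
  also have "Re \<dots> = (cmod ?s)\<^sup>2 / ?r"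
    by (metis Re_complex_of_real of_real_divide of_real_power)
  also have "(cmod (?s / ?r) * hnorm H y)\<^sup>2 = (cmod ?s)\<^sup>2 / ?r"
    using r by (simp add: norm_divide power2_eq_square field_simps norm_mult)
  finally have "(cmod ?s)\<^sup>2 / ?r \<le> (hnorm H x)\<^sup>2"
    by simp
  then have "(cmod ?s)\<^sup>2 \<le> (hnorm H x * hnorm H y)\<^sup>2"
    using r by (simp add: pos_divide_le_eq power_mult_distrib)
  then show ?thesis
    using x y by (meson hnorm_ge_0 mult_nonneg_nonneg power2_le_imp_le)
qed

lemma hnorm_triangle_minus:
  assumes x: "x \<in> hcar H" and y: "y \<in> hcar H"
  shows "hnorm H (x - y) \<le> hnorm H x + hnorm H y"
proof -
  have "- Re (hip H x y) \<le> hnorm H x * hnorm H y"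
    using hip_cauchy_schwarz[OF x y] abs_Re_le_cmod[of "hip H x y"] by linarith
  then have "(hnorm H (x - y))\<^sup>2 \<le> (hnorm H x + hnorm H y)\<^sup>2"
    using x y by (simp add: hnorm_diff_sq power2_sum)
  then show ?thesis
    using x y by (meson add_nonneg_nonneg hnorm_ge_0 power2_le_imp_le)
qed

lemma hnorm_triangle: "x \<in> hcar H \<Longrightarrow> y \<in> hcar H \<Longrightarrow> hnorm H (x + y) \<le> hnorm H x + hnorm H y"
  using hnorm_triangle_minus[of x "- y"] by simp

lemma hnorm_triangle_ineq2:
  "x \<in> hcar H \<Longrightarrow> y \<in> hcar H \<Longrightarrow> hnorm H x \<le> hnorm H y + hnorm H (x - y)"
  using hnorm_triangle[of y "x - y"] by simp

lemma hs_complete: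
  fixes X :: "nat \<Rightarrow> 'a"
  assumes "\<And>i. X i \<in> hcar H" and "\<And>e. e > 0 \<Longrightarrow> \<exists>N. \<forall>i\<ge>N. \<forall>j\<ge>N. hnorm H (X i - X j) < e"
  obtains x where "x \<in> hcar H" "(\<lambda>i. hnorm H (X i - x)) \<longlonglongrightarrow> 0"
  using hilbert_space_conds[THEN conjunct2, THEN conjunct2, THEN conjunct2, THEN conjunct2, THEN conjunct2, THEN conjunct2] assms by blast

end

section \<open>Bounded operators between Hilbert spaces\<close>

lemma bounded_opI:
  assumes "\<And>x. x \<in> hcar H \<Longrightarrow> T x \<in> hcar K"
    and "\<And>x y. x \<in> hcar H \<Longrightarrow> y \<in> hcar H \<Longrightarrow> T (x + y) = T x + T y"
    and "\<And>c x. x \<in> hcar H \<Longrightarrow> T (c *\<^sub>C x) = c *\<^sub>C T x"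
    and "\<And>x. x \<in> hcar H \<Longrightarrow> hnorm K (T x) \<le> C * hnorm H x"
  shows "bounded_op H K T"
  using assms unfolding bounded_op_def by blast

lemma bounded_op_in: "bounded_op H K T \<Longrightarrow> x \<in> hcar H \<Longrightarrow> T x \<in> hcar K"
  by (simp add: bounded_op_def)

lemma bounded_op_add:
  "bounded_op H K T \<Longrightarrow> x \<in> hcar H \<Longrightarrow> y \<in> hcar H \<Longrightarrow> T (x + y) = T x + T y"
  by (simp add: bounded_op_def)

lemma bounded_op_scale: "bounded_op H K T \<Longrightarrow> x \<in> hcar H \<Longrightarrow> T (c *\<^sub>C x) = c *\<^sub>C T x"
  by (simp add: bounded_op_def)

lemma bounded_op_uminus: "bounded_op H K T \<Longrightarrow> x \<in> hcar H \<Longrightarrow> T (- x) = - T x"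
  using bounded_op_scale[of H K T x "-1"] by (simp flip: minus_scaleC)

lemma bounded_op_diff:
  "hilbert_space H \<Longrightarrow> bounded_op H K T \<Longrightarrow> x \<in> hcar H \<Longrightarrow> y \<in> hcar H \<Longrightarrow> T (x - y) = T x - T y"
  using bounded_op_add[of H K T x "- y"] by (simp add: bounded_op_uminus hs_uminus)

lemma bounded_op_zero: "hilbert_space H \<Longrightarrow> bounded_op H K T \<Longrightarrow> T 0 = 0"
  using bounded_op_diff[of H K T 0 0] by simp

text \<open>The constant in \<open>bounded_op\<close> may be any real number. It is enlarged to a
  positive one, so that later estimates can multiply and divide by it.\<close>

lemma bounded_op_bound:
  assumes "hilbert_space H" "bounded_op H K T"
  obtains C where "C > 0" "\<And>x. x \<in> hcar H \<Longrightarrow> hnorm K (T x) \<le> C * hnorm H x"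
proof -
  obtain C where C: "\<forall>x\<in>hcar H. hnorm K (T x) \<le> C * hnorm H x"
    using assms(2) by (auto simp: bounded_op_def)
  have "hnorm K (T x) \<le> max C 1 * hnorm H x" if "x \<in> hcar H" for x
    using C that hnorm_ge_0[OF assms(1) that] by (meson max.cobounded1 mult_right_mono order_trans)
  then show thesis
    by (intro that[of "max C 1"]) auto
qed

lemma bounded_op_cong:
  assumes "hilbert_space H" "bounded_op H K T" "\<And>x. x \<in> hcar H \<Longrightarrow> S x = T x"
  shows "bounded_op H K S"
  using assms by (simp add: bounded_op_def hs_add hs_scale)

lemma bounded_op_comp:
  assumes "hilbert_space H" "hilbert_space K" "bounded_op H K T" "bounded_op K M S"
  shows "bounded_op H M (S \<circ> T)"
proof -
  obtain C where C: "C > 0" "\<And>x. x \<in> hcar H \<Longrightarrow> hnorm K (T x) \<le> C * hnorm H x"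
    using bounded_op_bound[OF assms(1,3)] by blast
  obtain D where D: "D > 0" "\<And>x. x \<in> hcar K \<Longrightarrow> hnorm M (S x) \<le> D * hnorm K x"
    using bounded_op_bound[OF assms(2,4)] by blast
  note T = assms(3) and S = assms(4)
  show ?thesis
  proof (rule bounded_opI)
    fix x assume x: "x \<in> hcar H"
    have "hnorm M (S (T x)) \<le> D * hnorm K (T x)"
      by (simp add: D bounded_op_in[OF T x])
    also have "\<dots> \<le> D * (C * hnorm H x)"
      using C D x by simp
    finally show "hnorm M ((S \<circ> T) x) \<le> (D * C) * hnorm H x"
      by (simp add: mult.assoc)
  qed (simp_all add: bounded_op_in[OF T] bounded_op_in[OF S] bounded_op_add[OF T]
      bounded_op_add[OF S] bounded_op_scale[OF T] bounded_op_scale[OF S])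
qed

lemma bounded_op_plus:
  assumes "hilbert_space H" "hilbert_space K" "bounded_op H K T" "bounded_op H K S"
  shows "bounded_op H K (\<lambda>x. T x + S x)"
proof -
  note T = assms(3) and S = assms(4)
  obtain C where C: "C > 0" "\<And>x. x \<in> hcar H \<Longrightarrow> hnorm K (T x) \<le> C * hnorm H x"
    using bounded_op_bound[OF assms(1,3)] by blast
  obtain D where D: "D > 0" "\<And>x. x \<in> hcar H \<Longrightarrow> hnorm K (S x) \<le> D * hnorm H x"
    using bounded_op_bound[OF assms(1,4)] by blast
  show ?thesis
  proof (rule bounded_opI)
    fix x assume x: "x \<in> hcar H"
    then show "T x + S x \<in> hcar K"
      by (simp add: assms(2) bounded_op_in[OF T] bounded_op_in[OF S])
    show "hnorm K (T x + S x) \<le> (C + D) * hnorm H x"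
      using hnorm_triangle[OF assms(2) bounded_op_in[OF T x] bounded_op_in[OF S x]] C(2)[OF x] D(2)[OF x]
      by (simp add: algebra_simps)
  qed (simp_all add: bounded_op_add[OF T] bounded_op_scale[OF T] bounded_op_add[OF S]
      bounded_op_scale[OF S] scaleC_add_right)
qed

lemma bounded_op_uminus':
  assumes "hilbert_space K" "bounded_op H K T"
  shows "bounded_op H K (\<lambda>x. - T x)"
  using assms unfolding bounded_op_def
  by (simp add: hs_uminus hnorm_uminus complex_vector.scale_minus_right)

lemma bounded_op_minus:
  assumes "hilbert_space H" "hilbert_space K" "bounded_op H K T" "bounded_op H K S"
  shows "bounded_op H K (\<lambda>x. T x - S x)"
  using bounded_op_plus[OF assms(1-3) bounded_op_uminus'[OF assms(2,4)]] by simp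

lemma bounded_op_id: "bounded_op H H id"
  by (rule bounded_opI[where C = 1]) auto

section \<open>Lower bounds, perturbations of the identity, and coercive operators\<close>

lemma bij_bounded_below_toplinear_iso:
  assumes H: "hilbert_space H" and K: "hilbert_space K" and T: "bounded_op H K T"
    and below: "\<And>x. x \<in> hcar H \<Longrightarrow> hnorm H x \<le> c * hnorm K (T x)"
    and surj: "\<And>y. y \<in> hcar K \<Longrightarrow> \<exists>x\<in>hcar H. T x = y"
  shows "toplinear_iso H K T"
proof -
  have inj: "inj_on T (hcar H)"
  proof (rule inj_onI)
    fix x y assume xy: "x \<in> hcar H" "y \<in> hcar H" "T x = T y"
    then have "hnorm H (x - y) \<le> 0"
      using below[of "x - y"] by (simp add: H K hs_diff bounded_op_diff[OF H T] hnorm_zero)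
    then show "x = y"
      using xy hnorm_le_0_iff[OF H, of "x - y"] by (simp add: hs_diff[OF H])
  qed
  have img: "T ` hcar H = hcar K"
    using surj bounded_op_in[OF T] by auto
  let ?S = "inv_into (hcar H) T"
  have S_in: "?S y \<in> hcar H" and TS: "T (?S y) = y" if "y \<in> hcar K" for y
    using that img by (auto simp: inv_into_into f_inv_into_f)
  \<comment> \<open>Read at the preimage of a vector, the lower bound for \<open>T\<close> is the
    norm bound for the inverse, with the same \<open>c\<close>.\<close>
  have "bounded_op K H ?S"
  proof (rule bounded_opI[where C = c])
    fix x y assume x: "x \<in> hcar K" and y: "y \<in> hcar K"
    show "?S (x + y) = ?S x + ?S y"
      using inv_into_f_f[OF inj, of "?S x + ?S y"] x y
      by (simp add: S_in TS bounded_op_add[OF T] H hs_add)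
  next
    fix a x assume x: "x \<in> hcar K"
    show "?S (a *\<^sub>C x) = a *\<^sub>C ?S x"
      using inv_into_f_f[OF inj, of "a *\<^sub>C ?S x"] x
      by (simp add: S_in TS bounded_op_scale[OF T] H hs_scale)
  next
    fix x assume x: "x \<in> hcar K"
    show "hnorm H (?S x) \<le> c * hnorm K x"
      using below[OF S_in[OF x]] x by (simp add: TS)
  qed (rule S_in)
  then show ?thesis
    using T inj img by (simp add: toplinear_iso_def bij_betw_def)
qed

lemma toplinear_isoD:
  assumes "toplinear_iso H K T"
  shows "bounded_op H K T" "bounded_op K H (inv_into (hcar H) T)"
    and "\<And>x. x \<in> hcar H \<Longrightarrow> inv_into (hcar H) T (T x) = x"
    and "\<And>y. y \<in> hcar K \<Longrightarrow> T (inv_into (hcar H) T y) = y"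
  using assms by (auto simp: toplinear_iso_def bij_betw_def inv_into_f_f f_inv_into_f)

lemma toplinear_iso_below:
  assumes "hilbert_space H" "hilbert_space K" "toplinear_iso H K T"
  obtains c where "c > 0" "\<And>x. x \<in> hcar H \<Longrightarrow> hnorm H x \<le> c * hnorm K (T x)"
proof -
  note D = toplinear_isoD[OF assms(3)]
  obtain c where "c > 0" and c: "\<And>y. y \<in> hcar K \<Longrightarrow> hnorm H (inv_into (hcar H) T y) \<le> c * hnorm K y"
    using bounded_op_bound[OF assms(2) D(2)] by blast
  have "hnorm H x \<le> c * hnorm K (T x)" if "x \<in> hcar H" for x
    using c[OF bounded_op_in[OF D(1) that]] that by (simp add: D(3))
  with \<open>c > 0\<close> show thesis
    using that by blast
qed

text \<open>The preimage of \<open>y\<close> is the limit of the iteration \<open>x \<mapsto> x + (y - T x)\<close>.\<close>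

lemma perturbed_identity_surj:
  assumes H: "hilbert_space H" and T: "bounded_op H H T" and c: "0 \<le> c" "c < 1"
    and near: "\<And>x. x \<in> hcar H \<Longrightarrow> hnorm H (x - T x) \<le> c * hnorm H x"
    and y: "y \<in> hcar H"
  shows "\<exists>x\<in>hcar H. T x = y"
proof -
  note HH [simp] = hs_zero[OF H] hs_add[OF H] hs_diff[OF H] bounded_op_in[OF T] hnorm_ge_0[OF H]
  define X where "X = rec_nat 0 (\<lambda>_ x. x + (y - T x))"
  have X0: "X 0 = 0" and XS: "X (Suc n) = X n + (y - T (X n))" for n
    by (simp_all add: X_def)
  have X [simp]: "X n \<in> hcar H" for n
    by (induction n) (simp_all add: X0 XS y)
  define D where "D = hnorm H y"
  \<comment> \<open>The increment at 0 is \<open>y\<close>, and an increment d is followed by d - T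
    d; hence \<open>near\<close> shrinks the increments by the factor \<open>c\<close>.\<close>
  have step: "hnorm H (X (Suc n) - X n) \<le> D * c ^ n" for n
  proof (induction n)
    case 0
    then show ?case
      by (simp add: X0 XS D_def bounded_op_zero[OF H T])
  next
    case (Suc n)
    let ?d = "X (Suc n) - X n"
    have "X (Suc (Suc n)) - X (Suc n) = ?d - T ?d"
      by (simp add: XS[of "Suc n"] bounded_op_diff[OF H T] bounded_op_add[OF T] XS[of n] y)
    then have "hnorm H (X (Suc (Suc n)) - X (Suc n)) \<le> c * hnorm H ?d"
      using near[of ?d] by simp
    also have "\<dots> \<le> c * (D * c ^ n)"
      using Suc c(1) by (rule mult_left_mono)
    finally show ?case
      by (simp add: mult_ac)
  qed
  \<comment> \<open>The geometric sum is kept in closed form, so that adding the next increment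
    turns the induction step into an identity.\<close>
  have tele: "hnorm H (X (i + k) - X i) \<le> D * (c ^ i - c ^ (i + k)) / (1 - c)" for i k
  proof (induction k)
    case (Suc k)
    have "hnorm H (X (i + Suc k) - X i)
        \<le> hnorm H (X (Suc (i + k)) - X (i + k)) + hnorm H (X (i + k) - X i)"
      using hnorm_triangle[OF H, of "X (Suc (i + k)) - X (i + k)" "X (i + k) - X i"] by simp
    also have "\<dots> \<le> D * c ^ (i + k) + D * (c ^ i - c ^ (i + k)) / (1 - c)"
      using step Suc by (rule add_mono)
    also have "\<dots> = D * (c ^ i - c ^ (i + Suc k)) / (1 - c)"
      using c(2) by (simp add: field_simps)
    finally show ?case .
  qed (simp add: hnorm_zero[OF H])
  have D0: "D \<ge> 0"
    by (simp add: D_def y)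
  have le: "hnorm H (X (i + k) - X i) \<le> D / (1 - c) * c ^ i" for i k
  proof -
    have "D * (c ^ i - c ^ (i + k)) \<le> D * c ^ i"
      using D0 c(1) by (intro mult_left_mono) auto
    then show ?thesis
      using order_trans[OF tele[of i k] divide_right_mono[of _ _ "1 - c"]] c(2) by simp
  qed
  have cauchy: "\<exists>N. \<forall>i\<ge>N. \<forall>j\<ge>N. hnorm H (X i - X j) < e" if "e > 0" for e
  proof -
    have "(\<lambda>n. D / (1 - c) * c ^ n) \<longlonglongrightarrow> D / (1 - c) * 0"
      using c by (intro tendsto_mult_left LIMSEQ_power_zero) simp
    then obtain N where N: "\<And>n. n \<ge> N \<Longrightarrow> D / (1 - c) * c ^ n < e"
      using \<open>e > 0\<close> by (force dest: order_tendstoD(2) simp: eventually_sequentially)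
    have "hnorm H (X j - X i) < e" if "N \<le> i" "i \<le> j" for i j
      using le_less_trans[OF le[of i "j - i"] N[OF that(1)]] that by simp
    then have "hnorm H (X i - X j) < e" if "N \<le> i" "N \<le> j" for i j
      using that by (metis X hnorm_minus_commute[OF H] nat_le_linear)
    then show ?thesis
      by blast
  qed
  obtain x where x [simp]: "x \<in> hcar H" and lim: "(\<lambda>i. hnorm H (X i - x)) \<longlonglongrightarrow> 0"
    using hs_complete[OF H, of X] cauchy X by metis
  obtain C where C: "C > 0" "\<And>x. x \<in> hcar H \<Longrightarrow> hnorm H (T x) \<le> C * hnorm H x"
    using bounded_op_bound[OF H T] by blast
  \<comment> \<open>The defect of the limit is the defect of \<open>X i\<close>, which is the next
    increment, plus the image under \<open>T\<close> of the error \<open>X i - x\<close>. Both tend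
    to 0.\<close>
  have "hnorm H (y - T x) \<le> D * c ^ i + C * hnorm H (X i - x)" for i
  proof -
    have "y - T x = (X (Suc i) - X i) + T (X i - x)"
      by (simp add: XS bounded_op_diff[OF H T])
    then show ?thesis
      using hnorm_triangle[OF H, of "X (Suc i) - X i" "T (X i - x)"] step[of i] C(2)[of "X i - x"] by simp
  qed
  moreover have "(\<lambda>i. D * c ^ i + C * hnorm H (X i - x)) \<longlonglongrightarrow> D * 0 + C * 0"
    using c lim by (intro tendsto_intros LIMSEQ_power_zero) auto
  ultimately have "hnorm H (y - T x) \<le> 0"
    by (intro LIMSEQ_le_const[of _ "0::real"]) auto
  then have "y - T x = 0"
    using y by (simp add: hnorm_le_0_iff[OF H])
  then show ?thesis
    by (intro bexI[of _ x]) auto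
qed

lemma perturbed_identity_below:
  assumes H: "hilbert_space H" and T: "bounded_op H H T"
    and near: "\<And>x. x \<in> hcar H \<Longrightarrow> hnorm H (x - T x) \<le> c * hnorm H x"
    and x: "x \<in> hcar H"
  shows "(1 - c) * hnorm H x \<le> hnorm H (T x)"
  using near[OF x] hnorm_triangle_ineq2[OF H x bounded_op_in[OF T x]] by (simp add: algebra_simps)

text \<open>This is Lax-Milgram by contraction: for a suitable t > 0 the operator 1 - t T has norm
  less than 1, so t T is a perturbed identity, and dividing by t returns to
  \<open>T\<close>.\<close>

lemma coercive_toplinear_iso:
  assumes H: "hilbert_space H" and T: "bounded_op H H T" and "c > 0"
    and coercive: "\<And>x. x \<in> hcar H \<Longrightarrow> c * (hnorm H x)\<^sup>2 \<le> Re (hip H (T x) x)"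
  shows "toplinear_iso H H T"
proof -
  note [simp] = hs_scale[OF H] hs_diff[OF H] bounded_op_in[OF T] hnorm_ge_0[OF H]
  obtain C where "C > 0" and C: "\<And>x. x \<in> hcar H \<Longrightarrow> hnorm H (T x) \<le> C * hnorm H x"
    using bounded_op_bound[OF H T] by blast
  \<comment> \<open>The squared norm of 1 - t T is at most
    \<open>1 - 2 * t * c + t\<^sup>2 * C\<^sup>2\<close>; this \<open>t\<close> minimises it, with
    value \<open>1 - c\<^sup>2 / C\<^sup>2\<close>. On the zero space \<open>C\<close> may be
    smaller than \<open>c\<close> and the value negative, hence the maximum with 0 in
    \<open>d\<close>.\<close>
  define t where "t = c / C\<^sup>2"
  define d where "d = sqrt (max 0 (1 - c\<^sup>2 / C\<^sup>2))"
  have t: "t > 0"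
    using \<open>c > 0\<close> \<open>C > 0\<close> by (simp add: t_def)
  have d: "0 \<le> d" "d < 1"
    using \<open>c > 0\<close> \<open>C > 0\<close> by (auto simp: d_def)
  let ?T = "\<lambda>x. complex_of_real t *\<^sub>C T x"
  have bT: "bounded_op H H ?T"
    by (rule bounded_opI[where C = "t * C"])
      (use t C in \<open>simp_all add: bounded_op_add[OF T] bounded_op_scale[OF T] scaleC_add_right scaleC_scaleC
        mult.commute hnorm_scale[OF H] mult.left_commute\<close>)
  have near: "hnorm H (x - ?T x) \<le> d * hnorm H x" if x: "x \<in> hcar H" for x
  proof -
    have "Re (hip H x (?T x)) = t * Re (hip H (T x) x)"
      using hip_cnj[OF H x bounded_op_in[OF T x]] x
      by (simp add: hip_scale_right[OF H])
    then have "(hnorm H (x - ?T x))\<^sup>2 = (hnorm H x)\<^sup>2 - 2 * (t * Re (hip H (T x) x)) + (t * hnorm H (T x))\<^sup>2"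
      using x t by (simp add: hnorm_diff_sq[OF H] hnorm_scale[OF H])
    also have "\<dots> \<le> (hnorm H x)\<^sup>2 - 2 * (t * (c * (hnorm H x)\<^sup>2)) + (t * (C * hnorm H x))\<^sup>2"
      using x t C[OF x] coercive[OF x] by (intro add_mono diff_mono power_mono mult_left_mono) auto
    also have "\<dots> = (1 - 2 * t * c + t\<^sup>2 * C\<^sup>2) * (hnorm H x)\<^sup>2"
      by (simp add: algebra_simps power_mult_distrib)
    also have "1 - 2 * t * c + t\<^sup>2 * C\<^sup>2 = 1 - c\<^sup>2 / C\<^sup>2"
      using \<open>C > 0\<close> by (simp add: t_def field_simps power2_eq_square)
    also have "(1 - c\<^sup>2 / C\<^sup>2) * (hnorm H x)\<^sup>2 \<le> (d * hnorm H x)\<^sup>2"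
      by (simp add: d_def power_mult_distrib mult_right_mono)
    finally show ?thesis
      using d(1) x by (meson hnorm_ge_0[OF H] mult_nonneg_nonneg power2_le_imp_le)
  qed
  show ?thesis
  proof (rule bij_bounded_below_toplinear_iso[OF H H T])
    fix x assume x: "x \<in> hcar H"
    have "(1 - d) * hnorm H x \<le> t * hnorm H (T x)"
      using perturbed_identity_below[OF H bT near x] t x by (simp add: hnorm_scale[OF H])
    then show "hnorm H x \<le> (t / (1 - d)) * hnorm H (T x)"
      using d(2) by (simp add: field_simps)
  next
    fix y assume y: "y \<in> hcar H"
    then obtain x where x: "x \<in> hcar H" "?T x = complex_of_real t *\<^sub>C y"
      using perturbed_identity_surj[OF H bT d near, of "complex_of_real t *\<^sub>C y"] by auto
    then have "T x = y"
      using t by (metis complex_vector.scale_cancel_left less_irrefl of_real_eq_0_iff)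
    with x show "\<exists>x\<in>hcar H. T x = y"
      by blast
  qed
qed

lemma adjoint_op_sym:
  assumes "hilbert_space H" "hilbert_space K" "bounded_op H K T" "bounded_op K H S" "adjoint_op H K T S"
  shows "adjoint_op K H S T"
  using assms unfolding adjoint_op_def by (metis bounded_op_in hip_cnj)

text \<open>Pairing the operator at \<open>x\<close> with \<open>x\<close> gives the sum of the
  squared norms of \<open>T x\<close> and \<open>Q x\<close>. By (a + b)^2 \<le> 2 (a^2 + b^2) the
  lower bound becomes coercivity with constant \<open>1 / (2 * d\<^sup>2)\<close>.\<close>

lemma sum_of_squares_toplinear_iso:
  assumes H: "hilbert_space H" and K: "hilbert_space K" and M: "hilbert_space M"
    and T: "bounded_op H K T" "bounded_op K H T'" "adjoint_op H K T T'"
    and Q: "bounded_op H M Q" "bounded_op M H Q'" "adjoint_op H M Q Q'"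
    and below: "\<And>x. x \<in> hcar H \<Longrightarrow> hnorm H x \<le> c * (hnorm K (T x) + hnorm M (Q x))"
  shows "toplinear_iso H H (\<lambda>x. T' (T x) + Q' (Q x))"
proof -
  \<comment> \<open>The given \<open>c\<close> has no sign; a positive constant is needed to form
    the coercivity constant.\<close>
  define d where "d = max c 1"
  have d: "d > 0"
    by (simp add: d_def)
  have belowd: "hnorm H x \<le> d * (hnorm K (T x) + hnorm M (Q x))" if x: "x \<in> hcar H" for x
  proof -
    have "0 \<le> hnorm K (T x) + hnorm M (Q x)"
      by (simp add: x hnorm_ge_0[OF K] hnorm_ge_0[OF M] bounded_op_in[OF T(1)] bounded_op_in[OF Q(1)])
    then show ?thesis
      using below[OF x] unfolding d_def by (meson max.cobounded1 mult_right_mono order_trans)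
  qed
  have bdd: "bounded_op H H (\<lambda>x. T' (T x) + Q' (Q x))"
    using bounded_op_plus[OF H H bounded_op_comp[OF H K T(1,2)] bounded_op_comp[OF H M Q(1,2)]] by simp
  have coer: "1 / (2 * d\<^sup>2) * (hnorm H x)\<^sup>2 \<le> Re (hip H (T' (T x) + Q' (Q x)) x)"
    if x: "x \<in> hcar H" for x
  proof -
    note i = bounded_op_in[OF T(1) x] bounded_op_in[OF T(2)] bounded_op_in[OF Q(1) x] bounded_op_in[OF Q(2)]
    have "hip H (T' (T x)) x = hip K (T x) (T x)" "hip H (Q' (Q x)) x = hip M (Q x) (Q x)"
      using adjoint_op_sym[OF H K T] adjoint_op_sym[OF H M Q] x i unfolding adjoint_op_def by auto
    then have eq: "Re (hip H (T' (T x) + Q' (Q x)) x) = (hnorm K (T x))\<^sup>2 + (hnorm M (Q x))\<^sup>2"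
      using x i by (simp add: hip_add_left[OF H] hip_self[OF K] hip_self[OF M])
    have "(hnorm H x)\<^sup>2 \<le> (d * (hnorm K (T x) + hnorm M (Q x)))\<^sup>2"
      using belowd[OF x] hnorm_ge_0[OF H x] by (rule power_mono)
    also have "\<dots> = d\<^sup>2 * (hnorm K (T x) + hnorm M (Q x))\<^sup>2"
      by (rule power_mult_distrib)
    also have "\<dots> \<le> d\<^sup>2 * (2 * ((hnorm K (T x))\<^sup>2 + (hnorm M (Q x))\<^sup>2))"
      using sum_squares_bound[of "hnorm K (T x)" "hnorm M (Q x)"]
      by (intro mult_left_mono) (auto simp: power2_sum)
    finally show ?thesis
      using d unfolding eq by (simp add: field_simps)
  qed
  show ?thesis
    by (rule coercive_toplinear_iso[OF H bdd _ coer]) (use d in auto)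
qed

section \<open>Ranges of projections as Hilbert spaces\<close>

definition range_space :: "'a hilbert \<Rightarrow> ('a \<Rightarrow> 'a) \<Rightarrow> 'a hilbert"
  where "range_space H p = \<lparr>hcar = p ` hcar H, hip = hip H\<rparr>"

lemma hnorm_range_space [simp]: "hnorm (range_space H p) = hnorm H"
  by (simp add: fun_eq_iff hnorm_def range_space_def)

lemma hip_range_space [simp]: "hip (range_space H p) = hip H"
  by (simp add: range_space_def)

lemma hcar_range_space:
  assumes "bounded_op H H p" "\<And>x. x \<in> hcar H \<Longrightarrow> p (p x) = p x"
  shows "x \<in> hcar (range_space H p) \<longleftrightarrow> x \<in> hcar H \<and> p x = x"
  using assms by (force simp: range_space_def bounded_op_in)


text \<open>The range is closed: if the \<open>X i\<close> are fixed by \<open>p\<close> and tend to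
  x, then p x - x = (X i - x) - p (X i - x) tends to 0. The lemma serves both for the fibres of a
  range bundle and for the model space of its charts.\<close>

lemma hilbert_space_range_space:
  assumes H: "hilbert_space H" and p: "bounded_op H H p" and pp: "\<And>x. x \<in> hcar H \<Longrightarrow> p (p x) = p x"
  shows "hilbert_space (range_space H p)"
proof -
  note car = hcar_range_space[OF p pp]
  have sub: "csubspace (hcar (range_space H p))"
    by (rule complex_vector.subspaceI)
      (simp_all add: car hs_zero[OF H] hs_add[OF H] hs_scale[OF H] bounded_op_zero[OF H p]
        bounded_op_add[OF p] bounded_op_scale[OF p])
  have complete: "\<exists>x\<in>hcar (range_space H p). (\<lambda>i. hnorm H (X i - x)) \<longlonglongrightarrow> 0"
    if X: "\<forall>i. X i \<in> hcar (range_space H p)"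
      and cau: "\<forall>e>0. \<exists>N. \<forall>i\<ge>N. \<forall>j\<ge>N. hnorm H (X i - X j) < e" for X :: "nat \<Rightarrow> 'a"
  proof -
    have XH: "X i \<in> hcar H" and pX: "p (X i) = X i" for i
      using X by (auto simp: car)
    obtain x where x: "x \<in> hcar H" and lim: "(\<lambda>i. hnorm H (X i - x)) \<longlonglongrightarrow> 0"
      using hs_complete[OF H, of X] XH cau by metis
    obtain C where C: "C > 0" "\<And>x. x \<in> hcar H \<Longrightarrow> hnorm H (p x) \<le> C * hnorm H x"
      using bounded_op_bound[OF H p] by blast
    note [simp] = x XH hs_diff[OF H] bounded_op_in[OF p] hnorm_ge_0[OF H]
    have "hnorm H (p x - x) \<le> hnorm H (X i - x) + C * hnorm H (X i - x)" for i
    proof -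
      have "p x - x = (X i - x) - p (X i - x)"
        by (simp add: bounded_op_diff[OF H p] pX)
      then have "hnorm H (p x - x) = hnorm H ((X i - x) - p (X i - x))"
        by (rule arg_cong)
      also have "\<dots> \<le> hnorm H (X i - x) + hnorm H (p (X i - x))"
        by (intro hnorm_triangle_minus[OF H]) simp_all
      also have "\<dots> \<le> hnorm H (X i - x) + C * hnorm H (X i - x)"
        by (intro add_left_mono C(2)) simp
      finally show ?thesis .
    qed
    moreover have "(\<lambda>i. hnorm H (X i - x) + C * hnorm H (X i - x)) \<longlonglongrightarrow> 0 + C * 0"
      using lim by (intro tendsto_intros)
    ultimately have "hnorm H (p x - x) \<le> 0"
      by (intro LIMSEQ_le_const[of _ "0::real"]) auto
    then have "p x - x = 0"
      by (simp add: hnorm_le_0_iff[OF H])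
    then show ?thesis
      using lim by (intro bexI[of _ x]) (auto simp: car)
  qed
  show ?thesis
    unfolding hilbert_space_def
    using sub complete
    by (auto simp: car hip_add_left[OF H] hip_scale_left[OF H] hip_ge_0[OF H] intro: hip_cnj[OF H] hip_definite[OF H])
qed

section \<open>Norm-continuous operator functions\<close>

text \<open>Domains of charts and their overlaps are open, so the subtopology in
  \<open>norm_continuous\<close> and \<open>metric_continuous\<close> can be replaced by the
  topology of the base.\<close>

lemma nhdsin_subtopology_open:
  assumes U: "openin X U" and x: "x \<in> U"
  shows "nhdsin (subtopology X U) x = nhdsin X x"
proof (rule filter_eqI)
  fix P
  have "(\<exists>S. openin (subtopology X U) S \<and> x \<in> S \<and> (\<forall>y\<in>S. P y)) \<longleftrightarrow>
      (\<exists>S. openin X S \<and> x \<in> S \<and> (\<forall>y\<in>S. P y))"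
  proof
    assume "\<exists>S. openin (subtopology X U) S \<and> x \<in> S \<and> (\<forall>y\<in>S. P y)"
    then show "\<exists>S. openin X S \<and> x \<in> S \<and> (\<forall>y\<in>S. P y)"
      using openin_open_subtopology[OF U] by blast
  next
    assume "\<exists>S. openin X S \<and> x \<in> S \<and> (\<forall>y\<in>S. P y)"
    then obtain S where "openin X S" "x \<in> S" "\<forall>y\<in>S. P y"
      by blast
    then show "\<exists>S. openin (subtopology X U) S \<and> x \<in> S \<and> (\<forall>y\<in>S. P y)"
      using U x openin_open_subtopology[OF U] openin_Int by (intro exI[of _ "S \<inter> U"]) simp
  qed
  moreover have "x \<in> topspace X"
    using U x openin_subset by blast
  ultimately show "eventually P (nhdsin (subtopology X U) x) \<longleftrightarrow> eventually P (nhdsin X x)"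
    using x by (simp add: eventually_nhdsin)
qed

lemma eventually_nhdsin_open: "openin X U \<Longrightarrow> x \<in> U \<Longrightarrow> (\<And>y. y \<in> U \<Longrightarrow> P y) \<Longrightarrow> eventually P (nhdsin X x)"
  by (auto simp: eventually_nhdsin)

section \<open>The operator norm as the best constant in a norm estimate\<close>

lemma opnorm_least:
  assumes "hilbert_space M" "0 \<le> e" "\<And>v. v \<in> hcar M \<Longrightarrow> hnorm N (S v) \<le> e * hnorm M v"
  shows "opnorm M N S \<le> e"
  unfolding opnorm_def
proof (rule cSUP_least)
  show "{x \<in> hcar M. hnorm M x \<le> 1} \<noteq> {}"
    using hs_zero[OF assms(1)] hnorm_zero[OF assms(1)] by force
next
  fix v assume v: "v \<in> {x \<in> hcar M. hnorm M x \<le> 1}"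
  then have "e * hnorm M v \<le> e * 1"
    using assms(2) by (intro mult_left_mono) auto
  then show "hnorm N (S v) \<le> e"
    using assms(3)[of v] v by simp
qed

context
  fixes M :: "'a::complex_vector hilbert" and N :: "'b::complex_vector hilbert" and S
  assumes M: "hilbert_space M" and N: "hilbert_space N" and S: "bounded_op M N S"
begin

lemma opnorm_upper: "v \<in> hcar M \<Longrightarrow> hnorm M v \<le> 1 \<Longrightarrow> hnorm N (S v) \<le> opnorm M N S"
proof -
  assume v: "v \<in> hcar M" "hnorm M v \<le> 1"
  obtain C where C: "C > 0" "\<And>v. v \<in> hcar M \<Longrightarrow> hnorm N (S v) \<le> C * hnorm M v"
    using bounded_op_bound[OF M S] by blast
  have "hnorm N (S v) \<le> C" if "v \<in> hcar M" "hnorm M v \<le> 1" for v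
    using C(2)[OF that(1)] mult_left_mono[OF that(2), of C] C(1) by linarith
  then show ?thesis
    unfolding opnorm_def using v by (intro cSUP_upper bdd_aboveI2[of _ _ C]) auto
qed

lemma opnorm_nonneg: "0 \<le> opnorm M N S"
  using opnorm_upper[of 0] by (simp add: hs_zero[OF M] hnorm_zero[OF M] hnorm_zero[OF N] bounded_op_zero[OF M S])

lemma opnorm_bound:
  assumes v: "v \<in> hcar M"
  shows "hnorm N (S v) \<le> opnorm M N S * hnorm M v"
proof (cases "hnorm M v = 0")
  case True
  then show ?thesis
    using v by (simp add: hnorm_eq_0[OF M] hnorm_zero[OF N] bounded_op_zero[OF M S] hnorm_zero[OF M])
next
  case False
  then have pos: "hnorm M v > 0"
    using hnorm_ge_0[OF M v] by simp
  let ?w = "complex_of_real (1 / hnorm M v) *\<^sub>C v"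
  have "hnorm N (S ?w) \<le> opnorm M N S"
    using pos v by (intro opnorm_upper) (simp_all add: hs_scale[OF M] hnorm_scale[OF M] norm_divide)
  then show ?thesis
    using pos v
    by (simp add: bounded_op_scale[OF S] hnorm_scale[OF N] bounded_op_in[OF S] norm_divide field_simps)
qed

end

text \<open>The supremum in the operator norm is traded for an estimate uniform in the vector. All
  later continuity arguments work with this form only.\<close>

lemma norm_continuous_iff:
  assumes U: "openin X U" and M: "hilbert_space M" and N: "hilbert_space N"
  shows "norm_continuous X U M N T \<longleftrightarrow>
    (\<forall>x\<in>U. bounded_op M N (T x)) \<and>
    (\<forall>x\<^sub>0\<in>U. \<forall>e>0. \<forall>\<^sub>F x in nhdsin X x\<^sub>0. \<forall>v\<in>hcar M. hnorm N (T x v - T x\<^sub>0 v) \<le> e * hnorm M v)"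
proof -
  have "((\<lambda>x. opnorm M N (T x - T x\<^sub>0)) \<longlongrightarrow> 0) (nhdsin X x\<^sub>0) \<longleftrightarrow>
      (\<forall>e>0. \<forall>\<^sub>F x in nhdsin X x\<^sub>0. \<forall>v\<in>hcar M. hnorm N (T x v - T x\<^sub>0 v) \<le> e * hnorm M v)"
    (is "?l \<longleftrightarrow> ?r")
    if bdd: "\<And>x. x \<in> U \<Longrightarrow> bounded_op M N (T x)" and x0: "x\<^sub>0 \<in> U" for x\<^sub>0
  proof -
    have ev: "\<forall>\<^sub>F x in nhdsin X x\<^sub>0. x \<in> U"
      using U x0 by (rule eventually_nhdsin_open)
    have diff: "bounded_op M N (T x - T x\<^sub>0)" if "x \<in> U" for x
      using bounded_op_minus[OF M N bdd[OF that] bdd[OF x0]] by (simp add: fun_diff_def)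
    show ?thesis
    proof
      assume l: ?l
      show ?r
      proof (intro allI impI)
        fix e :: real assume "e > 0"
        then have "\<forall>\<^sub>F x in nhdsin X x\<^sub>0. opnorm M N (T x - T x\<^sub>0) < e"
          using l by (intro order_tendstoD)
        with ev show "\<forall>\<^sub>F x in nhdsin X x\<^sub>0. \<forall>v\<in>hcar M. hnorm N (T x v - T x\<^sub>0 v) \<le> e * hnorm M v"
        proof eventually_elim
          case (elim x)
          show ?case
          proof
            fix v assume v: "v \<in> hcar M"
            have "hnorm N (T x v - T x\<^sub>0 v) \<le> opnorm M N (T x - T x\<^sub>0) * hnorm M v"
              using opnorm_bound[OF M N diff[OF elim(1)] v] by simp
            also have "\<dots> \<le> e * hnorm M v"
              using elim(2) hnorm_ge_0[OF M v] by (intro mult_right_mono) auto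
            finally show "hnorm N (T x v - T x\<^sub>0 v) \<le> e * hnorm M v" .
          qed
        qed
      qed
    next
      assume r: ?r
      show ?l
      proof (rule tendstoI)
        fix e :: real assume e: "e > 0"
        \<comment> \<open>Half of \<open>e\<close>, because the uniform estimate bounds the supremum
          only weakly while the limit asks for a strict inequality.\<close>
        with r have "\<forall>\<^sub>F x in nhdsin X x\<^sub>0. \<forall>v\<in>hcar M. hnorm N (T x v - T x\<^sub>0 v) \<le> e / 2 * hnorm M v"
          by (simp del: times_divide_eq_left)
        with ev show "\<forall>\<^sub>F x in nhdsin X x\<^sub>0. dist (opnorm M N (T x - T x\<^sub>0)) 0 < e"
        proof eventually_elim
          case (elim x)
          have "opnorm M N (T x - T x\<^sub>0) \<le> e / 2"
            using elim(2) e by (intro opnorm_least[OF M]) auto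
          then show ?case
            using opnorm_nonneg[OF M N diff[OF elim(1)]] e by (simp add: dist_real_def)
        qed
      qed
    qed
  qed
  then show ?thesis
    unfolding norm_continuous_def using nhdsin_subtopology_open[OF U] by (auto cong: conj_cong)
qed

section \<open>Calculus of norm-continuous operator functions\<close>

lemma norm_continuous_bounded: "norm_continuous X U M N T \<Longrightarrow> x \<in> U \<Longrightarrow> bounded_op M N (T x)"
  by (simp add: norm_continuous_def)

lemma norm_continuousI:
  assumes "openin X U" "hilbert_space M" "hilbert_space N" "\<And>x. x \<in> U \<Longrightarrow> bounded_op M N (T x)"
    and "\<And>x\<^sub>0 e. x\<^sub>0 \<in> U \<Longrightarrow> e > 0 \<Longrightarrow>
      \<forall>\<^sub>F x in nhdsin X x\<^sub>0. \<forall>v\<in>hcar M. hnorm N (T x v - T x\<^sub>0 v) \<le> e * hnorm M v"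
  shows "norm_continuous X U M N T"
  using assms by (simp add: norm_continuous_iff)

lemma norm_continuousD:
  assumes "openin X U" "hilbert_space M" "hilbert_space N" "norm_continuous X U M N T" "x\<^sub>0 \<in> U" "e > 0"
  shows "\<forall>\<^sub>F x in nhdsin X x\<^sub>0. x \<in> U \<and> (\<forall>v\<in>hcar M. hnorm N (T x v - T x\<^sub>0 v) \<le> e * hnorm M v)"
  using assms eventually_nhdsin_open[OF assms(1,5), of "\<lambda>x. x \<in> U"]
  by (auto simp: norm_continuous_iff intro: eventually_conj)

lemma norm_continuous_subset:
  assumes "openin X U" "openin X V" "V \<subseteq> U" "hilbert_space M" "hilbert_space N" "norm_continuous X U M N T"
  shows "norm_continuous X V M N T"
  using assms by (auto simp: norm_continuous_iff)

text \<open>Continuity at a point involves only a neighbourhood of it. This is used on overlaps that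
  no single ambient chart needs to cover.\<close>

lemma norm_continuous_local:
  assumes "openin X U" "hilbert_space M" "hilbert_space N"
    and "\<And>x. x \<in> U \<Longrightarrow> \<exists>V. openin X V \<and> x \<in> V \<and> norm_continuous X V M N T"
  shows "norm_continuous X U M N T"
proof (rule norm_continuousI[OF assms(1-3)])
  fix x assume "x \<in> U"
  then show "bounded_op M N (T x)"
    by (blast dest: assms(4) norm_continuous_bounded)
next
  fix x\<^sub>0 and e :: real assume "x\<^sub>0 \<in> U" and e: "e > 0"
  then obtain V where V: "openin X V" "x\<^sub>0 \<in> V" "norm_continuous X V M N T"
    using assms(4) by blast
  show "\<forall>\<^sub>F x in nhdsin X x\<^sub>0. \<forall>v\<in>hcar M. hnorm N (T x v - T x\<^sub>0 v) \<le> e * hnorm M v"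
    using norm_continuousD[OF V(1) assms(2,3) V(3,2) e] by (rule eventually_mono) simp
qed

lemma norm_continuous_cong:
  assumes U: "openin X U" and M: "hilbert_space M" and N: "hilbert_space N"
    and T: "norm_continuous X U M N T" and eq: "\<And>x v. x \<in> U \<Longrightarrow> v \<in> hcar M \<Longrightarrow> S x v = T x v"
  shows "norm_continuous X U M N S"
proof (rule norm_continuousI[OF U M N])
  fix x assume "x \<in> U"
  then show "bounded_op M N (S x)"
    using bounded_op_cong[OF M norm_continuous_bounded[OF T]] eq by blast
next
  fix x\<^sub>0 and e :: real assume x0: "x\<^sub>0 \<in> U" and "e > 0"
  from norm_continuousD[OF U M N T this]
  show "\<forall>\<^sub>F x in nhdsin X x\<^sub>0. \<forall>v\<in>hcar M. hnorm N (S x v - S x\<^sub>0 v) \<le> e * hnorm M v"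
    by (rule eventually_mono) (simp add: eq x0)
qed

lemma norm_continuous_const:
  assumes U: "openin X U" and M: "hilbert_space M" and N: "hilbert_space N" and T: "bounded_op M N T"
  shows "norm_continuous X U M N (\<lambda>_. T)"
  by (rule norm_continuousI[OF U M N T]) (simp add: hnorm_zero[OF N] hnorm_ge_0[OF M])

lemma norm_continuous_plus:
  assumes U: "openin X U" and M: "hilbert_space M" and N: "hilbert_space N"
    and T: "norm_continuous X U M N T" and S: "norm_continuous X U M N S"
  shows "norm_continuous X U M N (\<lambda>x v. T x v + S x v)"
proof (rule norm_continuousI[OF U M N])
  fix x assume "x \<in> U"
  then show "bounded_op M N (\<lambda>v. T x v + S x v)"
    by (intro bounded_op_plus[OF M N] norm_continuous_bounded[OF T] norm_continuous_bounded[OF S])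
next
  fix x\<^sub>0 and e :: real assume x0: "x\<^sub>0 \<in> U" and "e > 0"
  then have e: "e / 2 > 0"
    by simp
  from norm_continuousD[OF U M N T x0 e] norm_continuousD[OF U M N S x0 e]
  show "\<forall>\<^sub>F x in nhdsin X x\<^sub>0. \<forall>v\<in>hcar M. hnorm N (T x v + S x v - (T x\<^sub>0 v + S x\<^sub>0 v)) \<le> e * hnorm M v"
  proof eventually_elim
    case (elim x)
    show ?case
    proof
      fix v assume v: "v \<in> hcar M"
      have i: "T x v - T x\<^sub>0 v \<in> hcar N" "S x v - S x\<^sub>0 v \<in> hcar N"
        using elim x0 v
        by (simp_all add: hs_diff[OF N] bounded_op_in[OF norm_continuous_bounded[OF T]]
            bounded_op_in[OF norm_continuous_bounded[OF S]])
      have "hnorm N (T x v + S x v - (T x\<^sub>0 v + S x\<^sub>0 v))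
          = hnorm N ((T x v - T x\<^sub>0 v) + (S x v - S x\<^sub>0 v))"
        by (simp add: algebra_simps)
      also have "\<dots> \<le> hnorm N (T x v - T x\<^sub>0 v) + hnorm N (S x v - S x\<^sub>0 v)"
        by (rule hnorm_triangle[OF N i])
      also have "\<dots> \<le> e / 2 * hnorm M v + e / 2 * hnorm M v"
        using elim v by (intro add_mono) auto
      finally show "hnorm N (T x v + S x v - (T x\<^sub>0 v + S x\<^sub>0 v)) \<le> e * hnorm M v"
        by simp
    qed
  qed
qed

lemma norm_continuous_uminus:
  assumes U: "openin X U" and M: "hilbert_space M" and N: "hilbert_space N"
    and T: "norm_continuous X U M N T"
  shows "norm_continuous X U M N (\<lambda>x v. - T x v)"
proof (rule norm_continuousI[OF U M N])
  fix x assume "x \<in> U"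
  then show "bounded_op M N (\<lambda>v. - T x v)"
    by (intro bounded_op_uminus'[OF N] norm_continuous_bounded[OF T])
next
  fix x\<^sub>0 and e :: real assume x0: "x\<^sub>0 \<in> U" and e: "e > 0"
  have "hnorm N (- T x v - - T x\<^sub>0 v) = hnorm N (T x v - T x\<^sub>0 v)" if "x \<in> U" "v \<in> hcar M" for x v
    using hnorm_minus_commute[OF N, of "T x\<^sub>0 v" "T x v"] that x0
    by (simp add: bounded_op_in[OF norm_continuous_bounded[OF T]])
  then show "\<forall>\<^sub>F x in nhdsin X x\<^sub>0. \<forall>v\<in>hcar M. hnorm N (- T x v - - T x\<^sub>0 v) \<le> e * hnorm M v"
    by (intro eventually_mono[OF norm_continuousD[OF U M N T x0 e]]) simp
qed

lemma norm_continuous_minus: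
  assumes "openin X U" "hilbert_space M" "hilbert_space N"
    "norm_continuous X U M N T" "norm_continuous X U M N S"
  shows "norm_continuous X U M N (\<lambda>x v. T x v - S x v)"
  using norm_continuous_plus[OF assms(1-4) norm_continuous_uminus[OF assms(1-3,5)]] by simp

lemma norm_continuous_comp:
  assumes U: "openin X U" and M: "hilbert_space M" and N: "hilbert_space N" and K: "hilbert_space K"
    and T: "norm_continuous X U M N T" and S: "norm_continuous X U N K S"
  shows "norm_continuous X U M K (\<lambda>x. S x \<circ> T x)"
proof (rule norm_continuousI[OF U M K])
  fix x assume "x \<in> U"
  then show "bounded_op M K (S x \<circ> T x)"
    by (intro bounded_op_comp[OF M N] norm_continuous_bounded[OF T] norm_continuous_bounded[OF S])
next
  fix x\<^sub>0 and e :: real assume x0: "x\<^sub>0 \<in> U" and e: "e > 0"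
  note bT = norm_continuous_bounded[OF T] and bS = norm_continuous_bounded[OF S]
  obtain C where C: "C > 0" "\<And>v. v \<in> hcar M \<Longrightarrow> hnorm N (T x\<^sub>0 v) \<le> C * hnorm M v"
    using bounded_op_bound[OF M bT[OF x0]] by blast
  obtain D where D: "D > 0" "\<And>v. v \<in> hcar N \<Longrightarrow> hnorm K (S x\<^sub>0 v) \<le> D * hnorm N v"
    using bounded_op_bound[OF N bS[OF x0]] by blast
  \<comment> \<open>The difference is (S x - S x0) T x + S x0 (T x - T x0). The bound 1 on
    \<open>d\<close> makes \<open>C + 1\<close> a bound for T x, and \<open>d * (C + 1 + D)\<close>
    then collects both errors.\<close>
  define d where "d = min 1 (e / (C + 1 + D))"
  have pos: "C + 1 + D > 0"
    using C D by simp
  have d: "d > 0" "d \<le> 1" "d * (C + 1 + D) \<le> e"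
    using e pos by (simp_all add: d_def flip: pos_le_divide_eq[OF pos])
  from norm_continuousD[OF U M N T x0 d(1)] norm_continuousD[OF U N K S x0 d(1)]
  show "\<forall>\<^sub>F x in nhdsin X x\<^sub>0. \<forall>v\<in>hcar M. hnorm K ((S x \<circ> T x) v - (S x\<^sub>0 \<circ> T x\<^sub>0) v) \<le> e * hnorm M v"
  proof eventually_elim
    case (elim x)
    show ?case
    proof
      fix v assume v: "v \<in> hcar M"
      have x: "x \<in> U"
        using elim by simp
      note [simp] = v hs_diff[OF N] hs_diff[OF K] bounded_op_in[OF bT[OF x]] bounded_op_in[OF bT[OF x0]]
        bounded_op_in[OF bS[OF x]] bounded_op_in[OF bS[OF x0]] hnorm_ge_0[OF M]
      have dT: "hnorm N (T x v - T x\<^sub>0 v) \<le> d * hnorm M v"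
        using elim by simp
      also have "\<dots> \<le> 1 * hnorm M v"
        using d by (intro mult_right_mono) auto
      finally have Tx: "hnorm N (T x v) \<le> (C + 1) * hnorm M v"
        using hnorm_triangle_ineq2[OF N, of "T x v" "T x\<^sub>0 v"] C(2)[of v] by (simp add: algebra_simps)
      have "hnorm K ((S x \<circ> T x) v - (S x\<^sub>0 \<circ> T x\<^sub>0) v)
          = hnorm K ((S x (T x v) - S x\<^sub>0 (T x v)) + S x\<^sub>0 (T x v - T x\<^sub>0 v))"
        by (simp add: bounded_op_diff[OF N bS[OF x0]])
      also have "\<dots> \<le> hnorm K (S x (T x v) - S x\<^sub>0 (T x v)) + hnorm K (S x\<^sub>0 (T x v - T x\<^sub>0 v))"
        by (intro hnorm_triangle[OF K]) simp_all
      also have "\<dots> \<le> d * hnorm N (T x v) + D * hnorm N (T x v - T x\<^sub>0 v)"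
        using elim by (intro add_mono D(2)) simp_all
      also have "\<dots> \<le> d * ((C + 1) * hnorm M v) + D * (d * hnorm M v)"
        using d D(1) Tx dT by (intro add_mono mult_left_mono) auto
      also have "\<dots> = (d * (C + 1 + D)) * hnorm M v"
        by (simp add: algebra_simps)
      also have "\<dots> \<le> e * hnorm M v"
        using d(3) by (intro mult_right_mono) auto
      finally show "hnorm K ((S x \<circ> T x) v - (S x\<^sub>0 \<circ> T x\<^sub>0) v) \<le> e * hnorm M v" .
    qed
  qed
qed

text \<open>Let w = T x v - T x0 v. Then B x w = (A x v - A x0 v) - (B x - B x0) (T x0 v), which is
  small by the continuity of \<open>A\<close> and \<open>B\<close> and the boundedness of T x0
  alone. The lower bound for B x0 carries over to B x up to a factor, since B x is close to B x0. So
  its constant may vary from point to point, and no bound for T uniform in x is assumed.\<close>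

lemma norm_continuous_division:
  assumes U: "openin X U" and M: "hilbert_space M" and N: "hilbert_space N" and K: "hilbert_space K"
    and A: "norm_continuous X U M K A" and B: "norm_continuous X U N K B"
    and T: "\<And>x. x \<in> U \<Longrightarrow> bounded_op M N (T x)"
    and BT: "\<And>x v. x \<in> U \<Longrightarrow> v \<in> hcar M \<Longrightarrow> B x (T x v) = A x v"
    and below: "\<And>x. x \<in> U \<Longrightarrow> \<exists>c>0. \<forall>v\<in>hcar N. hnorm N v \<le> c * hnorm K (B x v)"
  shows "norm_continuous X U M N T"
proof (rule norm_continuousI[OF U M N T])
  fix x\<^sub>0 and e :: real assume x0: "x\<^sub>0 \<in> U" and e: "e > 0"
  note bA = norm_continuous_bounded[OF A] and bB = norm_continuous_bounded[OF B]
  obtain c where c: "c > 0" "\<And>v. v \<in> hcar N \<Longrightarrow> hnorm N v \<le> c * hnorm K (B x\<^sub>0 v)"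
    using below[OF x0] by blast
  obtain D where D: "D > 0" "\<And>v. v \<in> hcar M \<Longrightarrow> hnorm N (T x\<^sub>0 v) \<le> D * hnorm M v"
    using bounded_op_bound[OF M T[OF x0]] by blast
  \<comment> \<open>The first entry gives c d \<le> 1/2, so the error c d |w| made in replacing B x0
    by B x is absorbed and |w| \<le> 2 c |B x w| remains. The second makes
    \<open>2 * c * (d * (1 + D))\<close> at most \<open>e\<close>, where \<open>d * (1 + D)\<close>
    bounds B x w relative to v.\<close>
  define d where "d = min (1 / (2 * c)) (e / (2 * c * (1 + D)))"
  have le: "d \<le> 1 / (2 * c)" "d \<le> e / (2 * c * (1 + D))"
    by (simp_all add: d_def)
  have d: "d > 0"
    using c D e by (simp add: d_def)
  have d2: "2 * c * d \<le> 1"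
    using le(1) c(1) by (simp add: field_simps)
  have pos: "2 * c * (1 + D) > 0"
    using c D by simp
  have d3: "2 * c * (d * (1 + D)) \<le> e"
    using le(2) unfolding pos_le_divide_eq[OF pos] by (simp add: mult_ac)
  from norm_continuousD[OF U M K A x0 d] norm_continuousD[OF U N K B x0 d]
  show "\<forall>\<^sub>F x in nhdsin X x\<^sub>0. \<forall>v\<in>hcar M. hnorm N (T x v - T x\<^sub>0 v) \<le> e * hnorm M v"
  proof eventually_elim
    case (elim x)
    show ?case
    proof
      fix v assume v: "v \<in> hcar M"
      have x: "x \<in> U"
        using elim by simp
      note [simp] = v hs_diff[OF N] hs_diff[OF K] bounded_op_in[OF bA[OF x]] bounded_op_in[OF bA[OF x0]]
        bounded_op_in[OF bB[OF x]] bounded_op_in[OF bB[OF x0]] bounded_op_in[OF T[OF x]]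
        bounded_op_in[OF T[OF x0]] hnorm_ge_0[OF M] hnorm_ge_0[OF N]
      let ?w = "T x v - T x\<^sub>0 v"
      have "hnorm K (B x\<^sub>0 ?w) \<le> hnorm K (B x ?w) + hnorm K (B x\<^sub>0 ?w - B x ?w)"
        by (intro hnorm_triangle_ineq2[OF K]) simp_all
      also have "hnorm K (B x\<^sub>0 ?w - B x ?w) \<le> d * hnorm N ?w"
        using elim by (simp add: hnorm_minus_commute[OF K, of "B x\<^sub>0 ?w" "B x ?w"])
      finally have "hnorm N ?w \<le> c * (hnorm K (B x ?w) + d * hnorm N ?w)"
        using c(2)[of ?w] c(1) by (meson add_left_mono hs_diff[OF N] mult_left_mono less_imp_le order_trans
            bounded_op_in[OF T[OF x] v] bounded_op_in[OF T[OF x0] v])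
      moreover have "2 * c * d * hnorm N ?w \<le> 1 * hnorm N ?w"
        using d2 by (intro mult_right_mono) auto
      ultimately have 1: "hnorm N ?w \<le> 2 * c * hnorm K (B x ?w)"
        by (simp add: algebra_simps)
      have "hnorm K (B x ?w) = hnorm K ((A x v - A x\<^sub>0 v) - (B x (T x\<^sub>0 v) - B x\<^sub>0 (T x\<^sub>0 v)))"
        by (simp add: bounded_op_diff[OF N bB[OF x]] BT[OF x] BT[OF x0])
      also have "\<dots> \<le> hnorm K (A x v - A x\<^sub>0 v) + hnorm K (B x (T x\<^sub>0 v) - B x\<^sub>0 (T x\<^sub>0 v))"
        by (intro hnorm_triangle_minus[OF K]) simp_all
      also have "\<dots> \<le> d * hnorm M v + d * hnorm N (T x\<^sub>0 v)"
        using elim by (intro add_mono) simp_all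
      also have "\<dots> \<le> d * hnorm M v + d * (D * hnorm M v)"
        using d D(2)[of v] by simp
      finally have "hnorm K (B x ?w) \<le> d * (1 + D) * hnorm M v"
        by (simp add: algebra_simps)
      then have "2 * c * hnorm K (B x ?w) \<le> 2 * c * (d * (1 + D) * hnorm M v)"
        using c(1) by simp
      also have "\<dots> = (2 * c * (d * (1 + D))) * hnorm M v"
        by (simp add: mult.assoc)
      also have "\<dots> \<le> e * hnorm M v"
        using d3 by (intro mult_right_mono) auto
      finally show "hnorm N ?w \<le> e * hnorm M v"
        using 1 by simp
    qed
  qed
qed

section \<open>Range bundles of projections\<close>

lemma trivializationD:
  assumes "trivialization X F (U, M, \<phi>)"
  shows "openin X U" "hilbert_space M" "\<And>x. x \<in> U \<Longrightarrow> toplinear_iso (F x) M (\<phi> x)"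
    "\<And>x. x \<in> U \<Longrightarrow> x \<in> topspace X"
  using assms openin_subset by (auto simp: trivialization_def)

text \<open>The intermediate chart and its inverse cancel between the two local representatives.
  Since that chart covers only \<open>V\<close>, the conclusion holds on the triple overlap.\<close>

lemma continuous_rep_comp:
  assumes c: "trivialization X F (U, M, \<phi>)" and d: "trivialization X G (V, N, \<psi>)"
    and e: "trivialization X J (W, K, \<eta>)"
    and f: "continuous_rep X F (U, M, \<phi>) (V, N, \<psi>) f"
    and g: "continuous_rep X G (V, N, \<psi>) (W, K, \<eta>) g"
    and f_in: "\<And>x v. x \<in> topspace X \<Longrightarrow> v \<in> hcar (F x) \<Longrightarrow> f x v \<in> hcar (G x)"
    and h: "\<And>x v. x \<in> topspace X \<Longrightarrow> v \<in> hcar (F x) \<Longrightarrow> h x v = g x (f x v)"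
  shows "norm_continuous X (U \<inter> V \<inter> W) M K (\<lambda>x. \<eta> x \<circ> h x \<circ> inv_into (hcar (F x)) (\<phi> x))"
proof -
  note c = trivializationD[OF c] and d = trivializationD[OF d] and e = trivializationD[OF e]
  have op: "openin X (U \<inter> V \<inter> W)" "openin X (U \<inter> V)" "openin X (V \<inter> W)"
    using c(1) d(1) e(1) by auto
  have "norm_continuous X (U \<inter> V \<inter> W) M N (\<lambda>x. \<psi> x \<circ> f x \<circ> inv_into (hcar (F x)) (\<phi> x))"
    using f by (intro norm_continuous_subset[OF op(2,1) _ c(2) d(2)]) (auto simp: continuous_rep_def)
  moreover have "norm_continuous X (U \<inter> V \<inter> W) N K (\<lambda>x. \<eta> x \<circ> g x \<circ> inv_into (hcar (G x)) (\<psi> x))"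
    using g by (intro norm_continuous_subset[OF op(3,1) _ d(2) e(2)]) (auto simp: continuous_rep_def)
  ultimately have "norm_continuous X (U \<inter> V \<inter> W) M K
      (\<lambda>x. (\<eta> x \<circ> g x \<circ> inv_into (hcar (G x)) (\<psi> x)) \<circ> (\<psi> x \<circ> f x \<circ> inv_into (hcar (F x)) (\<phi> x)))"
    by (rule norm_continuous_comp[OF op(1) c(2) d(2) e(2)])
  then show ?thesis
  proof (rule norm_continuous_cong[OF op(1) c(2) e(2)])
    fix x v assume x: "x \<in> U \<inter> V \<inter> W" and v: "v \<in> hcar M"
    let ?w = "inv_into (hcar (F x)) (\<phi> x) v"
    have "?w \<in> hcar (F x)"
      using bounded_op_in[OF toplinear_isoD(2)[OF c(3)] v] x by simp
    moreover from this have "inv_into (hcar (G x)) (\<psi> x) (\<psi> x (f x ?w)) = f x ?w"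
      using toplinear_isoD(3)[OF d(3)] f_in x c(4) by simp
    ultimately show "(\<eta> x \<circ> h x \<circ> inv_into (hcar (F x)) (\<phi> x)) v
        = ((\<eta> x \<circ> g x \<circ> inv_into (hcar (G x)) (\<psi> x)) \<circ> (\<psi> x \<circ> f x \<circ> inv_into (hcar (F x)) (\<phi> x))) v"
      using h x c(4) by simp
  qed
qed

text \<open>The division principle in charts: \<open>h\<close> is \<open>g\<close> after
  \<open>f\<close>, so the representative of \<open>f\<close> is continuous if those of
  \<open>h\<close> and \<open>g\<close> are. It is applied with \<open>g\<close> an isomorphism, to
  invert it, and with \<open>g\<close> an inclusion, to restrict the target.\<close>

lemma continuous_rep_division:
  assumes c: "trivialization X F (U, M, \<phi>)" and d: "trivialization X G (V, N, \<psi>)"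
    and e: "trivialization X J (W, K, \<eta>)"
    and F: "\<And>x. x \<in> topspace X \<Longrightarrow> hilbert_space (F x)"
    and G: "\<And>x. x \<in> topspace X \<Longrightarrow> hilbert_space (G x)"
    and J: "\<And>x. x \<in> topspace X \<Longrightarrow> hilbert_space (J x)"
    and h: "norm_continuous X (U \<inter> V \<inter> W) M K (\<lambda>x. \<eta> x \<circ> h x \<circ> inv_into (hcar (F x)) (\<phi> x))"
    and g: "continuous_rep X G (V, N, \<psi>) (W, K, \<eta>) g"
    and f: "\<And>x. x \<in> topspace X \<Longrightarrow> bounded_op (F x) (G x) (f x)"
    and h_eq: "\<And>x v. x \<in> topspace X \<Longrightarrow> v \<in> hcar (F x) \<Longrightarrow> h x v = g x (f x v)"
    and g_in: "\<And>x v. x \<in> topspace X \<Longrightarrow> v \<in> hcar (G x) \<Longrightarrow> g x v \<in> hcar (J x)"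
    and below: "\<And>x. x \<in> topspace X \<Longrightarrow> \<exists>c>0. \<forall>v\<in>hcar (G x). hnorm (G x) v \<le> c * hnorm (J x) (g x v)"
  shows "norm_continuous X (U \<inter> V \<inter> W) M N (\<lambda>x. \<psi> x \<circ> f x \<circ> inv_into (hcar (F x)) (\<phi> x))"
proof -
  note c = trivializationD[OF c] and d = trivializationD[OF d] and e = trivializationD[OF e]
  have op: "openin X (U \<inter> V \<inter> W)" "openin X (V \<inter> W)"
    using c(1) d(1) e(1) by auto
  have nB: "norm_continuous X (U \<inter> V \<inter> W) N K (\<lambda>x. \<eta> x \<circ> g x \<circ> inv_into (hcar (G x)) (\<psi> x))"
    using g by (intro norm_continuous_subset[OF op(2,1) _ d(2) e(2)]) (auto simp: continuous_rep_def)
  show ?thesis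
  proof (rule norm_continuous_division[OF op(1) c(2) d(2) e(2) h nB])
    fix x assume "x \<in> U \<inter> V \<inter> W"
    then have x: "x \<in> U" "x \<in> V" "x \<in> W" "x \<in> topspace X"
      using c(4) by auto
    note Fx = F[OF x(4)] and Gx = G[OF x(4)] and Jx = J[OF x(4)]
    note \<phi> = toplinear_isoD[OF c(3)[OF x(1)]] and \<psi> = toplinear_isoD[OF d(3)[OF x(2)]]
    show "bounded_op M N (\<psi> x \<circ> f x \<circ> inv_into (hcar (F x)) (\<phi> x))"
      by (rule bounded_op_comp[OF c(2) Fx \<phi>(2) bounded_op_comp[OF Fx Gx f[OF x(4)] \<psi>(1)]])
    show "(\<eta> x \<circ> g x \<circ> inv_into (hcar (G x)) (\<psi> x)) ((\<psi> x \<circ> f x \<circ> inv_into (hcar (F x)) (\<phi> x)) v)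
        = (\<eta> x \<circ> h x \<circ> inv_into (hcar (F x)) (\<phi> x)) v" if v: "v \<in> hcar M" for v
      using bounded_op_in[OF \<phi>(2) v] bounded_op_in[OF f[OF x(4)]] x(4) by (simp add: h_eq \<psi>(3))
    obtain c1 where c1: "c1 > 0" "\<And>v. v \<in> hcar (G x) \<Longrightarrow> hnorm (G x) v \<le> c1 * hnorm (J x) (g x v)"
      using below[OF x(4)] by blast
    obtain c2 where c2: "c2 > 0" "\<And>v. v \<in> hcar (J x) \<Longrightarrow> hnorm (J x) v \<le> c2 * hnorm K (\<eta> x v)"
      using toplinear_iso_below[OF Jx e(2) e(3)[OF x(3)]] by blast
    obtain c3 where c3: "c3 > 0" "\<And>v. v \<in> hcar (G x) \<Longrightarrow> hnorm N (\<psi> x v) \<le> c3 * hnorm (G x) v"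
      using bounded_op_bound[OF Gx \<psi>(1)] by blast
    show "\<exists>c>0. \<forall>v\<in>hcar N. hnorm N v \<le> c * hnorm K ((\<eta> x \<circ> g x \<circ> inv_into (hcar (G x)) (\<psi> x)) v)"
    \<comment> \<open>The factors come from the norm of \<open>\<psi> x\<close>, the lower bound of
      \<open>g x\<close> and the lower bound of \<open>\<eta> x\<close>.\<close>
    proof (intro exI[of _ "c3 * c1 * c2"] conjI ballI)
      fix v assume v: "v \<in> hcar N"
      let ?w = "inv_into (hcar (G x)) (\<psi> x) v"
      have w: "?w \<in> hcar (G x)"
        by (rule bounded_op_in[OF \<psi>(2) v])
      have "hnorm N v \<le> c3 * hnorm (G x) ?w"
        using c3(2)[OF w] \<psi>(4)[OF v] by simp
      also have "\<dots> \<le> c3 * (c1 * hnorm (J x) (g x ?w))"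
        using c1(2)[OF w] c3(1) by simp
      also have "\<dots> \<le> c3 * (c1 * (c2 * hnorm K (\<eta> x (g x ?w))))"
        using c2(2)[OF g_in[OF x(4) w]] c1(1) c3(1) by simp
      finally show "hnorm N v \<le> c3 * c1 * c2 * hnorm K ((\<eta> x \<circ> g x \<circ> inv_into (hcar (G x)) (\<psi> x)) v)"
        by (simp add: mult.assoc)
    qed (use c1 c2 c3 in simp)
  qed
qed

lemma hilbert_bundleD:
  assumes "hilbert_bundle E"
  shows "\<And>x. x \<in> topspace (base E) \<Longrightarrow> hilbert_space (fibre E x)"
    and "\<And>x. x \<in> topspace (base E) \<Longrightarrow> \<exists>U M \<phi>. (U, M, \<phi>) \<in> charts E \<and> x \<in> U"
    and "\<And>c. c \<in> charts E \<Longrightarrow> trivialization (base E) (fibre E) c"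
    and "\<And>c. c \<in> charts E \<Longrightarrow> metric_continuous (base E) (fibre E) c"
    and "\<And>c d. c \<in> charts E \<Longrightarrow> d \<in> charts E \<Longrightarrow> continuous_rep (base E) (fibre E) c d (\<lambda>x. id)"
  using assms unfolding hilbert_bundle_def by fast+

lemma bundle_morphismD:
  assumes "bundle_morphism E F f"
  shows "base F = base E" "\<And>x. x \<in> topspace (base E) \<Longrightarrow> bounded_op (fibre E x) (fibre F x) (f x)"
    and "\<And>x v. x \<notin> topspace (base E) \<or> v \<notin> hcar (fibre E x) \<Longrightarrow> f x v = 0"
    and "\<And>c d. c \<in> charts E \<Longrightarrow> d \<in> charts F \<Longrightarrow> continuous_rep (base E) (fibre E) c d f"
  using assms unfolding bundle_morphism_def by fast+

text \<open>Only the continuity of the fibrewise inverses is at stake. It follows by division from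
  the fact that \<open>f\<close> after the inverse is the identity of \<open>F\<close>.\<close>

lemma bundle_isoI:
  assumes E: "hilbert_bundle E" and F: "hilbert_bundle F" and f: "bundle_morphism E F f"
    and iso: "\<And>x. x \<in> topspace (base E) \<Longrightarrow> toplinear_iso (fibre E x) (fibre F x) (f x)"
  shows "bundle_iso E F f"
proof -
  note E = hilbert_bundleD[OF E] and F = hilbert_bundleD[OF F] and f' = bundle_morphismD[OF f]
  define h where "h x v = (if x \<in> topspace (base E) \<and> v \<in> hcar (fibre F x)
    then inv_into (hcar (fibre E x)) (f x) v else 0)" for x v
  note iso' = toplinear_isoD[OF iso]
  have h_op: "bounded_op (fibre F x) (fibre E x) (h x)" if x: "x \<in> topspace (base E)" for x
    by (rule bounded_op_cong[OF _ iso'(2)[OF x]]) (use F(1) x f'(1) in \<open>simp_all add: h_def\<close>)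
  have fh: "f x (h x v) = v" if "x \<in> topspace (base E)" "v \<in> hcar (fibre F x)" for x v
    using that by (simp add: h_def iso'(4))
  have hf: "h x (f x v) = v" if "x \<in> topspace (base E)" "v \<in> hcar (fibre E x)" for x v
    using that bounded_op_in[OF iso'(1)] by (simp add: h_def iso'(3))
  have "bundle_morphism F E h"
    unfolding bundle_morphism_def f'(1)
  proof (intro conjI ballI allI impI)
    fix c d assume c: "c \<in> charts F" and d: "d \<in> charts E"
    obtain U M \<phi> V N \<psi> where cd: "c = (U, M, \<phi>)" "d = (V, N, \<psi>)"
      by (metis prod_cases3)
    note tc = F(3)[OF c, unfolded cd f'(1)] and td = E(3)[OF d, unfolded cd]
    have op: "openin (base E) (U \<inter> V \<inter> U)" "openin (base E) (U \<inter> U)"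
      using trivializationD(1)[OF tc] trivializationD(1)[OF td] by auto
    \<comment> \<open>The identity of \<open>F\<close>, read in the chart \<open>c\<close> on both
      sides, is the numerator of the division. The doubled \<open>U\<close> fits the shape of a
      triple overlap.\<close>
    have id: "norm_continuous (base E) (U \<inter> V \<inter> U) M M (\<lambda>x. \<phi> x \<circ> id \<circ> inv_into (hcar (fibre F x)) (\<phi> x))"
      using F(5)[OF c c] unfolding cd f'(1) continuous_rep_def
      by (intro norm_continuous_subset[OF op(2,1) _ trivializationD(2)[OF tc] trivializationD(2)[OF tc]]) auto
    have "norm_continuous (base E) (U \<inter> V \<inter> U) M N (\<lambda>x. \<psi> x \<circ> h x \<circ> inv_into (hcar (fibre F x)) (\<phi> x))"
    proof (rule continuous_rep_division[OF tc td tc _ _ _ id f'(4)[OF d c, unfolded cd]])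
      fix x assume x: "x \<in> topspace (base E)"
      show Fx: "hilbert_space (fibre F x)" and Ex: "hilbert_space (fibre E x)" and "hilbert_space (fibre F x)"
        using E(1) F(1) f'(1) x by auto
      show "\<exists>c>0. \<forall>v\<in>hcar (fibre E x). hnorm (fibre E x) v \<le> c * hnorm (fibre F x) (f x v)"
        by (rule toplinear_iso_below[OF Ex Fx iso[OF x]]) blast
      show "bounded_op (fibre F x) (fibre E x) (h x)"
        by (rule h_op[OF x])
      fix v
      show "id v = f x (h x v)" if "v \<in> hcar (fibre F x)"
        using fh[OF x that] by simp
      show "f x v \<in> hcar (fibre F x)" if "v \<in> hcar (fibre E x)"
        by (rule bounded_op_in[OF iso'(1)[OF x] that])
    qed
    moreover have "U \<inter> V \<inter> U = U \<inter> V"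
      by auto
    ultimately show "continuous_rep (base E) (fibre F) c d h"
      by (simp add: cd continuous_rep_def)
  qed (use h_op in \<open>auto simp: h_def\<close>)
  moreover have "h \<odot> f = bundle_id E"
  proof (intro ext)
    fix x v
    have "h x 0 = 0"
      using bounded_op_zero[OF F(1) h_op] f'(1) by (cases "x \<in> topspace (base E)") (simp_all add: h_def)
    then show "(h \<odot> f) x v = bundle_id E x v"
      using hf[of x v] f'(3)[of x v] by (simp add: pcomp_def bundle_id_def id_op_def)
  qed
  moreover have "f \<odot> h = bundle_id F"
  proof (intro ext)
    fix x v
    have "f x 0 = 0"
      using bounded_op_zero[OF E(1) f'(2)] f'(3) by blast
    then show "(f \<odot> h) x v = bundle_id F x v"
      using fh[of x v] by (auto simp: pcomp_def bundle_id_def id_op_def f'(1) h_def)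
  qed
  ultimately show ?thesis
    using f by (auto simp: bundle_iso_def)
qed

section \<open>The bundle structure on the range of a projection\<close>

lemma range_fibre_eq: "range_fibre E p x = range_space (fibre E x) (p x)"
  by (simp add: range_fibre_def range_space_def)

lemma hnorm_range_fibre: "hnorm (range_fibre E p x) = hnorm (fibre E x)"
  by (simp add: range_fibre_eq)

lemma hip_range_fibre: "hip (range_fibre E p x) = hip (fibre E x)"
  by (simp add: range_fibre_eq)

context
  fixes E :: "('x, 'f::complex_vector) hbundle" and p
  assumes E: "hilbert_bundle E" and p: "bundle_morphism E E p" and pp: "p \<odot> p = p"
begin

lemma projection_fibre: "p x (p x v) = p x v"
  using fun_cong[OF fun_cong[OF pp, of x], of v] by (simp add: pcomp_def)

lemma in_range_fibre:
  "x \<in> topspace (base E) \<Longrightarrow> v \<in> hcar (range_fibre E p x) \<longleftrightarrow> v \<in> hcar (fibre E x) \<and> p x v = v"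
  unfolding range_fibre_eq by (rule hcar_range_space[OF bundle_morphismD(2)[OF p] projection_fibre])

lemma hilbert_range_fibre: "x \<in> topspace (base E) \<Longrightarrow> hilbert_space (range_fibre E p x)"
  unfolding range_fibre_eq
  by (rule hilbert_space_range_space[OF hilbert_bundleD(1)[OF E] bundle_morphismD(2)[OF p] projection_fibre])

lemma bounded_op_incl:
  "x \<in> topspace (base E) \<Longrightarrow> bounded_op (range_fibre E p x) (fibre E x) id"
  by (rule bounded_opI[where C = 1]) (simp_all add: in_range_fibre hnorm_range_fibre)

text \<open>Near \<open>x\<^sub>0\<close> the ranges of the projections \<open>q x\<close> are identified with that of \<open>q\<^sub>0 = q x\<^sub>0\<close> by
  \<open>q\<^sub>0\<close>, which on the range of \<open>q x\<close> agrees with the operator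
  \<open>T x = q\<^sub>0 q x + (1 - q\<^sub>0) (1 - q x) = 1 + (2 q\<^sub>0 - 1) (q x - q\<^sub>0)\<close> near the identity.\<close>

lemma range_bundle_chart:
  assumes x0: "x\<^sub>0 \<in> topspace (base E)"
  shows "\<exists>U M \<phi>. (U, M, \<phi>) \<in> charts (range_bundle E p) \<and> x\<^sub>0 \<in> U"
proof -
  let ?X = "base E"
  note E' = hilbert_bundleD[OF E] and p' = bundle_morphismD[OF p]
  obtain U M \<phi> where c: "(U, M, \<phi>) \<in> charts E" and x0U: "x\<^sub>0 \<in> U"
    using E'(2)[OF x0] by blast
  note tr = trivializationD[OF E'(3)[OF c]]
  note U = tr(1) and M = tr(2) and iso = toplinear_isoD[OF tr(3)]
  \<comment> \<open>The projection of the bundle becomes a norm-continuous family of projections of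
    the fixed space \<open>M\<close>.\<close>
  define q where "q x = \<phi> x \<circ> p x \<circ> inv_into (hcar (fibre E x)) (\<phi> x)" for x
  have nq: "norm_continuous ?X U M M q"
    using p'(4)[OF c c] by (simp add: continuous_rep_def q_def[abs_def])
  note bq = norm_continuous_bounded[OF nq]
  have q\<phi>: "q x (\<phi> x v) = \<phi> x (p x v)" if "x \<in> U" "v \<in> hcar (fibre E x)" for x v
    using that by (simp add: q_def iso(3))
  have qq: "q x (q x m) = q x m" if x: "x \<in> U" and m: "m \<in> hcar M" for x m
    using bounded_op_in[OF iso(2)[OF x] m] bounded_op_in[OF p'(2)[OF tr(4)[OF x]]] x
    by (simp add: q_def iso(3) projection_fibre)
  define q0 where "q0 = q x\<^sub>0"
  have b0: "bounded_op M M q0" and q00: "\<And>m. m \<in> hcar M \<Longrightarrow> q0 (q0 m) = q0 m"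
    using bq qq x0U by (auto simp: q0_def)
  define M0 where "M0 = range_space M q0"
  have M0: "hilbert_space M0"
    unfolding M0_def by (rule hilbert_space_range_space[OF M b0 q00])
  have M0_iff: "m \<in> hcar M0 \<longleftrightarrow> m \<in> hcar M \<and> q0 m = m" for m
    unfolding M0_def by (rule hcar_range_space[OF b0 q00])
  have nM0: "hnorm M0 = hnorm M"
    by (simp add: M0_def)
  obtain C where C: "C > 0" "\<And>m. m \<in> hcar M \<Longrightarrow> hnorm M (q0 m) \<le> C * hnorm M m"
    using bounded_op_bound[OF M b0] by blast
  \<comment> \<open>\<open>2 * C + 1\<close> bounds the norm of \<open>2 q\<^sub>0 - 1\<close>, so
    staying within \<open>d\<close> of \<open>q0\<close> keeps \<open>T x\<close> within 1/2 of the
    identity.\<close>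
  define d where "d = 1 / (2 * (2 * C + 1))"
  have d: "d > 0" "(2 * C + 1) * d = 1 / 2"
    using C(1) by (simp_all add: d_def field_simps)
  obtain V where V: "openin ?X V" "x\<^sub>0 \<in> V" "V \<subseteq> U"
    and close: "\<And>x m. x \<in> V \<Longrightarrow> m \<in> hcar M \<Longrightarrow> hnorm M (q x m - q0 m) \<le> d * hnorm M m"
    using norm_continuousD[OF U M M nq x0U d(1)] x0 unfolding eventually_nhdsin q0_def by blast
  define T where "T x m = q0 (q x m) + ((m - q x m) - q0 (m - q x m))" for x m
  have nqV: "norm_continuous ?X V M M q"
    by (rule norm_continuous_subset[OF U V(1,3) M M nq])
  have nT: "norm_continuous ?X V M M T"
  proof -
    note const = norm_continuous_const[OF V(1) M M]
    note comp = norm_continuous_comp[OF V(1) M M M _ const[OF b0]]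
    have n1: "norm_continuous ?X V M M (\<lambda>x m. m - q x m)"
      using norm_continuous_minus[OF V(1) M M const[OF bounded_op_id] nqV] by simp
    show ?thesis
      using norm_continuous_plus[OF V(1) M M comp[OF nqV] norm_continuous_minus[OF V(1) M M n1 comp[OF n1]]]
      by (simp add: T_def[abs_def])
  qed
  note bT = norm_continuous_bounded[OF nT]
  have near: "hnorm M (m - T x m) \<le> 1 / 2 * hnorm M m" if x: "x \<in> V" and m: "m \<in> hcar M" for x m
  proof -
    have xU: "x \<in> U"
      using x V(3) by blast
    let ?w = "q x m - q0 m"
    have i [simp]: "q x m \<in> hcar M" "q0 m \<in> hcar M" "q0 (q x m) \<in> hcar M" "?w \<in> hcar M" "q0 ?w \<in> hcar M"
      using m bounded_op_in[OF bq[OF xU]] bounded_op_in[OF b0] by (simp_all add: hs_diff[OF M])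
    have "m - T x m = ?w - (q0 ?w + q0 ?w)"
      using m by (simp add: T_def bounded_op_diff[OF M b0] q00 algebra_simps)
    then have "hnorm M (m - T x m) = hnorm M (?w - (q0 ?w + q0 ?w))"
      by (rule arg_cong)
    also have "\<dots> \<le> hnorm M ?w + hnorm M (q0 ?w + q0 ?w)"
      by (intro hnorm_triangle_minus[OF M] hs_add[OF M] i)
    also have "\<dots> \<le> hnorm M ?w + (hnorm M (q0 ?w) + hnorm M (q0 ?w))"
      by (intro add_left_mono hnorm_triangle[OF M] i)
    also have "\<dots> \<le> (2 * C + 1) * hnorm M ?w"
      using C(2)[OF i(4)] by (simp add: algebra_simps)
    also have "\<dots> \<le> (2 * C + 1) * (d * hnorm M m)"
      using close[OF x m] C(1) by (intro mult_left_mono) auto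
    also have "\<dots> = 1 / 2 * hnorm M m"
      using d(2) by (simp flip: mult.assoc)
    finally show ?thesis .
  qed
  have Tbelow: "hnorm M m \<le> 2 * hnorm M (T x m)" if x: "x \<in> V" and m: "m \<in> hcar M" for x m
    using perturbed_identity_below[OF M bT[OF x] near[OF x] m] by simp
  \<comment> \<open>\<open>q0\<close> annihilates the second summand of \<open>T x\<close>. This
    places preimages under \<open>T x\<close> of vectors of \<open>M0\<close> in the range of
    \<open>q x\<close>.\<close>
  have q0T: "q0 (T x m) = q0 (q x m)" if x: "x \<in> V" and m: "m \<in> hcar M" for x m
  proof -
    have i [simp]: "q x m \<in> hcar M" "m - q x m \<in> hcar M"
      using m x V(3) bounded_op_in[OF bq] by (auto simp: hs_diff[OF M])
    then show ?thesis
      using bounded_op_in[OF b0] by (simp add: T_def bounded_op_diff[OF M b0] bounded_op_add[OF b0] q00 hs_diff[OF M])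
  qed
  define \<psi> where "\<psi> x v = q0 (\<phi> x v)" for x v
  have T\<phi>: "T x (\<phi> x v) = \<psi> x v" if x: "x \<in> V" and v: "v \<in> hcar (range_fibre E p x)" for x v
  proof -
    have "x \<in> U" "x \<in> topspace ?X"
      using x V(3) tr(4) by auto
    then have "q x (\<phi> x v) = \<phi> x v"
      using v q\<phi>[of x v] by (simp add: in_range_fibre)
    then show ?thesis
      by (simp add: T_def \<psi>_def bounded_op_zero[OF M b0])
  qed
  have \<psi>: "toplinear_iso (range_fibre E p x) M0 (\<psi> x)" if x: "x \<in> V" for x
  proof -
    have xU: "x \<in> U" and xX: "x \<in> topspace ?X"
      using x V(3) tr(4) by auto
    note Ex = E'(1)[OF xX] and R = hilbert_range_fibre[OF xX]
    have "bounded_op M M0 q0"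
      using b0 q00 by (simp add: bounded_op_def M0_iff nM0)
    from bounded_op_comp[OF R Ex bounded_op_incl[OF xX] bounded_op_comp[OF Ex M iso(1)[OF xU] this]]
    have b\<psi>: "bounded_op (range_fibre E p x) M0 (\<psi> x)"
      by (simp add: \<psi>_def[abs_def] comp_def)
    obtain c where c: "c > 0" "\<And>v. v \<in> hcar (fibre E x) \<Longrightarrow> hnorm (fibre E x) v \<le> c * hnorm M (\<phi> x v)"
      using toplinear_iso_below[OF Ex M tr(3)[OF xU]] by blast
    show ?thesis
    proof (rule bij_bounded_below_toplinear_iso[OF R M0 b\<psi>])
      fix v assume v: "v \<in> hcar (range_fibre E p x)"
      then have vE: "v \<in> hcar (fibre E x)"
        by (simp add: in_range_fibre xX)
      have "hnorm (fibre E x) v \<le> c * hnorm M (\<phi> x v)"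
        by (rule c(2)[OF vE])
      also have "\<dots> \<le> c * (2 * hnorm M (\<psi> x v))"
        using Tbelow[OF x bounded_op_in[OF iso(1)[OF xU] vE]] c(1) by (simp add: T\<phi>[OF x v])
      finally show "hnorm (range_fibre E p x) v \<le> (2 * c) * hnorm M0 (\<psi> x v)"
        by (simp add: hnorm_range_fibre nM0 mult_ac)
    next
      fix y assume y: "y \<in> hcar M0"
      \<comment> \<open>The preimage \<open>m\<close> need not lie in the range of
        \<open>q x\<close>, but \<open>q x m\<close> does, and q0 (q x m) = q0 (T x m) = q0 y =
        y.\<close>
      obtain m where m: "m \<in> hcar M" "T x m = y"
        using perturbed_identity_surj[OF M bT[OF x] _ _ near[OF x], of y] y by (auto simp: M0_iff)
      have qm: "q x m \<in> hcar M"
        by (rule bounded_op_in[OF bq[OF xU] m(1)])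
      let ?v = "inv_into (hcar (fibre E x)) (\<phi> x) (q x m)"
      have v: "?v \<in> hcar (fibre E x)"
        by (rule bounded_op_in[OF iso(2)[OF xU] qm])
      have "\<phi> x (p x ?v) = q x m"
        using q\<phi>[OF xU v] qq[OF xU m(1)] by (simp add: iso(4)[OF xU qm])
      then have "p x ?v = ?v"
        using iso(3)[OF xU bounded_op_in[OF p'(2)[OF xX] v]] by simp
      moreover have "\<psi> x ?v = y"
        using q0T[OF x m(1)] m(2) y by (simp add: \<psi>_def iso(4)[OF xU qm] M0_iff)
      ultimately show "\<exists>v\<in>hcar (range_fibre E p x). \<psi> x v = y"
        using v by (intro bexI[of _ ?v]) (simp_all add: in_range_fibre xX)
    qed
  qed
  have triv: "trivialization ?X (range_fibre E p) (V, M0, \<psi>)"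
    using V(1) M0 \<psi> by (simp add: trivialization_def)
  \<comment> \<open>\<open>S x\<close> is the inclusion of the range into the bundle, read as a map
    from \<open>M0\<close> to \<open>M\<close>. Since \<open>T x\<close> after \<open>S x\<close> is
    the constant inclusion of \<open>M0\<close> in \<open>M\<close>, division makes \<open>S\<close>
    continuous.\<close>
  define S where "S x = \<phi> x \<circ> inv_into (hcar (range_fibre E p x)) (\<psi> x)" for x
  note iso\<psi> = toplinear_isoD[OF \<psi>]
  have S: "norm_continuous ?X V M0 M S"
  proof (rule norm_continuous_division[OF V(1) M0 M M _ nT])
    have "bounded_op M0 M id"
      by (rule bounded_opI[where C = 1]) (simp_all add: M0_iff nM0)
    then show "norm_continuous ?X V M0 M (\<lambda>_. id)"
      by (rule norm_continuous_const[OF V(1) M0 M])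
    fix x assume x: "x \<in> V"
    then have xU: "x \<in> U" and xX: "x \<in> topspace ?X"
      using V(3) tr(4) by auto
    note Ex = E'(1)[OF xX] and R = hilbert_range_fibre[OF xX]
    show "bounded_op M0 M (S x)"
      using bounded_op_comp[OF M0 R iso\<psi>(2)[OF x] bounded_op_comp[OF R Ex bounded_op_incl[OF xX] iso(1)[OF xU]]]
      by (simp add: S_def comp_def)
    show "T x (S x m) = id m" if "m \<in> hcar M0" for m
      using T\<phi>[OF x bounded_op_in[OF iso\<psi>(2)[OF x] that]] that by (simp add: S_def iso\<psi>(4)[OF x])
    show "\<exists>c>0. \<forall>m\<in>hcar M. hnorm M m \<le> c * hnorm M (T x m)"
      using Tbelow[OF x] by (intro exI[of _ 2]) simp
  qed
  \<comment> \<open>For any other chart of \<open>E\<close>, the inclusion is \<open>S\<close>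
    followed by the transition map from the chart used to construct \<open>\<psi>\<close>.\<close>
  have "continuous_rep ?X (range_fibre E p) (V, M0, \<psi>) e (\<lambda>x. id)" if e: "e \<in> charts E" for e
  proof -
    obtain W K \<eta> where eq: "e = (W, K, \<eta>)"
      by (metis prod_cases3)
    note tr' = trivializationD[OF E'(3)[OF e[unfolded eq]]]
    note K = tr'(2)
    have op: "openin ?X (V \<inter> W)" "openin ?X (U \<inter> W)"
      using U V(1) tr'(1) by auto
    have "norm_continuous ?X (V \<inter> W) M K (\<lambda>x. \<eta> x \<circ> id \<circ> inv_into (hcar (fibre E x)) (\<phi> x))"
      using E'(5)[OF c e] V(3) unfolding eq continuous_rep_def
      by (intro norm_continuous_subset[OF op(2,1) _ M K]) auto
    moreover have "norm_continuous ?X (V \<inter> W) M0 M S"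
      by (rule norm_continuous_subset[OF V(1) op(1) _ M0 M S]) auto
    ultimately have "norm_continuous ?X (V \<inter> W) M0 K
        (\<lambda>x. (\<eta> x \<circ> id \<circ> inv_into (hcar (fibre E x)) (\<phi> x)) \<circ> S x)"
      by (intro norm_continuous_comp[OF op(1) M0 M K])
    then have "norm_continuous ?X (V \<inter> W) M0 K
        (\<lambda>x. \<eta> x \<circ> id \<circ> inv_into (hcar (range_fibre E p x)) (\<psi> x))"
    proof (rule norm_continuous_cong[OF op(1) M0 K])
      fix x m assume x: "x \<in> V \<inter> W" and m: "m \<in> hcar M0"
      then have xU: "x \<in> U" and xX: "x \<in> topspace ?X"
        using V(3) tr(4) by auto
      let ?v = "inv_into (hcar (range_fibre E p x)) (\<psi> x) m"
      have "?v \<in> hcar (fibre E x)"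
        using bounded_op_in[OF iso\<psi>(2) m, of x] x in_range_fibre[OF xX] by blast
      then show "(\<eta> x \<circ> id \<circ> inv_into (hcar (range_fibre E p x)) (\<psi> x)) m
          = ((\<eta> x \<circ> id \<circ> inv_into (hcar (fibre E x)) (\<phi> x)) \<circ> S x) m"
        by (simp add: S_def iso(3)[OF xU])
    qed
    then show ?thesis
      by (simp add: eq continuous_rep_def)
  qed
  with triv V(2) show ?thesis
    by (intro exI[of _ V] exI[of _ M0] exI[of _ \<psi>]) (simp add: range_bundle_def)
qed

end

lemma range_bundle_simps [simp]:
  "base (range_bundle E p) = base E" "fibre (range_bundle E p) = range_fibre E p"
  by (simp_all add: range_bundle_def)

lemma charts_range_bundleD:
  assumes "c \<in> charts (range_bundle E p)"
  shows "trivialization (base E) (range_fibre E p) c"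
    and "\<And>d. d \<in> charts E \<Longrightarrow> continuous_rep (base E) (range_fibre E p) c d (\<lambda>x. id)"
  using assms by (simp_all add: range_bundle_def)

lemma metric_continuousD:
  assumes "metric_continuous X F (U, M, \<phi>)" "x\<^sub>0 \<in> U" "openin X U" "e > 0"
  shows "\<forall>\<^sub>F x in nhdsin X x\<^sub>0. \<forall>u\<in>hcar M. \<forall>v\<in>hcar M.
    cmod (hip (F x) (inv_into (hcar (F x)) (\<phi> x) u) (inv_into (hcar (F x)) (\<phi> x) v)
      - hip (F x\<^sub>0) (inv_into (hcar (F x\<^sub>0)) (\<phi> x\<^sub>0) u) (inv_into (hcar (F x\<^sub>0)) (\<phi> x\<^sub>0) v))
      \<le> e * hnorm M u * hnorm M v"
  using assms by (simp add: metric_continuous_def Let_def nhdsin_subtopology_open)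

text \<open>If the metric of \<open>E\<close> is \<open>G x\<close> in a chart and the inclusion is \<open>a x\<close>, the metric of the range is
  \<open>G x (a x u) (a x v)\<close>.\<close>

lemma metric_continuous_range_bundle:
  assumes E: "hilbert_bundle E" and p: "bundle_morphism E E p" and pp: "p \<odot> p = p"
    and c: "c \<in> charts (range_bundle E p)"
  shows "metric_continuous (base E) (range_fibre E p) c"
proof -
  let ?X = "base E"
  note E' = hilbert_bundleD[OF E]
  obtain U M \<phi> where c_eq: "c = (U, M, \<phi>)"
    by (metis prod_cases3)
  note c' = charts_range_bundleD[OF c[unfolded c_eq]]
  note tr = trivializationD[OF c'(1)]
  note U = tr(1) and M = tr(2) and iso = toplinear_isoD[OF tr(3)]
  have main: "\<forall>\<^sub>F x in nhdsin ?X x\<^sub>0. \<forall>u\<in>hcar M. \<forall>v\<in>hcar M.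
    cmod (hip (fibre E x) (inv_into (hcar (range_fibre E p x)) (\<phi> x) u) (inv_into (hcar (range_fibre E p x)) (\<phi> x) v)
      - hip (fibre E x\<^sub>0) (inv_into (hcar (range_fibre E p x\<^sub>0)) (\<phi> x\<^sub>0) u) (inv_into (hcar (range_fibre E p x\<^sub>0)) (\<phi> x\<^sub>0) v))
      \<le> e * hnorm M u * hnorm M v"
    if x0: "x\<^sub>0 \<in> U" and e: "e > 0" for x\<^sub>0 e
  proof -
    have x0X: "x\<^sub>0 \<in> topspace ?X"
      by (rule tr(4)[OF x0])
    obtain W K \<eta> where d: "(W, K, \<eta>) \<in> charts E" and x0W: "x\<^sub>0 \<in> W"
      using E'(2)[OF x0X] by blast
    note tr' = trivializationD[OF E'(3)[OF d]]
    note W = tr'(1) and K = tr'(2) and iso' = toplinear_isoD[OF tr'(3)]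
    have op: "openin ?X (U \<inter> W)" and x0UW: "x\<^sub>0 \<in> U \<inter> W"
      using U W x0 x0W by auto
    define a where "a x = \<eta> x \<circ> id \<circ> inv_into (hcar (range_fibre E p x)) (\<phi> x)" for x
    define g where "g x k l = hip (fibre E x) (inv_into (hcar (fibre E x)) (\<eta> x) k)
      (inv_into (hcar (fibre E x)) (\<eta> x) l)" for x k l
    have na: "norm_continuous ?X (U \<inter> W) M K a"
      using c'(2)[OF d] by (simp add: continuous_rep_def a_def[abs_def])
    note ba = norm_continuous_bounded[OF na]
    have rep: "hip (fibre E x) (inv_into (hcar (range_fibre E p x)) (\<phi> x) u) (inv_into (hcar (range_fibre E p x)) (\<phi> x) v)
        = g x (a x u) (a x v)" if x: "x \<in> U" "x \<in> W" and u: "u \<in> hcar M" and v: "v \<in> hcar M" for x u v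
      using bounded_op_in[OF iso(2)[OF x(1)] u] bounded_op_in[OF iso(2)[OF x(1)] v]
      by (simp add: g_def a_def in_range_fibre[OF E p pp tr(4)[OF x(1)]] iso'(3)[OF x(2)])
    obtain C where C: "C > 0" "\<And>u. u \<in> hcar M \<Longrightarrow> hnorm K (a x\<^sub>0 u) \<le> C * hnorm M u"
      using bounded_op_bound[OF M ba[OF x0UW]] by blast
    obtain B where B: "B > 0" "\<And>k. k \<in> hcar K \<Longrightarrow>
        hnorm (fibre E x\<^sub>0) (inv_into (hcar (fibre E x\<^sub>0)) (\<eta> x\<^sub>0) k) \<le> B * hnorm K k"
      using bounded_op_bound[OF K iso'(2)[OF x0W]] by blast
    have g0: "cmod (g x\<^sub>0 k l) \<le> B\<^sup>2 * hnorm K k * hnorm K l" if k: "k \<in> hcar K" and l: "l \<in> hcar K" for k l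
    proof -
      note i = bounded_op_in[OF iso'(2)[OF x0W]]
      have "cmod (g x\<^sub>0 k l) \<le> (B * hnorm K k) * (B * hnorm K l)"
        unfolding g_def
        by (rule order_trans[OF hip_cauchy_schwarz[OF E'(1)[OF x0X] i[OF k] i[OF l]]])
          (intro mult_mono B k l; use B(1) k l hnorm_ge_0[OF K] hnorm_ge_0[OF E'(1)[OF x0X]] i in auto)
      then show ?thesis
        by (simp add: power2_eq_square mult_ac)
    qed
    \<comment> \<open>The summands bound, up to the common factor \<open>\<delta>\<close>, the three
      differences in \<open>split\<close> below. The bound 1 on \<open>\<delta>\<close> makes
      \<open>C + 1\<close> a bound for the inclusion at nearby points.\<close>
    define D where "D = (C + 1)\<^sup>2 + B\<^sup>2 * (C + 1) + B\<^sup>2 * C"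
    define \<delta> where "\<delta> = min 1 (e / D)"
    have D: "D > 0"
      using C(1) B(1) by (simp add: D_def add_pos_pos)
    have \<delta>: "\<delta> > 0" "\<delta> \<le> 1" "\<delta> * D \<le> e"
      using e D by (simp_all add: \<delta>_def flip: pos_le_divide_eq[OF D])
    have "\<forall>\<^sub>F x in nhdsin ?X x\<^sub>0. \<forall>k\<in>hcar K. \<forall>l\<in>hcar K.
        cmod (g x k l - g x\<^sub>0 k l) \<le> \<delta> * hnorm K k * hnorm K l"
      unfolding g_def by (rule metric_continuousD[OF E'(4)[OF d] x0W W \<delta>(1)])
    with norm_continuousD[OF op M K na x0UW \<delta>(1)] show ?thesis
    proof eventually_elim
      case (elim x)
      show ?case
      proof (intro ballI)
        fix u v assume u: "u \<in> hcar M" and v: "v \<in> hcar M"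
        have x: "x \<in> U" "x \<in> W" "x \<in> U \<inter> W"
          using elim by auto
        note [simp] = u v bounded_op_in[OF ba[OF x(3)]] bounded_op_in[OF ba[OF x0UW]] hs_diff[OF K]
          hnorm_ge_0[OF M] hnorm_ge_0[OF K]
        note i0 = bounded_op_in[OF iso'(2)[OF x0W]]
        have da: "hnorm K (a x w - a x\<^sub>0 w) \<le> \<delta> * hnorm M w" if "w \<in> hcar M" for w
          using elim that by simp
        have ax: "hnorm K (a x w) \<le> (C + 1) * hnorm M w" if w: "w \<in> hcar M" for w
        proof -
          have "\<delta> * hnorm M w \<le> 1 * hnorm M w"
            using \<delta>(2) w by (intro mult_right_mono) auto
          then show ?thesis
            using da[OF w] hnorm_triangle_ineq2[OF K, of "a x w" "a x\<^sub>0 w"] C(2)[OF w] w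
            by (simp add: algebra_simps)
        qed
        \<comment> \<open>The change of the metric is separated from the changes of the inclusion in
          the first and in the second argument.\<close>
        have split: "g x (a x u) (a x v) - g x\<^sub>0 (a x\<^sub>0 u) (a x\<^sub>0 v)
            = (g x (a x u) (a x v) - g x\<^sub>0 (a x u) (a x v)) + g x\<^sub>0 (a x u - a x\<^sub>0 u) (a x v)
              + g x\<^sub>0 (a x\<^sub>0 u) (a x v - a x\<^sub>0 v)"
          by (simp add: g_def bounded_op_diff[OF K iso'(2)[OF x0W]] i0
              hip_diff_left[OF E'(1)[OF x0X]] hip_diff_right[OF E'(1)[OF x0X]])
        have 1: "cmod (g x (a x u) (a x v) - g x\<^sub>0 (a x u) (a x v))
            \<le> \<delta> * ((C + 1) * hnorm M u) * ((C + 1) * hnorm M v)"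
        proof -
          have "cmod (g x (a x u) (a x v) - g x\<^sub>0 (a x u) (a x v)) \<le> \<delta> * hnorm K (a x u) * hnorm K (a x v)"
            using elim by simp
          also have "\<dots> \<le> \<delta> * ((C + 1) * hnorm M u) * ((C + 1) * hnorm M v)"
            using \<delta>(1) C(1) by (intro mult_mono ax mult_left_mono u v) auto
          finally show ?thesis .
        qed
        have 2: "cmod (g x\<^sub>0 (a x u - a x\<^sub>0 u) (a x v)) \<le> B\<^sup>2 * (\<delta> * hnorm M u) * ((C + 1) * hnorm M v)"
        proof -
          have "cmod (g x\<^sub>0 (a x u - a x\<^sub>0 u) (a x v)) \<le> B\<^sup>2 * hnorm K (a x u - a x\<^sub>0 u) * hnorm K (a x v)"
            by (intro g0) simp_all
          also have "\<dots> \<le> B\<^sup>2 * (\<delta> * hnorm M u) * ((C + 1) * hnorm M v)"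
            using \<delta>(1) C(1) by (intro mult_mono ax da mult_left_mono u v) auto
          finally show ?thesis .
        qed
        have 3: "cmod (g x\<^sub>0 (a x\<^sub>0 u) (a x v - a x\<^sub>0 v)) \<le> B\<^sup>2 * (C * hnorm M u) * (\<delta> * hnorm M v)"
        proof -
          have "cmod (g x\<^sub>0 (a x\<^sub>0 u) (a x v - a x\<^sub>0 v)) \<le> B\<^sup>2 * hnorm K (a x\<^sub>0 u) * hnorm K (a x v - a x\<^sub>0 v)"
            by (intro g0) simp_all
          also have "\<dots> \<le> B\<^sup>2 * (C * hnorm M u) * (\<delta> * hnorm M v)"
            using \<delta>(1) C(1) by (intro mult_mono C(2) da mult_left_mono u v) auto
          finally show ?thesis .
        qed
        have "cmod (g x (a x u) (a x v) - g x\<^sub>0 (a x\<^sub>0 u) (a x\<^sub>0 v)) \<le>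
            \<delta> * ((C + 1) * hnorm M u) * ((C + 1) * hnorm M v) + B\<^sup>2 * (\<delta> * hnorm M u) * ((C + 1) * hnorm M v)
              + B\<^sup>2 * (C * hnorm M u) * (\<delta> * hnorm M v)"
          unfolding split by (intro order_trans[OF norm_triangle_ineq] add_mono 1 2 3)
        also have "\<dots> = (\<delta> * D) * (hnorm M u * hnorm M v)"
          by (simp add: D_def power2_eq_square algebra_simps)
        also have "\<dots> \<le> e * (hnorm M u * hnorm M v)"
          using \<delta>(3) by (intro mult_right_mono) auto
        finally show "cmod (hip (fibre E x) (inv_into (hcar (range_fibre E p x)) (\<phi> x) u) (inv_into (hcar (range_fibre E p x)) (\<phi> x) v)
            - hip (fibre E x\<^sub>0) (inv_into (hcar (range_fibre E p x\<^sub>0)) (\<phi> x\<^sub>0) u) (inv_into (hcar (range_fibre E p x\<^sub>0)) (\<phi> x\<^sub>0) v))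
            \<le> e * hnorm M u * hnorm M v"
          by (simp only: rep[OF x(1,2) u v] rep[OF x0 x0W u v] mult.assoc)
      qed
    qed
  qed
  show ?thesis
    unfolding c_eq metric_continuous_def Let_def
    by (simp add: hip_range_fibre nhdsin_subtopology_open[OF U] main)
qed

text \<open>The inclusion of the range is isometric, hence bounded below, so continuity into
  \<open>F\<close> implies continuity into the range by division. The assumption \<open>incl\<close>
  is local because the continuity into \<open>F\<close> may be known only where a further chart of
  the source is available.\<close>

lemma continuous_rep_into_range_bundle:
  fixes E F :: "('x, 'f::complex_vector) hbundle"
  assumes F: "hilbert_bundle F" and q: "bundle_morphism F F q" "q \<odot> q = q"
    and G: "\<And>x. x \<in> topspace (base F) \<Longrightarrow> hilbert_space (G x)"
    and c: "trivialization (base F) G c" and d: "d \<in> charts (range_bundle F q)"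
    and f: "\<And>x. x \<in> topspace (base F) \<Longrightarrow> bounded_op (G x) (range_fibre F q x) (f x)"
    and incl: "\<And>x\<^sub>0. x\<^sub>0 \<in> topspace (base F) \<Longrightarrow> \<exists>U M \<phi> V W K \<eta>. c = (U, M, \<phi>) \<and>
      (W, K, \<eta>) \<in> charts F \<and> openin (base F) V \<and> x\<^sub>0 \<in> V \<and> x\<^sub>0 \<in> W \<and>
      norm_continuous (base F) (U \<inter> (V \<inter> W)) M K (\<lambda>x. \<eta> x \<circ> f x \<circ> inv_into (hcar (G x)) (\<phi> x))"
  shows "continuous_rep (base F) G c d f"
proof -
  let ?X = "base F"
  note F' = hilbert_bundleD[OF F]
  obtain U M \<phi> V N \<psi> where cd: "c = (U, M, \<phi>)" "d = (V, N, \<psi>)"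
    by (metis prod_cases3)
  note tc = c[unfolded cd] and d' = charts_range_bundleD[OF d[unfolded cd]]
  note trc = trivializationD[OF tc] and trd = trivializationD[OF d'(1)]
  have op: "openin ?X (U \<inter> V)"
    using trc(1) trd(1) by auto
  have "norm_continuous ?X (U \<inter> V) M N (\<lambda>x. \<psi> x \<circ> f x \<circ> inv_into (hcar (G x)) (\<phi> x))"
  proof (rule norm_continuous_local[OF op trc(2) trd(2)])
    fix x\<^sub>0 assume x0: "x\<^sub>0 \<in> U \<inter> V"
    then have "x\<^sub>0 \<in> topspace ?X"
      using trc(4) by auto
    from incl[OF this] obtain O' W K \<eta> where e: "(W, K, \<eta>) \<in> charts F" and O': "openin ?X O'" "x\<^sub>0 \<in> O'" "x\<^sub>0 \<in> W"
      and nf: "norm_continuous ?X (U \<inter> (O' \<inter> W)) M K (\<lambda>x. \<eta> x \<circ> f x \<circ> inv_into (hcar (G x)) (\<phi> x))"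
      unfolding cd by blast
    note tre = trivializationD[OF F'(3)[OF e]]
    \<comment> \<open>The source chart is cut down to \<open>O'\<close>, so that the set where
      \<open>f\<close> is known to be continuous has the shape of a triple overlap.\<close>
    have tc': "trivialization ?X G (U \<inter> O', M, \<phi>)"
      using trc O'(1) by (auto simp: trivialization_def)
    have op': "openin ?X (U \<inter> O' \<inter> V \<inter> W)" "openin ?X (U \<inter> (O' \<inter> W))"
      using trc(1) O'(1) trd(1) tre(1) by auto
    have nf': "norm_continuous ?X (U \<inter> O' \<inter> V \<inter> W) M K (\<lambda>x. \<eta> x \<circ> f x \<circ> inv_into (hcar (G x)) (\<phi> x))"
      by (rule norm_continuous_subset[OF op'(2,1) _ trc(2) tre(2) nf]) auto
    have "norm_continuous ?X (U \<inter> O' \<inter> V \<inter> W) M N (\<lambda>x. \<psi> x \<circ> f x \<circ> inv_into (hcar (G x)) (\<phi> x))"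
    proof (rule continuous_rep_division[OF tc' d'(1) F'(3)[OF e] G _ F'(1) nf' d'(2)[OF e] f])
      fix x assume x: "x \<in> topspace ?X"
      show "hilbert_space (range_fibre F q x)"
        by (rule hilbert_range_fibre[OF F q x])
      show "\<exists>c>0. \<forall>v\<in>hcar (range_fibre F q x). hnorm (range_fibre F q x) v \<le> c * hnorm (fibre F x) (id v)"
        by (intro exI[of _ 1]) (simp add: hnorm_range_fibre)
      show "id v \<in> hcar (fibre F x)" if "v \<in> hcar (range_fibre F q x)" for v
        using that by (simp add: in_range_fibre[OF F q x])
    qed simp_all
    then show "\<exists>S. openin ?X S \<and> x\<^sub>0 \<in> S \<and>
        norm_continuous ?X S M N (\<lambda>x. \<psi> x \<circ> f x \<circ> inv_into (hcar (G x)) (\<phi> x))"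
      using op'(1) x0 O' by (intro exI[of _ "U \<inter> O' \<inter> V \<inter> W"]) auto
  qed
  then show ?thesis
    by (simp add: cd continuous_rep_def)
qed

text \<open>Charts of the range are by definition compatible with the charts of \<open>E\<close>,
  but not explicitly with each other. Their transition maps are representatives of the identity,
  which is continuous into \<open>E\<close>; dividing by the inclusion settles the rest.\<close>

lemma hilbert_bundle_range_bundle:
  assumes E: "hilbert_bundle E" and p: "bundle_morphism E E p" and pp: "p \<odot> p = p"
  shows "hilbert_bundle (range_bundle E p)"
  unfolding hilbert_bundle_def range_bundle_simps
proof (intro conjI ballI)
  fix x assume x: "x \<in> topspace (base E)"
  then show "hilbert_space (range_fibre E p x)"
    by (rule hilbert_range_fibre[OF E p pp])
  show "\<exists>(U, M, \<phi>)\<in>charts (range_bundle E p). x \<in> U"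
    using range_bundle_chart[OF E p pp x] by fast
next
  fix c assume c: "c \<in> charts (range_bundle E p)"
  note c' = charts_range_bundleD[OF c]
  show "trivialization (base E) (range_fibre E p) c"
    by (rule c'(1))
  show "metric_continuous (base E) (range_fibre E p) c"
    by (rule metric_continuous_range_bundle[OF E p pp c])
  fix d assume d: "d \<in> charts (range_bundle E p)"
  show "continuous_rep (base E) (range_fibre E p) c d (\<lambda>x. id)"
  proof (rule continuous_rep_into_range_bundle[OF E p pp hilbert_range_fibre[OF E p pp] c'(1) d bounded_op_id])
    fix x assume x: "x \<in> topspace (base E)"
    obtain W K \<eta> where e: "(W, K, \<eta>) \<in> charts E" "x \<in> W"
      using hilbert_bundleD(2)[OF E x] by blast
    obtain U M \<phi> where c_eq: "c = (U, M, \<phi>)"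
      by (metis prod_cases3)
    have "norm_continuous (base E) (U \<inter> (W \<inter> W)) M K (\<lambda>x. \<eta> x \<circ> id \<circ> inv_into (hcar (range_fibre E p x)) (\<phi> x))"
      using c'(2)[OF e(1)] by (simp add: c_eq continuous_rep_def)
    then show "\<exists>U M \<phi> V W K \<eta>. c = (U, M, \<phi>) \<and> (W, K, \<eta>) \<in> charts E \<and> openin (base E) V \<and> x \<in> V \<and> x \<in> W \<and>
      norm_continuous (base E) (U \<inter> (V \<inter> W)) M K (\<lambda>x. \<eta> x \<circ> id \<circ> inv_into (hcar (range_fibre E p x)) (\<phi> x))"
      using e trivializationD(1)[OF hilbert_bundleD(3)[OF E e(1)]] c_eq
      by (intro exI[of _ U] exI[of _ M] exI[of _ \<phi>] exI[of _ W] exI[of _ K] exI[of _ \<eta>] conjI)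
  qed
qed

text \<open>The inclusion into \<open>E\<close> followed by \<open>f\<close> is continuous near each
  point through a chart of \<open>E\<close>. As \<open>f\<close> takes values in the range of
  \<open>q\<close>, the inclusion into \<open>F\<close> can be divided off.\<close>

lemma bundle_morphism_restrict:
  fixes E F :: "('x, 'f::complex_vector) hbundle"
  assumes E: "hilbert_bundle E" and p: "bundle_morphism E E p" "p \<odot> p = p"
    and F: "hilbert_bundle F" and q: "bundle_morphism F F q" "q \<odot> q = q"
    and f: "bundle_morphism E F f"
    and qf: "\<And>x v. x \<in> topspace (base E) \<Longrightarrow> v \<in> hcar (range_fibre E p x) \<Longrightarrow> q x (f x v) = f x v"
  shows "bundle_morphism (range_bundle E p) (range_bundle F q) (restrict_morphism (range_bundle E p) f)"
proof -
  let ?f = "restrict_morphism (range_bundle E p) f"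
  note E' = hilbert_bundleD[OF E] and F' = hilbert_bundleD[OF F] and f' = bundle_morphismD[OF f]
  have f_eq: "?f x v = f x v" if "x \<in> topspace (base E)" "v \<in> hcar (range_fibre E p x)" for x v
    using that by (simp add: restrict_morphism_def)
  have f_op: "bounded_op (range_fibre E p x) (range_fibre F q x) (?f x)" if x: "x \<in> topspace (base E)" for x
  proof -
    have xF: "x \<in> topspace (base F)"
      using x f'(1) by simp
    have "bounded_op (range_fibre E p x) (fibre F x) (f x \<circ> id)"
      by (rule bounded_op_comp[OF hilbert_range_fibre[OF E p x] E'(1)[OF x] bounded_op_incl[OF E p x] f'(2)[OF x]])
    then have "bounded_op (range_fibre E p x) (range_fibre F q x) (f x)"
      using qf[OF x] by (simp add: bounded_op_def in_range_fibre[OF F q xF] hnorm_range_fibre)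
    then show ?thesis
      by (rule bounded_op_cong[OF hilbert_range_fibre[OF E p x]]) (simp add: f_eq x)
  qed
  show ?thesis
    unfolding bundle_morphism_def range_bundle_simps
  proof (intro conjI allI ballI impI)
    show "base F = base E"
      by (rule f'(1))
  next
    fix x assume "x \<in> topspace (base E)"
    then show "bounded_op (range_fibre E p x) (range_fibre F q x) (?f x)"
      by (rule f_op)
  next
    fix x v assume "x \<notin> topspace (base E) \<or> v \<notin> hcar (range_fibre E p x)"
    then show "?f x v = 0"
      by (auto simp: restrict_morphism_def)
  next
    fix c d assume c: "c \<in> charts (range_bundle E p)" and d: "d \<in> charts (range_bundle F q)"
    note c' = charts_range_bundleD[OF c]
    show "continuous_rep (base E) (range_fibre E p) c d ?f"
      unfolding f'(1)[symmetric]
    proof (rule continuous_rep_into_range_bundle[OF F q _ _ d]; (unfold f'(1))?)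
      show "trivialization (base E) (range_fibre E p) c"
        by (rule c'(1))
      fix x assume x: "x \<in> topspace (base E)"
      show "hilbert_space (range_fibre E p x)"
        by (rule hilbert_range_fibre[OF E p x])
      show "bounded_op (range_fibre E p x) (range_fibre F q x) (?f x)"
        by (rule f_op[OF x])
      obtain V N \<psi> where e: "(V, N, \<psi>) \<in> charts E" "x \<in> V"
        using E'(2)[OF x] by blast
      obtain W K \<eta> where d: "(W, K, \<eta>) \<in> charts F" "x \<in> W"
        using F'(2) x f'(1) by metis
      obtain U M \<phi> where c_eq: "c = (U, M, \<phi>)"
        by (metis prod_cases3)
      have "norm_continuous (base E) (U \<inter> V \<inter> W) M K (\<lambda>x. \<eta> x \<circ> ?f x \<circ> inv_into (hcar (range_fibre E p x)) (\<phi> x))"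
        by (rule continuous_rep_comp[OF c'(1)[unfolded c_eq] E'(3)[OF e(1)] F'(3)[OF d(1), unfolded f'(1)]
              c'(2)[OF e(1), unfolded c_eq] f'(4)[OF e(1) d(1)]])
          (simp_all add: f_eq in_range_fibre[OF E p])
      then show "\<exists>U M \<phi> V W K \<eta>. c = (U, M, \<phi>) \<and> (W, K, \<eta>) \<in> charts F \<and> openin (base E) V \<and> x \<in> V \<and> x \<in> W \<and>
          norm_continuous (base E) (U \<inter> (V \<inter> W)) M K (\<lambda>x. \<eta> x \<circ> ?f x \<circ> inv_into (hcar (range_fibre E p x)) (\<phi> x))"
        using e d trivializationD(1)[OF E'(3)[OF e(1)]] c_eq unfolding Int_assoc
        by (intro exI[of _ U] exI[of _ M] exI[of _ \<phi>] exI[of _ V] exI[of _ W] exI[of _ K] exI[of _ \<eta>] conjI)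
    qed
  qed
qed

section \<open>The algebra of operator families\<close>

lemma pcomp_apply: "(B \<odot> A) l x = B l (A l x)"
  by (simp add: pcomp_def)

lemma pcomp_assoc: "A \<odot> B \<odot> C = A \<odot> (B \<odot> C)"
  by (simp add: pcomp_def fun_eq_iff)

lemma pcomp_add_left: "(A + B) \<odot> C = A \<odot> C + B \<odot> C"
  by (simp add: pcomp_def fun_eq_iff)

lemma pcomp_diff_left:
  fixes A B :: "'i \<Rightarrow> 'a \<Rightarrow> 'b::ab_group_add"
  shows "(A - B) \<odot> C = A \<odot> C - B \<odot> C"
  by (simp add: pcomp_def fun_eq_iff)

lemma pcomp_zero_left: "(0 :: 'i \<Rightarrow> 'a \<Rightarrow> 'b::zero) \<odot> C = 0"
  by (simp add: pcomp_def fun_eq_iff)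

context operator_algebra
begin

lemma bounded_family:
  "(g\<^sub>0, g\<^sub>1) \<in> adm \<Longrightarrow> A \<in> L 0 (g\<^sub>0, g\<^sub>1) \<Longrightarrow> l \<in> \<Lambda> \<Longrightarrow> bounded_op (H g\<^sub>0 0) (H g\<^sub>1 0) (A l)"
  using continuous[of g\<^sub>0 g\<^sub>1 0 A l 0] by simp

lemma family_outside:
  "(g\<^sub>0, g\<^sub>1) \<in> adm \<Longrightarrow> A \<in> L 0 (g\<^sub>0, g\<^sub>1) \<Longrightarrow> l \<notin> \<Lambda> \<or> x \<notin> hcar (H g\<^sub>0 0) \<Longrightarrow> A l x = 0"
  using extensional[of g\<^sub>0 g\<^sub>1 0 A l x] by simp

lemma family_zero: "(g\<^sub>0, g\<^sub>1) \<in> adm \<Longrightarrow> A \<in> L 0 (g\<^sub>0, g\<^sub>1) \<Longrightarrow> A l 0 = 0"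
  using bounded_op_zero[OF hilbert bounded_family] family_outside by blast

lemma L_add: "(g\<^sub>0, g\<^sub>1) \<in> adm \<Longrightarrow> \<mu> \<le> 0 \<Longrightarrow> A \<in> L \<mu> (g\<^sub>0, g\<^sub>1) \<Longrightarrow> B \<in> L \<mu> (g\<^sub>0, g\<^sub>1) \<Longrightarrow> A + B \<in> L \<mu> (g\<^sub>0, g\<^sub>1)"
  using complex_vector.subspace_add[OF vector_space] by blast

lemma L_diff: "(g\<^sub>0, g\<^sub>1) \<in> adm \<Longrightarrow> \<mu> \<le> 0 \<Longrightarrow> A \<in> L \<mu> (g\<^sub>0, g\<^sub>1) \<Longrightarrow> B \<in> L \<mu> (g\<^sub>0, g\<^sub>1) \<Longrightarrow> A - B \<in> L \<mu> (g\<^sub>0, g\<^sub>1)"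
  using complex_vector.subspace_diff[OF vector_space] by blast

lemma L_zero: "(g\<^sub>0, g\<^sub>1) \<in> adm \<Longrightarrow> \<mu> \<le> 0 \<Longrightarrow> 0 \<in> L \<mu> (g\<^sub>0, g\<^sub>1)"
  using complex_vector.subspace_0[OF vector_space] by blast

lemma L0_comp:
  "(g\<^sub>0, g\<^sub>1) \<in> adm \<Longrightarrow> (g\<^sub>1, g\<^sub>2) \<in> adm \<Longrightarrow> B \<in> L 0 (g\<^sub>1, g\<^sub>2) \<Longrightarrow> A \<in> L 0 (g\<^sub>0, g\<^sub>1) \<Longrightarrow> B \<odot> A \<in> L 0 (g\<^sub>0, g\<^sub>2)"
  using comp[of g\<^sub>0 g\<^sub>1 g\<^sub>2 0 0 B A] by simp

text \<open>Distributivity from the left is pointwise for arbitrary functions; here the linearity of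
  \<open>B\<close> enters. Off the domain both sides reduce to the value of \<open>B\<close> at 0,
  which is 0.\<close>

lemma pcomp_add_right:
  assumes g: "(g\<^sub>0, g\<^sub>1) \<in> adm" "(g\<^sub>1, g\<^sub>2) \<in> adm"
    and A: "A \<in> L 0 (g\<^sub>0, g\<^sub>1)" "A' \<in> L 0 (g\<^sub>0, g\<^sub>1)" and B: "B \<in> L 0 (g\<^sub>1, g\<^sub>2)"
  shows "B \<odot> (A + A') = B \<odot> A + B \<odot> A'"
proof (intro ext)
  fix l x
  show "(B \<odot> (A + A')) l x = (B \<odot> A + B \<odot> A') l x"
  proof (cases "l \<in> \<Lambda> \<and> x \<in> hcar (H g\<^sub>0 0)")
    case True
    then show ?thesis
      using bounded_op_add[OF bounded_family[OF g(2) B]] bounded_op_in[OF bounded_family[OF g(1)]] A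
      by (simp add: pcomp_apply)
  next
    case False
    then show ?thesis
      using family_outside[OF g(1) A(1), of l x] family_outside[OF g(1) A(2), of l x] family_zero[OF g(2) B]
      by (simp add: pcomp_apply)
  qed
qed

lemma pcomp_diff_right:
  assumes g: "(g\<^sub>0, g\<^sub>1) \<in> adm" "(g\<^sub>1, g\<^sub>2) \<in> adm"
    and A: "A \<in> L 0 (g\<^sub>0, g\<^sub>1)" "A' \<in> L 0 (g\<^sub>0, g\<^sub>1)" and B: "B \<in> L 0 (g\<^sub>1, g\<^sub>2)"
  shows "B \<odot> (A - A') = B \<odot> A - B \<odot> A'"
  using pcomp_add_right[OF g L_diff[OF g(1) _ A] A(2) B] by simp

lemma id_pcomp:
  assumes g: "(g\<^sub>0, g\<^sub>1) \<in> adm" and A: "A \<in> L 0 (g\<^sub>0, g\<^sub>1)"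
  shows "id_family \<Lambda> (H g\<^sub>1 0) \<odot> A = A"
proof (intro ext)
  fix l x
  show "(id_family \<Lambda> (H g\<^sub>1 0) \<odot> A) l x = A l x"
    using family_outside[OF g A, of l x] bounded_op_in[OF bounded_family[OF g A], of l x]
    by (auto simp: pcomp_apply id_family_def id_op_def)
qed

lemma pcomp_id:
  assumes g: "(g\<^sub>0, g\<^sub>1) \<in> adm" and A: "A \<in> L 0 (g\<^sub>0, g\<^sub>1)"
  shows "A \<odot> id_family \<Lambda> (H g\<^sub>0 0) = A"
proof (intro ext)
  fix l x
  show "(A \<odot> id_family \<Lambda> (H g\<^sub>0 0)) l x = A l x"
    using family_outside[OF g A, of l x] family_zero[OF g A, of l]
    by (auto simp: pcomp_apply id_family_def id_op_def)
qed

lemma in_smoothing_iff: "R \<in> smoothing L p \<longleftrightarrow> (\<forall>\<mu>\<le>0. R \<in> L \<mu> p)"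
  by (auto simp: smoothing_def)

lemma smoothing_L0: "R \<in> smoothing L p \<Longrightarrow> R \<in> L 0 p"
  by (simp add: in_smoothing_iff)

lemma smoothing_add:
  "(g\<^sub>0, g\<^sub>1) \<in> adm \<Longrightarrow> R \<in> smoothing L (g\<^sub>0, g\<^sub>1) \<Longrightarrow> S \<in> smoothing L (g\<^sub>0, g\<^sub>1) \<Longrightarrow> R + S \<in> smoothing L (g\<^sub>0, g\<^sub>1)"
  by (simp add: in_smoothing_iff L_add)

lemma smoothing_diff:
  "(g\<^sub>0, g\<^sub>1) \<in> adm \<Longrightarrow> R \<in> smoothing L (g\<^sub>0, g\<^sub>1) \<Longrightarrow> S \<in> smoothing L (g\<^sub>0, g\<^sub>1) \<Longrightarrow> R - S \<in> smoothing L (g\<^sub>0, g\<^sub>1)"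
  by (simp add: in_smoothing_iff L_diff)

lemma smoothing_zero: "(g\<^sub>0, g\<^sub>1) \<in> adm \<Longrightarrow> 0 \<in> smoothing L (g\<^sub>0, g\<^sub>1)"
  by (simp add: in_smoothing_iff L_zero)

lemma smoothing_pcomp_right:
  assumes "(g\<^sub>0, g\<^sub>1) \<in> adm" "(g\<^sub>1, g\<^sub>2) \<in> adm" "B \<in> L 0 (g\<^sub>1, g\<^sub>2)" "R \<in> smoothing L (g\<^sub>0, g\<^sub>1)"
  shows "B \<odot> R \<in> smoothing L (g\<^sub>0, g\<^sub>2)"
  unfolding in_smoothing_iff
proof (intro allI impI)
  fix \<mu> :: int assume "\<mu> \<le> 0"
  then show "B \<odot> R \<in> L \<mu> (g\<^sub>0, g\<^sub>2)"
    using comp[OF assms(1,2), of 0 \<mu> B R] assms by (simp add: in_smoothing_iff)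
qed

lemma smoothing_pcomp_left:
  assumes "(g\<^sub>0, g\<^sub>1) \<in> adm" "(g\<^sub>1, g\<^sub>2) \<in> adm" "R \<in> smoothing L (g\<^sub>1, g\<^sub>2)" "B \<in> L 0 (g\<^sub>0, g\<^sub>1)"
  shows "R \<odot> B \<in> smoothing L (g\<^sub>0, g\<^sub>2)"
  unfolding in_smoothing_iff
proof (intro allI impI)
  fix \<mu> :: int assume "\<mu> \<le> 0"
  then show "R \<odot> B \<in> L \<mu> (g\<^sub>0, g\<^sub>2)"
    using comp[OF assms(1,2), of \<mu> 0 R B] assms by (simp add: in_smoothing_iff)
qed

section \<open>Toeplitz classes as corners of the algebra\<close>

lemma in_toeplitz_adm_iff:
  "((g\<^sub>0, P\<^sub>0), (g\<^sub>1, P\<^sub>1)) \<in> toeplitz_adm adm L \<longleftrightarrow>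
    (g\<^sub>0, g\<^sub>1) \<in> adm \<and> projection L g\<^sub>0 P\<^sub>0 \<and> projection L g\<^sub>1 P\<^sub>1"
  by (simp add: toeplitz_adm_def)

lemma projectionD: "projection L g P \<Longrightarrow> P \<in> L 0 (g, g)" "projection L g P \<Longrightarrow> P \<odot> P = P"
  by (simp_all add: projection_def)

text \<open>By idempotence a compressed operator is its own compression, so the existentially
  quantified operator can be taken to be \<open>A\<close> itself.\<close>

lemma in_toeplitz_iff:
  assumes adm: "((g\<^sub>0, P\<^sub>0), (g\<^sub>1, P\<^sub>1)) \<in> toeplitz_adm adm L" and \<mu>: "\<mu> \<le> 0"
  shows "A \<in> toeplitz L \<mu> ((g\<^sub>0, P\<^sub>0), (g\<^sub>1, P\<^sub>1)) \<longleftrightarrow> A \<in> L \<mu> (g\<^sub>0, g\<^sub>1) \<and> P\<^sub>1 \<odot> A = A \<and> A \<odot> P\<^sub>0 = A"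
proof
  have g: "(g\<^sub>0, g\<^sub>1) \<in> adm" and P: "P\<^sub>0 \<in> L 0 (g\<^sub>0, g\<^sub>0)" "P\<^sub>1 \<in> L 0 (g\<^sub>1, g\<^sub>1)" "P\<^sub>0 \<odot> P\<^sub>0 = P\<^sub>0" "P\<^sub>1 \<odot> P\<^sub>1 = P\<^sub>1"
    using adm by (auto simp: in_toeplitz_adm_iff projection_def)
  assume "A \<in> toeplitz L \<mu> ((g\<^sub>0, P\<^sub>0), (g\<^sub>1, P\<^sub>1))"
  then obtain A' where A': "A = P\<^sub>1 \<odot> A' \<odot> P\<^sub>0" "A' \<in> L \<mu> (g\<^sub>0, g\<^sub>1)"
    by (auto simp: toeplitz_def)
  have "P\<^sub>1 \<odot> A' \<odot> P\<^sub>0 \<in> L (0 + \<mu> + 0) (g\<^sub>0, g\<^sub>1)"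
    using g P A' \<mu> by (intro comp[of g\<^sub>0 g\<^sub>0 g\<^sub>1] comp[of g\<^sub>0 g\<^sub>1 g\<^sub>1]) (auto intro: adm_refl)
  then have "A \<in> L \<mu> (g\<^sub>0, g\<^sub>1)"
    using A'(1) by simp
  moreover have "P\<^sub>1 \<odot> A = A"
    unfolding A'(1) using P(4) by (simp flip: pcomp_assoc)
  moreover have "A \<odot> P\<^sub>0 = A"
    unfolding A'(1) using P(3) by (simp add: pcomp_assoc)
  ultimately show "A \<in> L \<mu> (g\<^sub>0, g\<^sub>1) \<and> P\<^sub>1 \<odot> A = A \<and> A \<odot> P\<^sub>0 = A"
    by blast
next
  assume "A \<in> L \<mu> (g\<^sub>0, g\<^sub>1) \<and> P\<^sub>1 \<odot> A = A \<and> A \<odot> P\<^sub>0 = A"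
  then show "A \<in> toeplitz L \<mu> ((g\<^sub>0, P\<^sub>0), (g\<^sub>1, P\<^sub>1))"
    by (auto simp: toeplitz_def intro!: exI[of _ A])
qed

text \<open>By definition the operator being compressed may change with the order. The description
  by fixed points removes this dependence, so the intersection over all orders is the corner of the
  smoothing operators.\<close>

lemma in_smoothing_toeplitz_iff:
  assumes "((g\<^sub>0, P\<^sub>0), (g\<^sub>1, P\<^sub>1)) \<in> toeplitz_adm adm L"
  shows "A \<in> smoothing (toeplitz L) ((g\<^sub>0, P\<^sub>0), (g\<^sub>1, P\<^sub>1)) \<longleftrightarrow>
    A \<in> smoothing L (g\<^sub>0, g\<^sub>1) \<and> P\<^sub>1 \<odot> A = A \<and> A \<odot> P\<^sub>0 = A"
  by (auto simp: smoothing_def in_toeplitz_iff[OF assms])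

lemma toeplitz_adm_refl:
  assumes "((g\<^sub>0, P\<^sub>0), (g\<^sub>1, P\<^sub>1)) \<in> toeplitz_adm adm L"
  shows "((g\<^sub>0, P\<^sub>0), (g\<^sub>0, P\<^sub>0)) \<in> toeplitz_adm adm L" "((g\<^sub>1, P\<^sub>1), (g\<^sub>1, P\<^sub>1)) \<in> toeplitz_adm adm L"
    and "((g\<^sub>1, P\<^sub>1), (g\<^sub>0, P\<^sub>0)) \<in> toeplitz_adm adm L"
  using assms by (auto simp: in_toeplitz_adm_iff intro: adm_refl adm_swap)

text \<open>If \<open>1 + S'\<close> inverts \<open>1 + R\<close>, then \<open>P + P S' P\<close> inverts \<open>P + R\<close>, as \<open>R = P R = R P\<close>.\<close>

lemma toeplitz_inverse_closed:
  assumes inv: "inverse_closed \<Lambda> H adm L"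
  shows "toeplitz_inverse_closed \<Lambda> adm L"
  unfolding toeplitz_inverse_closed_def
proof (intro allI impI ballI)
  fix g P R assume gP: "(g, g) \<in> adm \<and> projection L g P" and R: "R \<in> smoothing (toeplitz L) ((g, P), (g, P))"
  then have g: "(g, g) \<in> adm" and P: "P \<in> L 0 (g, g)" "P \<odot> P = P" and adm: "((g, P), (g, P)) \<in> toeplitz_adm adm L"
    by (auto simp: projection_def in_toeplitz_adm_iff)
  have R': "R \<in> smoothing L (g, g)" "P \<odot> R = R" "R \<odot> P = R"
    using R by (simp_all add: in_smoothing_toeplitz_iff[OF adm])
  obtain S where S: "S \<in> smoothing L (g, g)" and ev: "\<forall>\<^sub>F l in inf at_infinity (principal \<Lambda>).
      (id_op (H g 0) + R l) \<circ> (id_op (H g 0) + S l) = id_op (H g 0) \<and>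
      (id_op (H g 0) + S l) \<circ> (id_op (H g 0) + R l) = id_op (H g 0)"
    using inv g R'(1) unfolding inverse_closed_def by blast
  define Q where "Q = P \<odot> S \<odot> P"
  have "Q \<in> smoothing L (g, g)"
    unfolding Q_def by (intro smoothing_pcomp_left[OF g g] smoothing_pcomp_right[OF g g] P S)
  moreover have "P \<odot> Q = Q"
    unfolding Q_def using P(2) by (simp flip: pcomp_assoc)
  moreover have "Q \<odot> P = Q"
    unfolding Q_def using P(2) by (simp add: pcomp_assoc)
  ultimately have "Q \<in> smoothing (toeplitz L) ((g, P), (g, P))"
    by (simp add: in_smoothing_toeplitz_iff[OF adm])
  moreover have "\<forall>\<^sub>F l in inf at_infinity (principal \<Lambda>). l \<in> \<Lambda>"
    by (simp add: eventually_inf_principal)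
  with ev have "\<forall>\<^sub>F l in inf at_infinity (principal \<Lambda>).
      (P l + R l) \<circ> (P l + Q l) = P l \<and> (P l + Q l) \<circ> (P l + R l) = P l"
  proof eventually_elim
    case (elim l)
    let ?H = "H g 0"
    note bP = bounded_family[OF g P(1) elim(2)] and bR = bounded_family[OF g smoothing_L0[OF R'(1)] elim(2)]
      and bS = bounded_family[OF g smoothing_L0[OF S] elim(2)]
    note [simp] = bounded_op_in[OF bP] bounded_op_in[OF bR] bounded_op_in[OF bS] hs_add[OF hilbert]
    have PP: "P l (P l x) = P l x" and PR: "P l (R l x) = R l x" and RP: "R l (P l x) = R l x" for x
      using P(2) R'(2,3) by (metis pcomp_apply)+
    have *: "(P l + R l) ((P l + Q l) x) = P l x \<and> (P l + Q l) ((P l + R l) x) = P l x" for x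
    proof (cases "x \<in> hcar ?H")
      case True
      \<comment> \<open>Both \<open>P l + R l\<close> and \<open>P l + Q l\<close> see
        \<open>x\<close> only through its component \<open>z\<close> in the range of
        \<open>P l\<close>.\<close>
      define z where "z = P l x"
      have z [simp]: "z \<in> hcar ?H" "P l z = z"
        using True by (simp_all add: z_def PP)
      have Rx: "R l x = R l z"
        by (simp add: z_def RP)
      have "((id_op ?H + R l) \<circ> (id_op ?H + S l)) z = z"
        using elim(1) by (simp add: id_op_def)
      then have 1: "S l z + (R l z + R l (S l z)) = 0"
        by (simp add: id_op_def bounded_op_add[OF bR] algebra_simps)
      have "((id_op ?H + S l) \<circ> (id_op ?H + R l)) z = z"
        using elim(1) by (simp add: id_op_def)
      then have 2: "R l z + (S l z + S l (R l z)) = 0"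
        by (simp add: id_op_def bounded_op_add[OF bS] algebra_simps)
      \<comment> \<open>Compressing the two inverse relations by \<open>P l\<close> turns
        \<open>S\<close> into \<open>Q\<close>. The \<open>R\<close> terms are unchanged since they
        already lie in the range of \<open>P l\<close>.\<close>
      have "P l (S l z + (R l z + R l (S l z))) = 0"
        unfolding 1 by (rule bounded_op_zero[OF hilbert bP])
      then have "P l (S l z) + (R l z + R l (S l z)) = 0"
        by (simp add: bounded_op_add[OF bP] PR)
      moreover have "P l (R l z + (S l z + S l (R l z))) = 0"
        unfolding 2 by (rule bounded_op_zero[OF hilbert bP])
      then have "R l z + (P l (S l z) + P l (S l (R l z))) = 0"
        by (simp add: bounded_op_add[OF bP] PR)
      moreover have "Q l x = P l (S l z)"
        by (simp add: Q_def pcomp_apply z_def)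
      moreover have "Q l (z + R l z) = P l (S l z) + P l (S l (R l z))"
        by (simp add: Q_def pcomp_apply bounded_op_add[OF bP] bounded_op_add[OF bS] PR)
      ultimately show ?thesis
        by (simp add: Rx bounded_op_add[OF bP] bounded_op_add[OF bR] PP PR RP algebra_simps flip: z_def)
    next
      \<comment> \<open>The claimed equalities are between functions on the whole ambient type;
        outside the Hilbert space everything vanishes by the extension by 0.\<close>
      case False
      then have "P l x = 0" "R l x = 0"
        using family_outside[OF g] P(1) smoothing_L0[OF R'(1)] by blast+
      then show ?thesis
        using family_zero[OF g P(1)] family_zero[OF g smoothing_L0[OF R'(1)]] family_zero[OF g smoothing_L0[OF S]]
        by (simp add: Q_def pcomp_apply)
    qed
    show ?case
      using * by (auto simp: fun_eq_iff)
  qed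
  ultimately show "\<exists>Q\<in>smoothing (toeplitz L) ((g, P), (g, P)). \<forall>\<^sub>F l in inf at_infinity (principal \<Lambda>).
      (P l + R l) \<circ> (P l + Q l) = P l \<and> (P l + Q l) \<circ> (P l + R l) = P l"
    by blast
qed

end

section \<open>Ellipticity in the Toeplitz algebra\<close>

text \<open>In \<open>symbol_sigma_algebra\<close> the rule for adjoints is conditional on
  star-closedness. With star-closedness assumed, it becomes the unconditional
  \<open>symbol_adjoint\<close>.\<close>

locale star_sigma_algebra =
  operator_algebra \<Lambda> H adm L + sym: symbol_map adm "L 0" "smoothing L" "elliptic \<Lambda> H L" n E \<sigma>
  for \<Lambda> :: "'l::euclidean_space set"
    and H :: "'g \<Rightarrow> nat \<Rightarrow> 'h::complex_vector hilbert"
    and adm :: "('g \<times> 'g) set"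
    and L :: "int \<Rightarrow> 'g \<times> 'g \<Rightarrow> ('l, 'h) family set"
    and n :: nat
    and E :: "nat \<Rightarrow> 'g \<Rightarrow> ('x, 'f::complex_vector) hbundle"
    and \<sigma> :: "nat \<Rightarrow> 'g \<times> 'g \<Rightarrow> ('l, 'h) family \<Rightarrow> 'x \<Rightarrow> 'f \<Rightarrow> 'f" +
  assumes star: "star_closed \<Lambda> H adm L"
    and symbol_adjoint: "\<lbrakk>(g\<^sub>0, g\<^sub>1) \<in> adm; A \<in> L 0 (g\<^sub>0, g\<^sub>1); A' \<in> L 0 (g\<^sub>1, g\<^sub>0);
      adjoint_family \<Lambda> H (g\<^sub>0, g\<^sub>1) A A'; k \<in> {1..n}; x \<in> topspace (base (E k g\<^sub>0))\<rbrakk>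
      \<Longrightarrow> adjoint_op (fibre (E k g\<^sub>0) x) (fibre (E k g\<^sub>1) x) (\<sigma> k (g\<^sub>0, g\<^sub>1) A x) (\<sigma> k (g\<^sub>1, g\<^sub>0) A' x)"
begin

section \<open>Symbols of identities, and ellipticity of sums of squares\<close>

lemma obtain_adjoint:
  assumes "(g\<^sub>0, g\<^sub>1) \<in> adm" "A \<in> L 0 (g\<^sub>0, g\<^sub>1)"
  obtains A' where "A' \<in> L 0 (g\<^sub>1, g\<^sub>0)" "adjoint_family \<Lambda> H (g\<^sub>0, g\<^sub>1) A A'"
  using star assms unfolding star_closed_def by blast

lemma adjoint_family_sym:
  assumes g: "(g\<^sub>0, g\<^sub>1) \<in> adm" and A: "A \<in> L 0 (g\<^sub>0, g\<^sub>1)" "A' \<in> L 0 (g\<^sub>1, g\<^sub>0)"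
    and adj: "adjoint_family \<Lambda> H (g\<^sub>0, g\<^sub>1) A A'"
  shows "adjoint_family \<Lambda> H (g\<^sub>1, g\<^sub>0) A' A"
  using adj unfolding adjoint_family_def
  by (auto intro!: adjoint_op_sym[OF hilbert hilbert bounded_family[OF g A(1)] bounded_family[OF adm_swap[OF g] A(2)]])

text \<open>The zero operator belongs to every class, and its symbol is a bundle morphism, which
  requires equal bases.\<close>

lemma base_eq: "k \<in> {1..n} \<Longrightarrow> (g\<^sub>0, g\<^sub>1) \<in> adm \<Longrightarrow> base (E k g\<^sub>1) = base (E k g\<^sub>0)"
  using bundle_morphismD(1)[OF sym.morphism[OF _ _ L_zero]] by simp

lemma symbol_diff:
  assumes "k \<in> {1..n}" "(g\<^sub>0, g\<^sub>1) \<in> adm" "A \<in> L 0 (g\<^sub>0, g\<^sub>1)" "B \<in> L 0 (g\<^sub>0, g\<^sub>1)"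
  shows "\<sigma> k (g\<^sub>0, g\<^sub>1) (A - B) = \<sigma> k (g\<^sub>0, g\<^sub>1) A - \<sigma> k (g\<^sub>0, g\<^sub>1) B"
  using sym.add[OF assms(1,2) L_diff[OF assms(2) _ assms(3,4)] assms(4)] by (simp add: algebra_simps)

text \<open>Unitality is not among the axioms. The identity is elliptic, so its symbol is
  invertible; it is also idempotent by multiplicativity, and an invertible idempotent is the
  identity.\<close>

lemma symbol_id:
  assumes k: "k \<in> {1..n}" and g: "(g, g) \<in> adm"
  shows "\<sigma> k (g, g) (id_family \<Lambda> (H g 0)) = bundle_id (E k g)"
proof -
  let ?I = "id_family \<Lambda> (H g 0)"
  let ?s = "\<sigma> k (g, g) ?I"
  have I: "?I \<in> L 0 (g, g)" and II: "?I \<odot> ?I = ?I"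
    using identity[OF g] id_pcomp[OF g identity[OF g]] by auto
  have "elliptic \<Lambda> H L (g, g) ?I"
    using I II smoothing_zero[OF g] by (auto simp: elliptic_def intro!: bexI[of _ ?I])
  then have iso: "bundle_iso (E k g) (E k g) ?s"
    using sym.elliptic_iff[OF g I] k by blast
  then obtain h where hs: "h \<odot> ?s = bundle_id (E k g)"
    by (auto simp: bundle_iso_def)
  note s = bundle_morphismD[OF sym.morphism[OF k g I]]
  have "?s \<odot> ?s = ?s"
    using sym.multiplicative[OF k g g I I] II by simp
  then have "bundle_id (E k g) \<odot> ?s = bundle_id (E k g)"
    by (metis hs pcomp_assoc)
  moreover have "bundle_id (E k g) \<odot> ?s = ?s"
  proof (intro ext)
    fix x v
    show "(bundle_id (E k g) \<odot> ?s) x v = ?s x v"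
      using bounded_op_in[OF s(2)] s(3)[of x v] by (auto simp: pcomp_apply bundle_id_def id_op_def)
  qed
  ultimately show ?thesis
    by simp
qed

text \<open>Multiplicativity and the rule for adjoints make the symbol a fibrewise sum of squares.
  The constant in \<open>below\<close> may depend on the point, because fibrewise invertibility of a
  morphism already gives a bundle isomorphism. The left parametrix uses it for \<open>A\<close> and
  the complement of \<open>P\<^sub>0\<close>, the right one for the adjoints of \<open>A\<close> and
  of the complement of \<open>P\<^sub>1\<close>.\<close>

lemma elliptic_sum_of_squares:
  assumes g: "(g\<^sub>0, g\<^sub>1) \<in> adm" "(g\<^sub>0, g\<^sub>2) \<in> adm"
    and A: "A \<in> L 0 (g\<^sub>0, g\<^sub>1)" "A' \<in> L 0 (g\<^sub>1, g\<^sub>0)" "adjoint_family \<Lambda> H (g\<^sub>0, g\<^sub>1) A A'"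
    and Q: "Q \<in> L 0 (g\<^sub>0, g\<^sub>2)" "Q' \<in> L 0 (g\<^sub>2, g\<^sub>0)" "adjoint_family \<Lambda> H (g\<^sub>0, g\<^sub>2) Q Q'"
    and below: "\<And>k x. k \<in> {1..n} \<Longrightarrow> x \<in> topspace (base (E k g\<^sub>0)) \<Longrightarrow> \<exists>c. \<forall>v\<in>hcar (fibre (E k g\<^sub>0) x).
      hnorm (fibre (E k g\<^sub>0) x) v \<le> c * (hnorm (fibre (E k g\<^sub>1) x) (\<sigma> k (g\<^sub>0, g\<^sub>1) A x v)
        + hnorm (fibre (E k g\<^sub>2) x) (\<sigma> k (g\<^sub>0, g\<^sub>2) Q x v))"
  shows "elliptic \<Lambda> H L (g\<^sub>0, g\<^sub>0) (A' \<odot> A + Q' \<odot> Q)"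
proof -
  note g' = adm_swap[OF g(1)] adm_swap[OF g(2)] and g00 = adm_refl(1)[OF g(1)]
    and g11 = adm_refl(2)[OF g(1)] and g22 = adm_refl(2)[OF g(2)]
  have AA: "A' \<odot> A \<in> L 0 (g\<^sub>0, g\<^sub>0)" and QQ: "Q' \<odot> Q \<in> L 0 (g\<^sub>0, g\<^sub>0)"
    using L0_comp[OF g(1) g'(1) A(2,1)] L0_comp[OF g(2) g'(2) Q(2,1)] by auto
  then have N: "A' \<odot> A + Q' \<odot> Q \<in> L 0 (g\<^sub>0, g\<^sub>0)"
    by (rule L_add[OF g00 order_refl])
  show ?thesis
    unfolding sym.elliptic_iff[OF g00 N]
  proof
    fix k assume k: "k \<in> {1..n}"
    note E0 = sym.bundles[OF k g00] and E1 = sym.bundles[OF k g11] and E2 = sym.bundles[OF k g22]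
    have eq: "\<sigma> k (g\<^sub>0, g\<^sub>0) (A' \<odot> A + Q' \<odot> Q)
        = \<sigma> k (g\<^sub>1, g\<^sub>0) A' \<odot> \<sigma> k (g\<^sub>0, g\<^sub>1) A + \<sigma> k (g\<^sub>2, g\<^sub>0) Q' \<odot> \<sigma> k (g\<^sub>0, g\<^sub>2) Q"
      by (simp add: sym.add[OF k g00 AA QQ] sym.multiplicative[OF k g(1) g'(1) A(1,2)]
          sym.multiplicative[OF k g(2) g'(2) Q(1,2)])
    show "bundle_iso (E k g\<^sub>0) (E k g\<^sub>0) (\<sigma> k (g\<^sub>0, g\<^sub>0) (A' \<odot> A + Q' \<odot> Q))"
    proof (rule bundle_isoI[OF E0 E0 sym.morphism[OF k g00 N]])
      fix x assume x: "x \<in> topspace (base (E k g\<^sub>0))"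
      then have x12: "x \<in> topspace (base (E k g\<^sub>1))" "x \<in> topspace (base (E k g\<^sub>2))"
        using base_eq[OF k g(1)] base_eq[OF k g(2)] by auto
      obtain c where c: "\<And>v. v \<in> hcar (fibre (E k g\<^sub>0) x) \<Longrightarrow>
        hnorm (fibre (E k g\<^sub>0) x) v \<le> c * (hnorm (fibre (E k g\<^sub>1) x) (\<sigma> k (g\<^sub>0, g\<^sub>1) A x v)
          + hnorm (fibre (E k g\<^sub>2) x) (\<sigma> k (g\<^sub>0, g\<^sub>2) Q x v))"
        using below[OF k x] by blast
      show "toplinear_iso (fibre (E k g\<^sub>0) x) (fibre (E k g\<^sub>0) x) (\<sigma> k (g\<^sub>0, g\<^sub>0) (A' \<odot> A + Q' \<odot> Q) x)"
        using sum_of_squares_toplinear_iso[OF hilbert_bundleD(1)[OF E0 x] hilbert_bundleD(1)[OF E1 x12(1)]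
            hilbert_bundleD(1)[OF E2 x12(2)]
            bundle_morphismD(2)[OF sym.morphism[OF k g(1) A(1)] x]
            bundle_morphismD(2)[OF sym.morphism[OF k g'(1) A(2)] x12(1)]
            symbol_adjoint[OF g(1) A k x]
            bundle_morphismD(2)[OF sym.morphism[OF k g(2) Q(1)] x]
            bundle_morphismD(2)[OF sym.morphism[OF k g'(2) Q(2)] x12(2)]
            symbol_adjoint[OF g(2) Q k x] c]
        unfolding eq by (simp add: plus_fun_def pcomp_def)
    qed
  qed
qed

lemma symbol_projection:
  assumes k: "k \<in> {1..n}" and g: "(g, g) \<in> adm" and P: "projection L g P"
  shows "bundle_morphism (E k g) (E k g) (\<sigma> k (g, g) P)" "\<sigma> k (g, g) P \<odot> \<sigma> k (g, g) P = \<sigma> k (g, g) P"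
  using sym.morphism[OF k g projectionD(1)[OF P]]
    sym.multiplicative[OF k g g projectionD(1)[OF P] projectionD(1)[OF P]] projectionD(2)[OF P] by auto

section \<open>Symbols and parametrices of a single Toeplitz operator\<close>

context
  fixes g\<^sub>0 g\<^sub>1 P\<^sub>0 P\<^sub>1 A
  assumes tadm: "((g\<^sub>0, P\<^sub>0), (g\<^sub>1, P\<^sub>1)) \<in> toeplitz_adm adm L"
    and A: "A \<in> toeplitz L 0 ((g\<^sub>0, P\<^sub>0), (g\<^sub>1, P\<^sub>1))"
begin

lemma toeplitz_facts:
  shows "(g\<^sub>0, g\<^sub>1) \<in> adm" "(g\<^sub>1, g\<^sub>0) \<in> adm" "(g\<^sub>0, g\<^sub>0) \<in> adm" "(g\<^sub>1, g\<^sub>1) \<in> adm"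
    and "projection L g\<^sub>0 P\<^sub>0" "projection L g\<^sub>1 P\<^sub>1"
    and "A \<in> L 0 (g\<^sub>0, g\<^sub>1)" "P\<^sub>1 \<odot> A = A" "A \<odot> P\<^sub>0 = A"
  using tadm A by (auto simp: in_toeplitz_adm_iff in_toeplitz_iff[OF tadm] intro: adm_refl adm_swap)

lemma toeplitz_symbol_left:
  assumes "k \<in> {1..n}"
  shows "\<sigma> k (g\<^sub>1, g\<^sub>1) P\<^sub>1 x (\<sigma> k (g\<^sub>0, g\<^sub>1) A x v) = \<sigma> k (g\<^sub>0, g\<^sub>1) A x v"
  using sym.multiplicative[OF assms toeplitz_facts(1,4,7) projectionD(1)[OF toeplitz_facts(6)]] toeplitz_facts(8)
  by (metis pcomp_apply)

lemma toeplitz_symbol_right: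
  assumes "k \<in> {1..n}"
  shows "\<sigma> k (g\<^sub>0, g\<^sub>1) A x (\<sigma> k (g\<^sub>0, g\<^sub>0) P\<^sub>0 x v) = \<sigma> k (g\<^sub>0, g\<^sub>1) A x v"
  using sym.multiplicative[OF assms toeplitz_facts(3,1) projectionD(1)[OF toeplitz_facts(5)] toeplitz_facts(7)]
    toeplitz_facts(9)
  by (metis pcomp_apply)

lemma toeplitz_symbol_morphism:
  assumes k: "k \<in> {1..n}"
  shows "bundle_morphism (toeplitz_bundle E \<sigma> k (g\<^sub>0, P\<^sub>0)) (toeplitz_bundle E \<sigma> k (g\<^sub>1, P\<^sub>1))
    (toeplitz_symbol E \<sigma> k ((g\<^sub>0, P\<^sub>0), (g\<^sub>1, P\<^sub>1)) A)"
  unfolding toeplitz_bundle_def toeplitz_symbol_def prod.case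
  by (rule bundle_morphism_restrict[OF sym.bundles[OF k toeplitz_facts(3)]
        symbol_projection[OF k toeplitz_facts(3,5)] sym.bundles[OF k toeplitz_facts(4)]
        symbol_projection[OF k toeplitz_facts(4,6)] sym.morphism[OF k toeplitz_facts(1,7)]
        toeplitz_symbol_left[OF k]])

text \<open>The inverse bundle morphism is unpacked at one point in terms of the full fibres, with
  ranges expressed by fixed points. As the symbol of \<open>A\<close> does not change under
  composition with that of \<open>P\<^sub>0\<close> on the right, the left-inverse property extends
  to all \<open>v\<close>, with the projection of \<open>v\<close> as the result.\<close>

lemma toeplitz_iso_fibre:
  assumes k: "k \<in> {1..n}" and x: "x \<in> topspace (base (E k g\<^sub>0))"
    and iso: "bundle_iso (toeplitz_bundle E \<sigma> k (g\<^sub>0, P\<^sub>0)) (toeplitz_bundle E \<sigma> k (g\<^sub>1, P\<^sub>1))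
      (toeplitz_symbol E \<sigma> k ((g\<^sub>0, P\<^sub>0), (g\<^sub>1, P\<^sub>1)) A)"
  obtains h C where "C > 0"
    "\<And>w. w \<in> hcar (fibre (E k g\<^sub>1) x) \<Longrightarrow> \<sigma> k (g\<^sub>1, g\<^sub>1) P\<^sub>1 x w = w \<Longrightarrow> h w \<in> hcar (fibre (E k g\<^sub>0) x)"
    "\<And>w. w \<in> hcar (fibre (E k g\<^sub>1) x) \<Longrightarrow> \<sigma> k (g\<^sub>1, g\<^sub>1) P\<^sub>1 x w = w \<Longrightarrow>
      hnorm (fibre (E k g\<^sub>0) x) (h w) \<le> C * hnorm (fibre (E k g\<^sub>1) x) w"
    "\<And>v. v \<in> hcar (fibre (E k g\<^sub>0) x) \<Longrightarrow> h (\<sigma> k (g\<^sub>0, g\<^sub>1) A x v) = \<sigma> k (g\<^sub>0, g\<^sub>0) P\<^sub>0 x v"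
    "\<And>w. w \<in> hcar (fibre (E k g\<^sub>1) x) \<Longrightarrow> \<sigma> k (g\<^sub>1, g\<^sub>1) P\<^sub>1 x w = w \<Longrightarrow> \<sigma> k (g\<^sub>0, g\<^sub>1) A x (h w) = w"
proof -
  let ?p0 = "\<sigma> k (g\<^sub>0, g\<^sub>0) P\<^sub>0" and ?p1 = "\<sigma> k (g\<^sub>1, g\<^sub>1) P\<^sub>1" and ?a = "\<sigma> k (g\<^sub>0, g\<^sub>1) A"
  let ?E0 = "E k g\<^sub>0" and ?E1 = "E k g\<^sub>1"
  note p0 = sym.bundles[OF k toeplitz_facts(3)] symbol_projection[OF k toeplitz_facts(3,5)]
  note p1 = sym.bundles[OF k toeplitz_facts(4)] symbol_projection[OF k toeplitz_facts(4,6)]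
  have x1: "x \<in> topspace (base ?E1)"
    using base_eq[OF k toeplitz_facts(1)] x by simp
  note R0 = in_range_fibre[OF p0 x] and R1 = in_range_fibre[OF p1 x1]
  obtain h where h: "bundle_morphism (range_bundle ?E1 ?p1) (range_bundle ?E0 ?p0) h"
    and ha: "h \<odot> restrict_morphism (range_bundle ?E0 ?p0) ?a = bundle_id (range_bundle ?E0 ?p0)"
    and ah: "restrict_morphism (range_bundle ?E0 ?p0) ?a \<odot> h = bundle_id (range_bundle ?E1 ?p1)"
    using iso by (auto simp: bundle_iso_def toeplitz_bundle_def toeplitz_symbol_def)
  have bh: "bounded_op (range_fibre ?E1 ?p1 x) (range_fibre ?E0 ?p0 x) (h x)"
    using bundle_morphismD(2)[OF h] x1 by simp
  obtain C where C: "C > 0" "\<And>w. w \<in> hcar (range_fibre ?E1 ?p1 x) \<Longrightarrow>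
      hnorm (range_fibre ?E0 ?p0 x) (h x w) \<le> C * hnorm (range_fibre ?E1 ?p1 x) w"
    using bounded_op_bound[OF hilbert_range_fibre[OF p1 x1] bh] by blast
  show thesis
  proof (rule that[OF C(1), of "h x"])
    fix w assume "w \<in> hcar (fibre ?E1 x)" "?p1 x w = w"
    then have w: "w \<in> hcar (range_fibre ?E1 ?p1 x)"
      by (simp add: R1)
    have hw: "h x w \<in> hcar (range_fibre ?E0 ?p0 x)"
      by (rule bounded_op_in[OF bh w])
    then show "h x w \<in> hcar (fibre ?E0 x)"
      by (simp add: R0)
    show "hnorm (fibre ?E0 x) (h x w) \<le> C * hnorm (fibre ?E1 x) w"
      using C(2)[OF w] by (simp add: hnorm_range_fibre)
    show "?a x (h x w) = w"
      using fun_cong[OF fun_cong[OF ah, of x], of w] hw w x x1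
      by (simp add: pcomp_apply restrict_morphism_def bundle_id_def id_op_def)
  next
    fix v assume v: "v \<in> hcar (fibre ?E0 x)"
    have "?p0 x v \<in> hcar (range_fibre ?E0 ?p0 x)"
      using bounded_op_in[OF bundle_morphismD(2)[OF p0(2) x] v] by (simp add: R0 projection_fibre[OF p0])
    then show "h x (?a x v) = ?p0 x v"
      using fun_cong[OF fun_cong[OF ha, of x], of "?p0 x v"] x
      by (simp add: pcomp_apply restrict_morphism_def bundle_id_def id_op_def toeplitz_symbol_right[OF k])
  qed
qed

text \<open>The symbol of \<open>A\<^sup>* A + (1 - P\<^sub>0)\<^sup>* (1 - P\<^sub>0)\<close> is invertible, and a parametrix of this
  operator yields a left parametrix \<open>P\<^sub>0 D A\<^sup>* P\<^sub>1\<close> of \<open>A\<close>.\<close>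

lemma toeplitz_left_parametrix:
  assumes iso: "\<And>k. k \<in> {1..n} \<Longrightarrow> bundle_iso (toeplitz_bundle E \<sigma> k (g\<^sub>0, P\<^sub>0)) (toeplitz_bundle E \<sigma> k (g\<^sub>1, P\<^sub>1))
      (toeplitz_symbol E \<sigma> k ((g\<^sub>0, P\<^sub>0), (g\<^sub>1, P\<^sub>1)) A)"
  obtains B where "B \<in> toeplitz L 0 ((g\<^sub>1, P\<^sub>1), (g\<^sub>0, P\<^sub>0))" "B \<odot> A - P\<^sub>0 \<in> smoothing L (g\<^sub>0, g\<^sub>0)"
proof -
  note f = toeplitz_facts
  note P0 = projectionD[OF f(5)] and P1 = projectionD[OF f(6)]
  let ?I = "id_family \<Lambda> (H g\<^sub>0 0)"
  have I: "?I \<in> L 0 (g\<^sub>0, g\<^sub>0)"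
    by (rule identity[OF f(3)])
  define Q where "Q = ?I - P\<^sub>0"
  have Q: "Q \<in> L 0 (g\<^sub>0, g\<^sub>0)"
    unfolding Q_def by (rule L_diff[OF f(3) order_refl I P0(1)])
  have QP: "Q \<odot> P\<^sub>0 = 0"
    by (simp add: Q_def pcomp_diff_left id_pcomp[OF f(3) P0(1)] P0(2))
  obtain A' where A': "A' \<in> L 0 (g\<^sub>1, g\<^sub>0)" "adjoint_family \<Lambda> H (g\<^sub>0, g\<^sub>1) A A'"
    by (rule obtain_adjoint[OF f(1,7)])
  obtain Q' where Q': "Q' \<in> L 0 (g\<^sub>0, g\<^sub>0)" "adjoint_family \<Lambda> H (g\<^sub>0, g\<^sub>0) Q Q'"
    by (rule obtain_adjoint[OF f(3) Q])
  have "elliptic \<Lambda> H L (g\<^sub>0, g\<^sub>0) (A' \<odot> A + Q' \<odot> Q)"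
  proof (rule elliptic_sum_of_squares[OF f(1,3,7) A' Q Q'])
    fix k x assume k: "k \<in> {1..n}" and x: "x \<in> topspace (base (E k g\<^sub>0))"
    let ?E0 = "fibre (E k g\<^sub>0) x" and ?E1 = "fibre (E k g\<^sub>1) x"
    let ?a = "\<sigma> k (g\<^sub>0, g\<^sub>1) A x" and ?p0 = "\<sigma> k (g\<^sub>0, g\<^sub>0) P\<^sub>0 x" and ?q = "\<sigma> k (g\<^sub>0, g\<^sub>0) Q x"
    have x1: "x \<in> topspace (base (E k g\<^sub>1))"
      using base_eq[OF k f(1)] x by simp
    note E0 = hilbert_bundleD(1)[OF sym.bundles[OF k f(3)] x] and E1 = hilbert_bundleD(1)[OF sym.bundles[OF k f(4)] x1]
    note a_in = bounded_op_in[OF bundle_morphismD(2)[OF sym.morphism[OF k f(1,7)] x]]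
      and p0_in = bounded_op_in[OF bundle_morphismD(2)[OF sym.morphism[OF k f(3) P0(1)] x]]
    have q: "?q v = v - ?p0 v" if "v \<in> hcar ?E0" for v
      using that x by (simp add: Q_def symbol_diff[OF k f(3) I P0(1)] symbol_id[OF k f(3)] bundle_id_def id_op_def)
    obtain h C where C: "C > 0"
      and hC: "\<And>w. w \<in> hcar ?E1 \<Longrightarrow> \<sigma> k (g\<^sub>1, g\<^sub>1) P\<^sub>1 x w = w \<Longrightarrow> hnorm ?E0 (h w) \<le> C * hnorm ?E1 w"
      and ha: "\<And>v. v \<in> hcar ?E0 \<Longrightarrow> h (?a v) = ?p0 v"
      using toeplitz_iso_fibre[OF k x iso[OF k]] by metis
    \<comment> \<open>Split v into its projection, recovered as \<open>h\<close> of the symbol of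
      \<open>A\<close> at v, and the complement, which is the symbol of \<open>Q\<close> at
      v.\<close>
    have "hnorm ?E0 v \<le> (C + 1) * (hnorm ?E1 (?a v) + hnorm ?E0 (?q v))" if v: "v \<in> hcar ?E0" for v
    proof -
      have i: "v - ?p0 v \<in> hcar ?E0"
        by (intro hs_diff[OF E0] v p0_in)
      have "hnorm ?E0 v \<le> hnorm ?E0 (?p0 v) + hnorm ?E0 (v - ?p0 v)"
        by (rule hnorm_triangle_ineq2[OF E0 v p0_in[OF v]])
      also have "\<dots> \<le> C * hnorm ?E1 (?a v) + hnorm ?E0 (?q v)"
        using hC[OF a_in[OF v] toeplitz_symbol_left[OF k]] by (simp add: ha[OF v] q[OF v])
      also have "\<dots> \<le> (C + 1) * (hnorm ?E1 (?a v) + hnorm ?E0 (?q v))"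
        using C hnorm_ge_0[OF E1 a_in[OF v]] hnorm_ge_0[OF E0 i] by (simp add: q[OF v] algebra_simps)
      finally show ?thesis .
    qed
    then show "\<exists>c. \<forall>v\<in>hcar ?E0. hnorm ?E0 v \<le> c * (hnorm ?E1 (?a v) + hnorm ?E0 (?q v))"
      by blast
  qed
  then obtain D where D: "D \<in> L 0 (g\<^sub>0, g\<^sub>0)" and R: "D \<odot> (A' \<odot> A + Q' \<odot> Q) - ?I \<in> smoothing L (g\<^sub>0, g\<^sub>0)"
    by (auto simp: elliptic_def)
  define R where "R = D \<odot> (A' \<odot> A + Q' \<odot> Q) - ?I"
  define B where "B = P\<^sub>0 \<odot> (D \<odot> (A' \<odot> P\<^sub>1))"
  have B: "B \<in> L 0 (g\<^sub>1, g\<^sub>0)"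
    unfolding B_def
    by (rule L0_comp[OF f(2,3) P0(1) L0_comp[OF f(2,3) D L0_comp[OF f(4,2) A'(1) P1(1)]]])
  have BT: "B \<in> toeplitz L 0 ((g\<^sub>1, P\<^sub>1), (g\<^sub>0, P\<^sub>0))"
    using B P0(2) P1(2) unfolding in_toeplitz_iff[OF toeplitz_adm_refl(3)[OF tadm] order_refl]
    by (simp add: B_def pcomp_assoc) (simp flip: pcomp_assoc)
  have Rs: "R \<in> smoothing L (g\<^sub>0, g\<^sub>0)"
    using R by (simp add: R_def)
  \<comment> \<open>Composition with \<open>P\<^sub>0\<close> on the right removes the auxiliary
    square, because \<open>Q\<close> annihilates \<open>P\<^sub>0\<close>. So D A' A is, up to a
    smoothing term, \<open>P\<^sub>0\<close>.\<close>
  have N: "(A' \<odot> A + Q' \<odot> Q) \<odot> P\<^sub>0 = A' \<odot> A"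
  proof -
    have "Q' \<odot> (0 :: 'l \<Rightarrow> 'h \<Rightarrow> 'h) = 0"
      using family_zero[OF f(3) Q'(1)] by (simp add: fun_eq_iff pcomp_apply)
    then show ?thesis
      by (simp add: pcomp_add_left pcomp_assoc QP f(9))
  qed
  have "B \<odot> A = P\<^sub>0 \<odot> (D \<odot> (A' \<odot> A))"
    by (simp add: B_def pcomp_assoc f(8))
  also have "\<dots> = P\<^sub>0 \<odot> ((R + ?I) \<odot> P\<^sub>0)"
    by (simp add: R_def pcomp_assoc N)
  also have "\<dots> = P\<^sub>0 \<odot> (R \<odot> P\<^sub>0) + P\<^sub>0"
    by (simp add: pcomp_add_left id_pcomp[OF f(3) P0(1)] P0(2)
        pcomp_add_right[OF f(3,3) L0_comp[OF f(3,3) smoothing_L0[OF Rs] P0(1)] P0(1) P0(1)])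
  finally have "B \<odot> A - P\<^sub>0 = P\<^sub>0 \<odot> (R \<odot> P\<^sub>0)"
    by simp
  then have "B \<odot> A - P\<^sub>0 \<in> smoothing L (g\<^sub>0, g\<^sub>0)"
    by (simp add: smoothing_pcomp_right[OF f(3,3) P0(1) smoothing_pcomp_left[OF f(3,3) Rs P0(1)]])
  with BT show thesis
    by (rule that)
qed

text \<open>Likewise \<open>P\<^sub>0 A\<^sup>* D P\<^sub>1\<close> is a right parametrix, \<open>D\<close> being a parametrix of
  \<open>A A\<^sup>* + (1 - P\<^sub>1) (1 - P\<^sub>1)\<^sup>*\<close>.\<close>

lemma toeplitz_right_parametrix:
  assumes iso: "\<And>k. k \<in> {1..n} \<Longrightarrow> bundle_iso (toeplitz_bundle E \<sigma> k (g\<^sub>0, P\<^sub>0)) (toeplitz_bundle E \<sigma> k (g\<^sub>1, P\<^sub>1))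
      (toeplitz_symbol E \<sigma> k ((g\<^sub>0, P\<^sub>0), (g\<^sub>1, P\<^sub>1)) A)"
  obtains B where "B \<in> toeplitz L 0 ((g\<^sub>1, P\<^sub>1), (g\<^sub>0, P\<^sub>0))" "A \<odot> B - P\<^sub>1 \<in> smoothing L (g\<^sub>1, g\<^sub>1)"
proof -
  note f = toeplitz_facts
  note P0 = projectionD[OF f(5)] and P1 = projectionD[OF f(6)]
  let ?I = "id_family \<Lambda> (H g\<^sub>1 0)"
  have I: "?I \<in> L 0 (g\<^sub>1, g\<^sub>1)"
    by (rule identity[OF f(4)])
  define Q where "Q = ?I - P\<^sub>1"
  have Q: "Q \<in> L 0 (g\<^sub>1, g\<^sub>1)"
    unfolding Q_def by (rule L_diff[OF f(4) order_refl I P1(1)])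
  have PQ: "P\<^sub>1 \<odot> Q = 0"
    by (simp add: Q_def pcomp_diff_right[OF f(4,4) I P1(1) P1(1)] pcomp_id[OF f(4) P1(1)] P1(2))
  obtain A' where A': "A' \<in> L 0 (g\<^sub>1, g\<^sub>0)" "adjoint_family \<Lambda> H (g\<^sub>0, g\<^sub>1) A A'"
    by (rule obtain_adjoint[OF f(1,7)])
  obtain Q' where Q': "Q' \<in> L 0 (g\<^sub>1, g\<^sub>1)" "adjoint_family \<Lambda> H (g\<^sub>1, g\<^sub>1) Q Q'"
    by (rule obtain_adjoint[OF f(4) Q])
  have "elliptic \<Lambda> H L (g\<^sub>1, g\<^sub>1) (A \<odot> A' + Q \<odot> Q')"
  \<comment> \<open>The roles are exchanged: the operators being squared are \<open>A'\<close> and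
    \<open>Q'\<close>, with \<open>A\<close> and \<open>Q\<close> as their adjoints.\<close>
  proof (rule elliptic_sum_of_squares[OF f(2,4) A'(1) f(7) adjoint_family_sym[OF f(1,7) A'] Q'(1) Q adjoint_family_sym[OF f(4) Q Q']])
    fix k x assume k: "k \<in> {1..n}" and x1: "x \<in> topspace (base (E k g\<^sub>1))"
    let ?E0 = "fibre (E k g\<^sub>0) x" and ?E1 = "fibre (E k g\<^sub>1) x"
    let ?a = "\<sigma> k (g\<^sub>0, g\<^sub>1) A x" and ?a' = "\<sigma> k (g\<^sub>1, g\<^sub>0) A' x"
    let ?p1 = "\<sigma> k (g\<^sub>1, g\<^sub>1) P\<^sub>1 x" and ?q = "\<sigma> k (g\<^sub>1, g\<^sub>1) Q x" and ?q' = "\<sigma> k (g\<^sub>1, g\<^sub>1) Q' x"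
    have x: "x \<in> topspace (base (E k g\<^sub>0))"
      using base_eq[OF k f(1)] x1 by simp
    note E0 = hilbert_bundleD(1)[OF sym.bundles[OF k f(3)] x] and E1 = hilbert_bundleD(1)[OF sym.bundles[OF k f(4)] x1]
    note b_in = bounded_op_in[OF bundle_morphismD(2)[OF sym.morphism[OF k f(1,7)] x]]
      bounded_op_in[OF bundle_morphismD(2)[OF sym.morphism[OF k f(2) A'(1)] x1]]
      bounded_op_in[OF bundle_morphismD(2)[OF sym.morphism[OF k f(4) Q] x1]]
      bounded_op_in[OF bundle_morphismD(2)[OF sym.morphism[OF k f(4) Q'(1)] x1]]
    note bp1 = bundle_morphismD(2)[OF sym.morphism[OF k f(4) P1(1)] x1]
    have q: "?q w = w - ?p1 w" if "w \<in> hcar ?E1" for w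
      using that x1 by (simp add: Q_def symbol_diff[OF k f(4) I P1(1)] symbol_id[OF k f(4)] bundle_id_def id_op_def)
    have adj: "hip ?E1 (?a v) w = hip ?E0 v (?a' w)" if "v \<in> hcar ?E0" "w \<in> hcar ?E1" for v w
      using symbol_adjoint[OF f(1,7) A' k x] that by (simp add: adjoint_op_def)
    have adj_q: "hip ?E1 (?q v) w = hip ?E1 v (?q' w)" if "v \<in> hcar ?E1" "w \<in> hcar ?E1" for v w
      using symbol_adjoint[OF f(4) Q Q' k x1] that by (simp add: adjoint_op_def)
    obtain h C where C: "C > 0"
      and h_in: "\<And>w. w \<in> hcar ?E1 \<Longrightarrow> ?p1 w = w \<Longrightarrow> h w \<in> hcar ?E0"
      and hC: "\<And>w. w \<in> hcar ?E1 \<Longrightarrow> ?p1 w = w \<Longrightarrow> hnorm ?E0 (h w) \<le> C * hnorm ?E1 w"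
      and ah: "\<And>w. w \<in> hcar ?E1 \<Longrightarrow> ?p1 w = w \<Longrightarrow> ?a (h w) = w"
      using toeplitz_iso_fibre[OF k x iso[OF k]] by metis
    obtain B where B: "B > 0" "\<And>w. w \<in> hcar ?E1 \<Longrightarrow> hnorm ?E1 (?p1 w) \<le> B * hnorm ?E1 w"
      using bounded_op_bound[OF E1 bp1] by blast
    have "hnorm ?E1 w \<le> (C * B + 1) * (hnorm ?E0 (?a' w) + hnorm ?E1 (?q' w))" if w: "w \<in> hcar ?E1" for w
    proof (cases "w = 0")
      case True
      then show ?thesis
        using C B(1) w hnorm_ge_0[OF E0] hnorm_ge_0[OF E1] b_in(2,4) by (simp add: hnorm_zero[OF E1])
    next
      case False
      have pw: "?p1 w \<in> hcar ?E1" "?p1 (?p1 w) = ?p1 w"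
        using bounded_op_in[OF bp1 w] projection_fibre[OF sym.bundles[OF k f(4)] symbol_projection[OF k f(4,6)]] by auto
      note hw = h_in[OF pw]
      have n0: "0 \<le> hnorm ?E0 (?a' w)" "0 \<le> hnorm ?E1 (?q' w)" "0 \<le> hnorm ?E1 w"
        by (rule hnorm_ge_0[OF E0 b_in(2)[OF w]], rule hnorm_ge_0[OF E1 b_in(4)[OF w]], rule hnorm_ge_0[OF E1 w])
      \<comment> \<open>Duality: pairing this decomposition with \<open>w\<close> and moving the
        symbols of \<open>A\<close> and \<open>Q\<close> to the other side leaves one factor of the
        norm of \<open>w\<close> in each term. It cancels against the squared norm on the left,
        since \<open>w\<close> is nonzero here.\<close>
      have "w = ?a (h (?p1 w)) + ?q w"
        by (simp add: ah[OF pw] q[OF w])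
      then have "hip ?E1 w w = hip ?E1 (?a (h (?p1 w)) + ?q w) w"
        by simp
      also have "\<dots> = hip ?E0 (h (?p1 w)) (?a' w) + hip ?E1 w (?q' w)"
        by (simp add: hip_add_left[OF E1 b_in(1)[OF hw] b_in(3)[OF w] w] adj[OF hw w] adj_q[OF w w])
      finally have "cmod (hip ?E1 w w) \<le> cmod (hip ?E0 (h (?p1 w)) (?a' w)) + cmod (hip ?E1 w (?q' w))"
        by (simp add: norm_triangle_ineq)
      also have "\<dots> \<le> hnorm ?E0 (h (?p1 w)) * hnorm ?E0 (?a' w) + hnorm ?E1 w * hnorm ?E1 (?q' w)"
        by (intro add_mono hip_cauchy_schwarz[OF E0 hw b_in(2)[OF w]] hip_cauchy_schwarz[OF E1 w b_in(4)[OF w]])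
      also have "\<dots> \<le> (C * (B * hnorm ?E1 w)) * hnorm ?E0 (?a' w) + hnorm ?E1 w * hnorm ?E1 (?q' w)"
        using order_trans[OF hC[OF pw] mult_left_mono[OF B(2)[OF w] less_imp_le[OF C]]] n0(1)
        by (intro add_right_mono mult_right_mono)
      finally have "hnorm ?E1 w * hnorm ?E1 w \<le> hnorm ?E1 w * (C * B * hnorm ?E0 (?a' w) + hnorm ?E1 (?q' w))"
        by (simp add: hip_self[OF E1 w] norm_mult power2_eq_square algebra_simps)
      moreover have "hnorm ?E1 w > 0"
        using False n0(3) hnorm_eq_0[OF E1 w] by simp
      ultimately have "hnorm ?E1 w \<le> C * B * hnorm ?E0 (?a' w) + hnorm ?E1 (?q' w)"
        by simp
      also have "\<dots> \<le> (C * B + 1) * (hnorm ?E0 (?a' w) + hnorm ?E1 (?q' w))"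
        using C B(1) n0 by (simp add: algebra_simps)
      finally show ?thesis .
    qed
    then show "\<exists>c. \<forall>w\<in>hcar ?E1. hnorm ?E1 w \<le> c * (hnorm ?E0 (?a' w) + hnorm ?E1 (?q' w))"
      by blast
  qed
  then obtain D where D: "D \<in> L 0 (g\<^sub>1, g\<^sub>1)" and R: "(A \<odot> A' + Q \<odot> Q') \<odot> D - ?I \<in> smoothing L (g\<^sub>1, g\<^sub>1)"
    by (auto simp: elliptic_def)
  define R where "R = (A \<odot> A' + Q \<odot> Q') \<odot> D - ?I"
  define B where "B = P\<^sub>0 \<odot> (A' \<odot> (D \<odot> P\<^sub>1))"
  have B: "B \<in> L 0 (g\<^sub>1, g\<^sub>0)"
    unfolding B_def
    by (rule L0_comp[OF f(2,3) P0(1) L0_comp[OF f(4,2) A'(1) L0_comp[OF f(4,4) D P1(1)]]])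
  have BT: "B \<in> toeplitz L 0 ((g\<^sub>1, P\<^sub>1), (g\<^sub>0, P\<^sub>0))"
    using B P0(2) P1(2) unfolding in_toeplitz_iff[OF toeplitz_adm_refl(3)[OF tadm] order_refl]
    by (simp add: B_def pcomp_assoc) (simp flip: pcomp_assoc)
  have Rs: "R \<in> smoothing L (g\<^sub>1, g\<^sub>1)"
    using R by (simp add: R_def)
  \<comment> \<open>Composition with \<open>P\<^sub>1\<close> on the left removes the auxiliary
    square, because \<open>P\<^sub>1\<close> annihilates \<open>Q\<close>.\<close>
  have N: "P\<^sub>1 \<odot> (A \<odot> A' + Q \<odot> Q') = A \<odot> A'"
    by (simp add: pcomp_add_right[OF f(4,4) L0_comp[OF f(2,1,7) A'(1)] L0_comp[OF f(4,4) Q Q'(1)] P1(1)]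
        f(8) PQ pcomp_zero_left flip: pcomp_assoc)
  have "A \<odot> B = (A \<odot> A') \<odot> D \<odot> P\<^sub>1"
    by (simp add: B_def f(9) flip: pcomp_assoc)
  also have "\<dots> = P\<^sub>1 \<odot> ((R + ?I) \<odot> P\<^sub>1)"
    by (simp add: R_def N flip: pcomp_assoc)
  also have "\<dots> = P\<^sub>1 \<odot> (R \<odot> P\<^sub>1) + P\<^sub>1"
    by (simp add: pcomp_add_left id_pcomp[OF f(4) P1(1)] P1(2)
        pcomp_add_right[OF f(4,4) L0_comp[OF f(4,4) smoothing_L0[OF Rs] P1(1)] P1(1) P1(1)])
  finally have "A \<odot> B - P\<^sub>1 = P\<^sub>1 \<odot> (R \<odot> P\<^sub>1)"
    by simp
  then have "A \<odot> B - P\<^sub>1 \<in> smoothing L (g\<^sub>1, g\<^sub>1)"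
    by (simp add: smoothing_pcomp_right[OF f(4,4) P1(1) smoothing_pcomp_left[OF f(4,4) Rs P1(1)]])
  with BT show thesis
    by (rule that)
qed

text \<open>A left and a right parametrix differ by a smoothing operator, as with one-sided inverses
  in a ring. So the left parametrix is also a right one.\<close>

lemma toeplitz_ellipticI:
  assumes iso: "\<And>k. k \<in> {1..n} \<Longrightarrow> bundle_iso (toeplitz_bundle E \<sigma> k (g\<^sub>0, P\<^sub>0)) (toeplitz_bundle E \<sigma> k (g\<^sub>1, P\<^sub>1))
      (toeplitz_symbol E \<sigma> k ((g\<^sub>0, P\<^sub>0), (g\<^sub>1, P\<^sub>1)) A)"
  shows "toeplitz_elliptic L ((g\<^sub>0, P\<^sub>0), (g\<^sub>1, P\<^sub>1)) A"
proof -
  note f = toeplitz_facts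
  note P0 = projectionD[OF f(5)] and P1 = projectionD[OF f(6)] and ta = toeplitz_adm_refl[OF tadm]
  obtain B where B: "B \<in> toeplitz L 0 ((g\<^sub>1, P\<^sub>1), (g\<^sub>0, P\<^sub>0))" and BA: "B \<odot> A - P\<^sub>0 \<in> smoothing L (g\<^sub>0, g\<^sub>0)"
    by (rule toeplitz_left_parametrix[OF iso])
  obtain B' where B': "B' \<in> toeplitz L 0 ((g\<^sub>1, P\<^sub>1), (g\<^sub>0, P\<^sub>0))" and AB': "A \<odot> B' - P\<^sub>1 \<in> smoothing L (g\<^sub>1, g\<^sub>1)"
    by (rule toeplitz_right_parametrix[OF iso])
  have b: "B \<in> L 0 (g\<^sub>1, g\<^sub>0)" "P\<^sub>0 \<odot> B = B" "B \<odot> P\<^sub>1 = B" and b': "B' \<in> L 0 (g\<^sub>1, g\<^sub>0)" "P\<^sub>0 \<odot> B' = B'"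
    using B B' by (simp_all add: in_toeplitz_iff[OF ta(3)])
  define R0 where "R0 = B \<odot> A - P\<^sub>0"
  define R1 where "R1 = A \<odot> B' - P\<^sub>1"
  have R0: "R0 \<in> smoothing L (g\<^sub>0, g\<^sub>0)" and R1: "R1 \<in> smoothing L (g\<^sub>1, g\<^sub>1)"
    using BA AB' by (simp_all add: R0_def R1_def)
  have AB'0: "A \<odot> B' \<in> L 0 (g\<^sub>1, g\<^sub>1)"
    by (rule L0_comp[OF f(2,1,7) b'(1)])
  \<comment> \<open>The product B A B' is evaluated in two ways: bracketed to the right it is B plus
    a smoothing term, to the left it is B' plus a smoothing term.\<close>
  have "B \<odot> R1 = B \<odot> (A \<odot> B') - B"
    unfolding R1_def pcomp_diff_right[OF f(4,2) AB'0 P1(1) b(1)] b(3) ..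
  also have "B \<odot> (A \<odot> B') = (R0 + P\<^sub>0) \<odot> B'"
    by (simp add: R0_def pcomp_assoc)
  also have "\<dots> = R0 \<odot> B' + B'"
    by (simp add: pcomp_add_left b'(2))
  finally have B_eq: "B = B' + (R0 \<odot> B' - B \<odot> R1)"
    by (simp add: fun_eq_iff)
  let ?S = "R0 \<odot> B' - B \<odot> R1"
  have S: "?S \<in> smoothing L (g\<^sub>1, g\<^sub>0)"
    by (intro smoothing_diff[OF f(2)] smoothing_pcomp_left[OF f(2,3) R0 b'(1)] smoothing_pcomp_right[OF f(4,2) b(1) R1])
  have "A \<odot> B = A \<odot> B' + A \<odot> ?S"
    by (subst B_eq) (rule pcomp_add_right[OF f(2,1) b'(1) smoothing_L0[OF S] f(7)])
  then have "A \<odot> B - P\<^sub>1 = R1 + A \<odot> ?S"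
    by (simp add: R1_def)
  then have AB: "A \<odot> B - P\<^sub>1 \<in> smoothing L (g\<^sub>1, g\<^sub>1)"
    using smoothing_add[OF f(4) R1 smoothing_pcomp_right[OF f(2,1,7) S]] by simp
  have AB0: "A \<odot> B \<in> L 0 (g\<^sub>1, g\<^sub>1)" and BA0: "B \<odot> A \<in> L 0 (g\<^sub>0, g\<^sub>0)"
    by (rule L0_comp[OF f(2,1,7) b(1)], rule L0_comp[OF f(1,2) b(1) f(7)])
  \<comment> \<open>What remains is that the remainder lies in the corner of
    \<open>P\<^sub>0\<close>: the outer factors satisfy \<open>P\<^sub>0 \<odot> B = B\<close> and
    \<open>A \<odot> P\<^sub>0 = A\<close>.\<close>
  have "B \<odot> A - P\<^sub>0 \<in> smoothing (toeplitz L) ((g\<^sub>0, P\<^sub>0), (g\<^sub>0, P\<^sub>0))"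
    unfolding in_smoothing_toeplitz_iff[OF ta(1)]
    by (intro conjI BA; simp add: pcomp_diff_right[OF f(3,3) BA0 P0(1) P0(1)] pcomp_diff_left P0(2) pcomp_assoc f(9))
      (simp add: b(2) flip: pcomp_assoc)
  moreover have "A \<odot> B - P\<^sub>1 \<in> smoothing (toeplitz L) ((g\<^sub>1, P\<^sub>1), (g\<^sub>1, P\<^sub>1))"
    unfolding in_smoothing_toeplitz_iff[OF ta(2)]
    by (intro conjI AB; simp add: pcomp_diff_right[OF f(4,4) AB0 P1(1) P1(1)] pcomp_diff_left P1(2) pcomp_assoc b(3))
      (simp add: f(8) flip: pcomp_assoc)
  ultimately show ?thesis
    using A B by (auto simp: toeplitz_elliptic_def)
qed

end

end

section \<open>The symbol axioms for the Toeplitz algebra\<close>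

lemma restrict_morphism_add: "restrict_morphism R (f + g) = restrict_morphism R f + restrict_morphism R g"
  by (simp add: restrict_morphism_def fun_eq_iff)

lemma restrict_morphism_scale: "restrict_morphism R (c *\<^sub>C f) = c *\<^sub>C restrict_morphism R f"
  by (simp add: restrict_morphism_def fun_eq_iff scaleC_fun_def)

lemma restrict_morphism_zero: "restrict_morphism R 0 = 0"
  by (simp add: restrict_morphism_def fun_eq_iff)

context star_sigma_algebra
begin

text \<open>Restrictions compose because the symbol of \<open>A\<close> maps the range for
  \<open>P\<^sub>0\<close> into that for \<open>P\<^sub>1\<close>, so the outer restriction acts as
  the full symbol of \<open>B\<close> there.\<close>

lemma toeplitz_symbol_comp:
  assumes k: "k \<in> {1..n}"
    and ab: "((g\<^sub>0, P\<^sub>0), (g\<^sub>1, P\<^sub>1)) \<in> toeplitz_adm adm L" and bc: "((g\<^sub>1, P\<^sub>1), (g\<^sub>2, P\<^sub>2)) \<in> toeplitz_adm adm L"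
    and A: "A \<in> toeplitz L 0 ((g\<^sub>0, P\<^sub>0), (g\<^sub>1, P\<^sub>1))" and B: "B \<in> toeplitz L 0 ((g\<^sub>1, P\<^sub>1), (g\<^sub>2, P\<^sub>2))"
  shows "toeplitz_symbol E \<sigma> k ((g\<^sub>0, P\<^sub>0), (g\<^sub>2, P\<^sub>2)) (B \<odot> A)
    = toeplitz_symbol E \<sigma> k ((g\<^sub>1, P\<^sub>1), (g\<^sub>2, P\<^sub>2)) B \<odot> toeplitz_symbol E \<sigma> k ((g\<^sub>0, P\<^sub>0), (g\<^sub>1, P\<^sub>1)) A"
proof (intro ext)
  fix x v
  note fA = toeplitz_facts[OF ab A] and fB = toeplitz_facts[OF bc B]
  let ?R0 = "range_fibre (E k g\<^sub>0) (\<sigma> k (g\<^sub>0, g\<^sub>0) P\<^sub>0) x" and ?R1 = "range_fibre (E k g\<^sub>1) (\<sigma> k (g\<^sub>1, g\<^sub>1) P\<^sub>1) x"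
  have base: "base (E k g\<^sub>1) = base (E k g\<^sub>0)"
    by (rule base_eq[OF k fA(1)])
  \<comment> \<open>Outside the range fibre the inner restriction returns 0, which the outer one
    must preserve.\<close>
  have "\<sigma> k (g\<^sub>1, g\<^sub>2) B x 0 = 0"
    using bundle_morphismD(2,3)[OF sym.morphism[OF k fB(1,7)], of x]
      bounded_op_zero[OF hilbert_bundleD(1)[OF sym.bundles[OF k fB(3)]]] by blast
  moreover have "\<sigma> k (g\<^sub>0, g\<^sub>1) A x v \<in> hcar ?R1" if "x \<in> topspace (base (E k g\<^sub>0))" "v \<in> hcar ?R0"
    using bounded_op_in[OF bundle_morphismD(2)[OF toeplitz_symbol_morphism[OF ab A k], of x], of v] that
    by (simp add: toeplitz_bundle_def toeplitz_symbol_def restrict_morphism_def)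
  ultimately show "toeplitz_symbol E \<sigma> k ((g\<^sub>0, P\<^sub>0), (g\<^sub>2, P\<^sub>2)) (B \<odot> A) x v
    = (toeplitz_symbol E \<sigma> k ((g\<^sub>1, P\<^sub>1), (g\<^sub>2, P\<^sub>2)) B \<odot> toeplitz_symbol E \<sigma> k ((g\<^sub>0, P\<^sub>0), (g\<^sub>1, P\<^sub>1)) A) x v"
    by (simp add: toeplitz_bundle_def toeplitz_symbol_def restrict_morphism_def pcomp_apply base
        sym.multiplicative[OF k fA(1) fB(1) fA(7) fB(7)])
qed

text \<open>Smoothing operators have symbol 0, so \<open>C\<close> and \<open>P\<close> have the
  same symbol, and a projection acts as the identity on its own range. This turns parametrix
  relations into exact inverse relations between symbols.\<close>

lemma toeplitz_symbol_identity_mod_smoothing: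
  assumes k: "k \<in> {1..n}" and gP: "((g, P), (g, P)) \<in> toeplitz_adm adm L"
    and C: "C - P \<in> smoothing (toeplitz L) ((g, P), (g, P))"
  shows "toeplitz_symbol E \<sigma> k ((g, P), (g, P)) C = bundle_id (toeplitz_bundle E \<sigma> k (g, P))"
proof -
  have g: "(g, g) \<in> adm" and P: "projection L g P"
    using gP by (auto simp: in_toeplitz_adm_iff)
  have R: "C - P \<in> smoothing L (g, g)"
    using C by (simp add: in_smoothing_toeplitz_iff[OF gP])
  note s = sym.bundles[OF k g] symbol_projection[OF k g P]
  have eq: "\<sigma> k (g, g) C = \<sigma> k (g, g) P"
    using sym.add[OF k g smoothing_L0[OF R] projectionD(1)[OF P]] sym.vanishing[OF k g R] by simp
  show ?thesis
    by (auto simp: fun_eq_iff toeplitz_symbol_def toeplitz_bundle_def restrict_morphism_def bundle_id_def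
        id_op_def eq in_range_fibre[OF s])
qed

lemma toeplitz_symbol_map:
  "symbol_map (toeplitz_adm adm L) (toeplitz L 0) (smoothing (toeplitz L)) (toeplitz_elliptic L)
    n (toeplitz_bundle E \<sigma>) (toeplitz_symbol E \<sigma>)"
proof (unfold_locales, goal_cases)
  case (1 k a)
  obtain g P where a: "a = (g, P)"
    by fastforce
  show ?case
    using 1 unfolding a toeplitz_bundle_def in_toeplitz_adm_iff prod.case
    by (intro hilbert_bundle_range_bundle sym.bundles symbol_projection) auto
next
  case (2 k a b A)
  then show ?case
    by (cases a, cases b) (simp add: toeplitz_symbol_morphism del: atLeastAtMost_iff)
next
  case (3 k a b A B)
  obtain g\<^sub>0 P\<^sub>0 g\<^sub>1 P\<^sub>1 where ab: "a = (g\<^sub>0, P\<^sub>0)" "b = (g\<^sub>1, P\<^sub>1)"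
    by fastforce
  note f = toeplitz_facts[OF 3(2)[unfolded ab]]
  show ?case
    using sym.add[OF 3(1) f(1,7,7)] 3(3,4)
    by (simp add: ab toeplitz_symbol_def restrict_morphism_add)
next
  case (4 k a b A z)
  obtain g\<^sub>0 P\<^sub>0 g\<^sub>1 P\<^sub>1 where ab: "a = (g\<^sub>0, P\<^sub>0)" "b = (g\<^sub>1, P\<^sub>1)"
    by fastforce
  note f = toeplitz_facts[OF 4(2,3)[unfolded ab]]
  show ?case
    using sym.scale[OF 4(1) f(1,7)] by (simp add: ab toeplitz_symbol_def restrict_morphism_scale)
next
  case (5 k a b c A B)
  then show ?case
    by (cases a, cases b, cases c) (simp add: toeplitz_symbol_comp del: atLeastAtMost_iff)
next
  case (6 k a b R)
  obtain g\<^sub>0 P\<^sub>0 g\<^sub>1 P\<^sub>1 where ab: "a = (g\<^sub>0, P\<^sub>0)" "b = (g\<^sub>1, P\<^sub>1)"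
    by fastforce
  have "(g\<^sub>0, g\<^sub>1) \<in> adm" "R \<in> smoothing L (g\<^sub>0, g\<^sub>1)"
    using 6(2,3) by (auto simp: ab in_toeplitz_adm_iff in_smoothing_toeplitz_iff)
  then show ?case
    using sym.vanishing[OF 6(1)] by (simp add: ab toeplitz_symbol_def restrict_morphism_zero)
next
  case (7 a b A)
  obtain g\<^sub>0 P\<^sub>0 g\<^sub>1 P\<^sub>1 where ab: "a = (g\<^sub>0, P\<^sub>0)" "b = (g\<^sub>1, P\<^sub>1)"
    by fastforce
  note tadm = 7(1)[unfolded ab] and A = 7(2)[unfolded ab]
  note ta = toeplitz_adm_refl[OF tadm]
  show ?case
    unfolding ab
  proof
    assume "toeplitz_elliptic L ((g\<^sub>0, P\<^sub>0), (g\<^sub>1, P\<^sub>1)) A"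
    then obtain B where B: "B \<in> toeplitz L 0 ((g\<^sub>1, P\<^sub>1), (g\<^sub>0, P\<^sub>0))"
      and BA: "B \<odot> A - P\<^sub>0 \<in> smoothing (toeplitz L) ((g\<^sub>0, P\<^sub>0), (g\<^sub>0, P\<^sub>0))"
      and AB: "A \<odot> B - P\<^sub>1 \<in> smoothing (toeplitz L) ((g\<^sub>1, P\<^sub>1), (g\<^sub>1, P\<^sub>1))"
      by (auto simp: toeplitz_elliptic_def)
    show "\<forall>k\<in>{1..n}. bundle_iso (toeplitz_bundle E \<sigma> k (g\<^sub>0, P\<^sub>0)) (toeplitz_bundle E \<sigma> k (g\<^sub>1, P\<^sub>1))
        (toeplitz_symbol E \<sigma> k ((g\<^sub>0, P\<^sub>0), (g\<^sub>1, P\<^sub>1)) A)"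
    proof
      fix k assume k: "k \<in> {1..n}"
      \<comment> \<open>The symbol of the parametrix is the two-sided inverse of the symbol of
        \<open>A\<close>, since the smoothing errors vanish on the symbol level.\<close>
      let ?b = "toeplitz_symbol E \<sigma> k ((g\<^sub>1, P\<^sub>1), (g\<^sub>0, P\<^sub>0)) B"
      show "bundle_iso (toeplitz_bundle E \<sigma> k (g\<^sub>0, P\<^sub>0)) (toeplitz_bundle E \<sigma> k (g\<^sub>1, P\<^sub>1))
          (toeplitz_symbol E \<sigma> k ((g\<^sub>0, P\<^sub>0), (g\<^sub>1, P\<^sub>1)) A)"
        unfolding bundle_iso_def
        using toeplitz_symbol_morphism[OF tadm A k] toeplitz_symbol_morphism[OF ta(3) B k]
          toeplitz_symbol_comp[OF k tadm ta(3) A B] toeplitz_symbol_comp[OF k ta(3) tadm B A]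
          toeplitz_symbol_identity_mod_smoothing[OF k ta(1) BA] toeplitz_symbol_identity_mod_smoothing[OF k ta(2) AB]
        by (intro conjI exI[of _ ?b]) simp_all
    qed
  next
    assume "\<forall>k\<in>{1..n}. bundle_iso (toeplitz_bundle E \<sigma> k (g\<^sub>0, P\<^sub>0)) (toeplitz_bundle E \<sigma> k (g\<^sub>1, P\<^sub>1))
        (toeplitz_symbol E \<sigma> k ((g\<^sub>0, P\<^sub>0), (g\<^sub>1, P\<^sub>1)) A)"
    then show "toeplitz_elliptic L ((g\<^sub>0, P\<^sub>0), (g\<^sub>1, P\<^sub>1)) A"
      by (intro toeplitz_ellipticI[OF tadm A]) blast
  qed
qed

end

theorem theorem3p18:
  fixes \<Lambda> :: "'l::euclidean_space set"
    and H :: "'g \<Rightarrow> nat \<Rightarrow> 'h::complex_vector hilbert"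
    and adm :: "('g \<times> 'g) set"
    and L :: "int \<Rightarrow> 'g \<times> 'g \<Rightarrow> ('l, 'h) family set"
    and n :: nat
    and E :: "nat \<Rightarrow> 'g \<Rightarrow> ('x, 'f::complex_vector) hbundle"
    and \<sigma> :: "nat \<Rightarrow> 'g \<times> 'g \<Rightarrow> ('l, 'h) family \<Rightarrow> 'x \<Rightarrow> 'f \<Rightarrow> 'f"
  assumes "operator_algebra \<Lambda> H adm L"
    and "inverse_closed \<Lambda> H adm L"
    and "star_closed \<Lambda> H adm L"
    and "symbol_sigma_algebra \<Lambda> H adm L n E \<sigma>"
  shows "toeplitz_inverse_closed \<Lambda> adm L \<and> toeplitz_sigma_algebra adm L n E \<sigma>"
proof
  show "toeplitz_inverse_closed \<Lambda> adm L"
    by (rule operator_algebra.toeplitz_inverse_closed[OF assms(1,2)])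
  interpret operator_algebra \<Lambda> H adm L
    by (rule assms(1))
  interpret sym: symbol_map adm "L 0" "smoothing L" "elliptic \<Lambda> H L" n E \<sigma>
    using assms(4) by (simp add: symbol_sigma_algebra_def)
  have "star_sigma_algebra \<Lambda> H adm L n E \<sigma>"
  proof
    show "star_closed \<Lambda> H adm L"
      by (rule assms(3))
  qed (use assms(3,4) in \<open>unfold symbol_sigma_algebra_def, blast\<close>)
  then show "toeplitz_sigma_algebra adm L n E \<sigma>"
    unfolding toeplitz_sigma_algebra_def by (rule star_sigma_algebra.toeplitz_symbol_map)
qed

end
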